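(* There exist absolute constants $C,C'>0$ such that the following holds. Let $\beta^*\in\mathbb R^d$, $\mathbf X\in\mathbb R^{n\times d}$ with i.i.d. $N(0,1)$ entries, and $\eta\in\mathbb R^n$ deterministic with $|\{i:|\eta_i|\le1\}|\ge\alpha n$ for some $\alpha\in(0,1]$; let $\mathbf y=\mathbf X\beta^*+\eta$. Suppose $\Delta\ge3(1+\|\beta^*\|)$, $\epsilon\in(0,1/2]$ and $n\ge C\cdot\frac{d\ln\Delta}{\alpha^2}\big(\ln(d/\epsilon)+\ln\ln\Delta\big)$. Let $\hat\beta$ be the output of the Bootstrapped Median Algorithm on input $(\mathbf y,\mathbf X,\Delta)$. Then with probability at least $1-\epsilon$, \[\tfrac1n\|\mathbf X(\beta^*-\hat\beta)\|^2\le C'\cdot\frac{d\log(d/\epsilon)}{\alpha^2 n}.\]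
   Context: Coordinate-wise Median Algorithm on input $(y,X)\in\mathbb R^m\times\mathbb R^{m\times d}$: sample fresh independent $w_i\sim N(0,1)$ and Rademacher signs $\sigma_i$ ($i\in[m]$), independent of everything else, and set $y'_i=\sigma_iy_i+w_i$, $X'_{i,\cdot}=\sigma_iX_{i,\cdot}$. For each $j\in[d]$ let $M_j=\{i:|X'_{ij}|\ge1/2\}$ and let $\hat\beta_j$ be the median of $\{y'_i/X'_{ij}: i\in M_j\}$. Output $\hat\beta=(\hat\beta_1,\dots,\hat\beta_d)$. Bootstrapped Median Algorithm on input $(y,X,\Delta)$, $\Delta\ge3$: let $t=\lceil\ln\Delta\rceil$; partition $[n]$ uniformly at random into disjoint sets $S_1,\dots,S_t$ (plus possibly leftover indices) with $|S_1|=\dots=|S_{t-1}|=\lfloor n/(2t)\rfloor$ and $|S_t|=\lfloor n/2\rfloor$. For $i=1,\dots,t$ run the Coordinate-wise Median Algorithm on $\big(y_{S_i}-X_{S_i}\sum_{j<i}\hat\beta^{(j)},\,X_{S_i}\big)$ and call the output $\hat\beta^{(i)}$. Output $\hat\beta=\sum_{i=1}^t\hat\beta^{(i)}$. Here $y_S$, $X_S$ denote the restrictions to the entries/rows in $S$. *)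

theory Defs
  imports "HOL-Probability.Probability" "HOL-Library.Multiset" "HOL-Combinatorics.Permutations"
begin

definition std_gauss :: "real measure" where
  "std_gauss = density lborel std_normal_density"

definition rademacher :: "real measure" where
  "rademacher = measure_pmf (pmf_of_set {-1, 1})"

(* Median of a finite multiset of reals: lower median (element of rank ceil(m/2));
   the empty multiset gets the conventional value 0. *)
definition median :: "real multiset \<Rightarrow> real" where
  "median A = (if A = {#} then 0
               else sorted_list_of_multiset A ! ((size A - 1) div 2))"

(* Coordinate-wise Median Algorithm run on the rows S of (y, X); vectors in R^d are
   functions nat => real (coordinates j < d), the rows of X are indexed by i in S.
   w and s are the fresh Gaussian noise and Rademacher signs of this call. *)
definition cwm_alg :: "nat \<Rightarrow> nat set \<Rightarrow> (nat \<Rightarrow> real) \<Rightarrow> (nat \<Rightarrow> nat \<Rightarrow> real)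
    \<Rightarrow> (nat \<Rightarrow> real) \<Rightarrow> (nat \<Rightarrow> real) \<Rightarrow> (nat \<Rightarrow> real)" where
  "cwm_alg d S y X w s = (\<lambda>j. if j < d then
      median (image_mset (\<lambda>i. (s i * y i + w i) / (s i * X i j))
               (filter_mset (\<lambda>i. \<bar>s i * X i j\<bar> \<ge> 1/2) (mset_set S)))
    else 0)"

(* The random partition: a uniformly random permutation p of {..<n}; block i (0-based,
   i < t) is the image under p of consecutive positions; blocks 0..t-2 have size
   floor(n/(2t)), block t-1 has size floor(n/2). *)
definition part_set :: "nat \<Rightarrow> nat \<Rightarrow> (nat \<Rightarrow> nat) \<Rightarrow> nat \<Rightarrow> nat set" where
  "part_set n t p i = p ` (if i + 1 < t
      then {i * (n div (2*t)) ..< (i+1) * (n div (2*t))}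
      else {(t-1) * (n div (2*t)) ..< (t-1) * (n div (2*t)) + n div 2})"

primrec boot_acc :: "nat \<Rightarrow> nat \<Rightarrow> nat \<Rightarrow> (nat \<Rightarrow> real) \<Rightarrow> (nat \<Rightarrow> nat \<Rightarrow> real)
    \<Rightarrow> (nat \<Rightarrow> nat \<Rightarrow> real) \<Rightarrow> (nat \<Rightarrow> nat \<Rightarrow> real) \<Rightarrow> (nat \<Rightarrow> nat)
    \<Rightarrow> nat \<Rightarrow> (nat \<Rightarrow> real)" where
  "boot_acc d n t y X w s p 0 = (\<lambda>_. 0)"
| "boot_acc d n t y X w s p (Suc i) =
     (let b = boot_acc d n t y X w s p i;
          bi = cwm_alg d (part_set n t p i) (\<lambda>k. y k - (\<Sum>l<d. X k l * b l)) X (w i) (s i)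
      in (\<lambda>j. b j + bi j))"

definition boot_t :: "real \<Rightarrow> nat" where
  "boot_t \<Delta> = nat \<lceil>ln \<Delta>\<rceil>"

definition boot_median :: "nat \<Rightarrow> nat \<Rightarrow> real \<Rightarrow> (nat \<Rightarrow> real) \<Rightarrow> (nat \<Rightarrow> nat \<Rightarrow> real)
    \<Rightarrow> (nat \<Rightarrow> nat \<Rightarrow> real) \<Rightarrow> (nat \<Rightarrow> nat \<Rightarrow> real) \<Rightarrow> (nat \<Rightarrow> nat) \<Rightarrow> (nat \<Rightarrow> real)" where
  "boot_median d n \<Delta> y X w s p = boot_acc d n (boot_t \<Delta>) y X w s p (boot_t \<Delta>)"

(* Joint probability space: design matrix X (n x d, iid N(0,1)), Gaussian noise w
   (t stages x n rows, iid N(0,1)), Rademacher signs s (t x n, iid), and a uniformly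
   random permutation p of {..<n}; all independent. *)
definition boot_space :: "nat \<Rightarrow> nat \<Rightarrow> nat \<Rightarrow>
    ((nat \<Rightarrow> nat \<Rightarrow> real) \<times> (nat \<Rightarrow> nat \<Rightarrow> real) \<times> (nat \<Rightarrow> nat \<Rightarrow> real) \<times> (nat \<Rightarrow> nat)) measure" where
  "boot_space n d t =
     (\<Pi>\<^sub>M i\<in>{..<n}. \<Pi>\<^sub>M j\<in>{..<d}. std_gauss) \<Otimes>\<^sub>M
     ((\<Pi>\<^sub>M i\<in>{..<t}. \<Pi>\<^sub>M k\<in>{..<n}. std_gauss) \<Otimes>\<^sub>M
     ((\<Pi>\<^sub>M i\<in>{..<t}. \<Pi>\<^sub>M k\<in>{..<n}. rademacher) \<Otimes>\<^sub>M
      measure_pmf (pmf_of_set {p. p permutes {..<n}})))"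

end

theory Submission
  imports Defs
begin

text \<open>
  Let \<open>r\<close> be the error before a stage. Since the rows, noise and signs of the stage are fresh, in
  coordinate \<open>j\<close> the ratios minus \<open>r\<^sub>j\<close> are \<open>z / x\<close> with \<open>x\<close> standard normal and independent of
  \<open>z \<sim> N(\<plusminus>\<eta>\<^sub>k, 1 + \<Sum>\<^sub>l\<^sub>\<noteq>\<^sub>j r\<^sub>l\<^sup>2)\<close>. They are symmetric, and if \<open>\<bar>\<eta>\<^sub>k\<bar> \<le> 1\<close> they lie within
  \<open>\<theta> sqrt (1 + \<bar>r\<bar>\<^sup>2)\<close> of \<open>0\<close> with probability of order \<open>\<theta>\<close>. By Chernoff's method the median of \<open>m\<close>
  ratios leaves that window with probability at most \<open>2 exp (- c m \<theta>\<^sup>2 \<alpha>\<^sup>2)\<close>, so the new error satisfies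
  \<open>\<bar>r'\<bar>\<^sup>2 \<le> d \<theta>\<^sup>2 (1 + \<bar>r\<bar>\<^sup>2)\<close>. The short stages use \<open>\<theta> = 1 / (4 sqrt d)\<close> and bring the error down to a
  constant; the long last stage uses \<open>\<theta>\<^sup>2\<close> of order \<open>ln (d / \<epsilon>) / (\<alpha>\<^sup>2 n)\<close>.
  The random partition preserves the proportion of good rows by the Chernoff bound for sampling
  without replacement, and the operator norm of the whole design, which depends on the estimate,
  is bounded uniformly by a net argument.
\<close>

section \<open>Sampling without replacement\<close>

text \<open>Every stage runs on an error vector that earlier stages have produced. Failure of a
  stage is therefore measured relative to the current error \<open>r\<close>, as a deviation above
  \<theta> sqrt (1 + |r|^2) in some coordinate. The probability bound holds for each fixed
  \<open>r\<close>, so the stages combine by a union bound without conditioning on earlier success,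
  and the decay of the error is a deterministic consequence of no stage failing.

  The standard normal density is at least 1/10 on [-3/2, 3/2]. This is used twice, for denominators
  in [1/2, 3/2] and for numerators near 0, so with Chernoff parameter l a good row gains l \<theta>
  / 100 in the exponent, while every row costs l^2. Only the good rows, at least a fraction
  \<alpha>/2 of the block, produce a gain; this is the source of the factor \<alpha>^2.

  A short stage has d \<theta>^2 = 1/16 and thus divides the squared error by 16 up to an additive
  constant. Initially the squared error is at most \<Delta>^2/9, and \<Delta>^2 \<le> exp (2 t)
  \<le> 9^t, so t - 1 short stages suffice.\<close>

lemma exp_le_quadratic:
  fixes x :: real assumes "\<bar>x\<bar> \<le> 1" shows "exp x \<le> 1 + x + x\<^sup>2"
proof (cases "x \<ge> 0")
  case True then show ?thesis using assms exp_bound by auto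
next
  case False
  define y where "y = - x"
  have y: "0 \<le> y" "y \<le> 1" using False assms by (auto simp: y_def)
  \<comment> \<open>The product equals 1 + y^3.\<close>
  have "1 \<le> (1 - y + y\<^sup>2) * (1 + y)"
    using y by (simp add: algebra_simps power2_eq_square)
  also have "\<dots> \<le> (1 - y + y\<^sup>2) * exp y"
    by (intro mult_left_mono exp_ge_add_one_self) (use y in \<open>auto intro: add_increasing2\<close>)
  finally have "exp (-y) \<le> 1 - y + y\<^sup>2"
    by (simp add: exp_minus field_simps)
  then show ?thesis by (simp add: y_def)
qed

text \<open>Double counting of the pairs (p, y) with p mapping \<open>T\<close> into
  \<open>B\<close>, y outside \<open>T\<close> and p y in \<open>B\<close>. By symmetry every y
  contributes as much as \<open>x\<close>, and every such p admits exactly card B - card T values of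
  y. In terms of sampling this is the conditional probability that the next draw hits
  \<open>B\<close>.\<close>

lemma card_permutes_image_insert:
  assumes x: "x \<in> {..<n}" "x \<notin> T" and T: "T \<subseteq> {..<n}" and B: "B \<subseteq> {..<n}"
  shows "card {p. p permutes {..<n} \<and> p ` insert x T \<subseteq> B} * (n - card T)
       = card {p. p permutes {..<n} \<and> p ` T \<subseteq> B} * (card B - card T)"
proof -
  define P where "P = {p. p permutes {..<n} \<and> p ` T \<subseteq> B}"
  have fT: "finite T" using T finite_subset by blast
  have fB: "finite B" using B finite_subset by blast
  have finP: "finite P"
    unfolding P_def by (rule finite_subset[OF _ finite_permutations[of "{..<n}"]]) auto
  \<comment> \<open>Composition with the transposition of \<open>x\<close> and \<open>y\<close>
    fixes \<open>T\<close> pointwise and exchanges the two conditions.\<close>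
  have swap: "card {p\<in>P. p y \<in> B} = card {p\<in>P. p x \<in> B}" if y: "y \<in> {..<n} - T" for y
  proof (rule bij_betw_same_card[of "\<lambda>p. p \<circ> Transposition.transpose x y"])
    have *: "p \<circ> Transposition.transpose x y \<in> P" if "p \<in> P" for p
    proof -
      have "Transposition.transpose x y permutes {..<n}" using x y by (intro permutes_swap_id) auto
      moreover have "Transposition.transpose x y ` T = T"
        using x y by (intro image_cong[where g = id, simplified]) (auto simp: Transposition.transpose_def)
      ultimately show ?thesis using that
        by (auto simp: P_def image_comp[symmetric] intro: permutes_compose)
    qed
    show "bij_betw (\<lambda>p. p \<circ> Transposition.transpose x y) {p\<in>P. p y \<in> B} {p\<in>P. p x \<in> B}"
      by (rule bij_betwI[where g = "\<lambda>p. p \<circ> Transposition.transpose x y"])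
         (use * in \<open>auto simp: o_assoc[symmetric]\<close>)
  qed
  have ins: "{p. p permutes {..<n} \<and> p ` insert x T \<subseteq> B} = {p\<in>P. p x \<in> B}"
    by (auto simp: P_def)
  have "card {p\<in>P. p x \<in> B} * (n - card T) = (\<Sum>y\<in>{..<n}-T. card {p\<in>P. p y \<in> B})"
    using swap by (simp add: card_Diff_subset[OF fT T])
  also have "\<dots> = (\<Sum>y\<in>{..<n}-T. \<Sum>p\<in>P. if p y \<in> B then 1 else 0)"
    using finP by (simp add: sum.If_cases Int_def)
  also have "\<dots> = (\<Sum>p\<in>P. \<Sum>y\<in>{..<n}-T. if p y \<in> B then 1 else 0)"
    by (rule sum.swap)
  also have "\<dots> = (\<Sum>p\<in>P. card B - card T)"
  proof (rule sum.cong[OF refl])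
    fix p assume p: "p \<in> P"
    then have pp: "p permutes {..<n}" and pT: "p ` T \<subseteq> B" by (auto simp: P_def)
    have "p ` {y\<in>{..<n}-T. p y \<in> B} = B - p ` T"
    proof safe
      fix b assume b: "b \<in> B" "b \<notin> p ` T"
      then have "b \<in> {..<n}" using B by auto
      then obtain y where y: "y \<in> {..<n}" "p y = b" using permutes_image[OF pp] by (metis imageE)
      then show "b \<in> p ` {y\<in>{..<n}-T. p y \<in> B}" using b by (intro image_eqI[of _ _ y]) auto
    next
      fix y z assume "y \<notin> T" "z \<in> T" "p y = p z"
      then show False using permutes_inj[OF pp] by (metis injD)
    qed
    then have "card {y\<in>{..<n}-T. p y \<in> B} = card (B - p ` T)"
      by (metis card_image permutes_inj_on[OF pp])
    also have "\<dots> = card B - card T"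
      using pT fB fT by (simp add: card_Diff_subset finite_subset card_image permutes_inj_on[OF pp])
    finally show "(\<Sum>y\<in>{..<n}-T. if p y \<in> B then 1 else 0) = card B - card T"
      by (simp add: sum.If_cases Int_def)
  qed
  finally show ?thesis unfolding ins by (simp add: P_def)
qed

text \<open>Draws without replacement are dominated by independent ones: (b - k) / (n - k) \<le> b /
  n for b \<le> n, and for k > b the truncated difference is 0.\<close>

lemma card_permutes_image_le:
  assumes T: "T \<subseteq> {..<n}" and B: "B \<subseteq> {..<n}"
  shows "real (card {p. p permutes {..<n} \<and> p ` T \<subseteq> B}) \<le> fact n * (card B / n) ^ card T"
proof -
  have "finite T" using T finite_subset by blast
  then show ?thesis using T
  proof (induction T rule: finite_induct)
    case empty
    then show ?case by (simp add: card_permutations)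
  next
    case (insert x T)
    have x: "x \<in> {..<n}" "x \<notin> T" "T \<subseteq> {..<n}" using insert by auto
    have cT: "card T < n"
      using psubset_card_mono[of "{..<n}" T] x by auto
    have cB: "card B \<le> n" using card_mono[OF _ B] by simp
    let ?N = "real (card {p. p permutes {..<n} \<and> p ` T \<subseteq> B})"
    let ?N' = "real (card {p. p permutes {..<n} \<and> p ` insert x T \<subseteq> B})"
    have "?N' * real (n - card T) = ?N * real (card B - card T)"
      using card_permutes_image_insert[OF x B, THEN arg_cong[where f = real]] by simp
    then have "?N' = ?N * (real (card B - card T) / real (n - card T))"
      using cT by (simp add: field_simps)
    also have "real (card B - card T) / real (n - card T) \<le> card B / n"
    proof (cases "card T \<le> card B")
      case True
      have "card T * card B \<le> card T * n" using cB by simp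
      then have "real (card T) * card B \<le> real (card T) * n" by (metis of_nat_le_iff of_nat_mult)
      then show ?thesis using True cT by (simp add: of_nat_diff field_simps)
    qed simp
    finally have "?N' \<le> ?N * (card B / n)" by (simp add: mult_left_mono)
    also have "\<dots> \<le> fact n * (card B / n) ^ card T * (card B / n)"
      using insert.IH x by (intro mult_right_mono) auto
    finally show ?case using insert.hyps by (simp add: ac_simps)
  qed
qed

text \<open>The moment generating function of a hypergeometric variable is at most the one of the
  corresponding binomial variable.\<close>

lemma sum_permutes_exp_le:
  assumes Q: "Q \<subseteq> {..<n}" and B: "B \<subseteq> {..<n}" and u: "0 \<le> u"
  shows "(\<Sum>p | p permutes {..<n}. (1 + u) ^ card {q\<in>Q. p q \<in> B}) \<le> fact n * (1 + u * (card B / n)) ^ card Q"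
proof -
  have fQ: "finite Q" using Q by (rule finite_subset) simp
  let ?P = "{p. p permutes {..<n}}"
  have finP: "finite ?P" by (simp add: finite_permutations)
  \<comment> \<open>Expanding the power over subsets of \<open>Q\<close> leaves only joint inclusion
    counts, with coefficients that are nonnegative because u \<ge> 0.\<close>
  have 1: "(1 + u) ^ card {q\<in>Q. p q \<in> B} = (\<Sum>T\<in>Pow Q. if p ` T \<subseteq> B then u ^ card T else 0)" for p
  proof -
    have "(1 + u) ^ card {q\<in>Q. p q \<in> B} = (\<Prod>q\<in>Q. if p q \<in> B then 1 + u else 1)"
      using fQ by (simp add: prod.If_cases Int_def)
    also have "\<dots> = (\<Prod>q\<in>Q. (if p q \<in> B then u else 0) + 1)" by (intro prod.cong) auto
    also have "\<dots> = (\<Sum>T\<in>Pow Q. (\<Prod>q\<in>T. if p q \<in> B then u else 0))"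
      by (subst prod_add[OF fQ]) simp
    also have "\<dots> = (\<Sum>T\<in>Pow Q. if p ` T \<subseteq> B then u ^ card T else 0)"
    proof (rule sum.cong[OF refl])
      fix T assume "T \<in> Pow Q"
      then have fT: "finite T" using fQ finite_subset by blast
      show "(\<Prod>q\<in>T. if p q \<in> B then u else 0) = (if p ` T \<subseteq> B then u ^ card T else 0)"
      proof (cases "p ` T \<subseteq> B")
        case True
        then have "(\<Prod>q\<in>T. if p q \<in> B then u else 0) = (\<Prod>q\<in>T. u)" by (intro prod.cong) auto
        then show ?thesis using True by simp
      next
        case False
        then show ?thesis using fT by (auto intro!: prod_zero)
      qed
    qed
    finally show ?thesis .
  qed
  have "(\<Sum>p\<in>?P. (1 + u) ^ card {q\<in>Q. p q \<in> B}) = (\<Sum>T\<in>Pow Q. \<Sum>p\<in>?P. if p ` T \<subseteq> B then u ^ card T else 0)"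
    unfolding 1 by (rule sum.swap)
  also have "\<dots> = (\<Sum>T\<in>Pow Q. real (card {p. p permutes {..<n} \<and> p ` T \<subseteq> B}) * u ^ card T)"
    using finP by (intro sum.cong) (simp_all add: sum.If_cases Int_def)
  also have "\<dots> \<le> (\<Sum>T\<in>Pow Q. (fact n * (card B / n) ^ card T) * u ^ card T)"
    using Q B u by (intro sum_mono mult_right_mono card_permutes_image_le) auto
  also have "\<dots> = fact n * (\<Sum>T\<in>Pow Q. (\<Prod>q\<in>T. u * (card B / n)))"
    by (simp add: sum_distrib_left power_mult_distrib power_divide mult_ac)
  also have "\<dots> = fact n * (\<Prod>q\<in>Q. u * (card B / n) + 1)"
    by (subst prod_add[OF fQ]) simp
  finally show ?thesis by (simp add: add.commute)
qed

text \<open>The moment bound with u \<ge> 0 controls upper tails only. So too few hits of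
  \<open>G\<close> are read as too many hits of its complement, to which Chernoff's method is
  applied.\<close>

lemma random_subset_tail:
  fixes n :: nat and \<alpha> :: real
  assumes Q: "Q \<subseteq> {..<n}" and G: "G \<subseteq> {..<n}" and \<alpha>: "0 < \<alpha>" "\<alpha> \<le> 1" "real (card G) \<ge> \<alpha> * n" and n: "n > 0"
  shows "measure (measure_pmf (pmf_of_set {p. p permutes {..<n}}))
     {p. real (card (p ` Q \<inter> G)) < \<alpha> / 2 * card Q} \<le> exp (- real (card Q) * \<alpha>\<^sup>2 / 16)"
proof -
  let ?P = "{p. p permutes {..<n}}" let ?m = "card Q"
  \<comment> \<open>Minimiser of l^2 - \<alpha> l / 2, the exponent that the second-order expansion
    below produces; its minimum is -\<alpha>^2/16.\<close>
  define l where "l = \<alpha> / 4"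
  define u where "u = exp l - 1"
  define B where "B = {..<n} - G"
  have l: "0 < l" "l \<le> 1" using \<alpha> by (auto simp: l_def)
  have u: "0 \<le> u" "1 + u = exp l" using l by (auto simp: u_def)
  have fQ: "finite Q" using Q by (rule finite_subset) simp
  have finP: "finite ?P" by (simp add: finite_permutations)
  have neP: "?P \<noteq> {}" by (auto intro!: exI[of _ id] permutes_id)
  have cP: "card ?P = fact n" by (simp add: card_permutations)
  have cB: "real (card B) / n \<le> 1 - \<alpha>"
  proof -
    have "real (card B) = n - real (card G)"
      using G card_mono[OF _ G] by (simp add: B_def card_Diff_subset finite_subset of_nat_diff)
    then show ?thesis using \<alpha> n by (simp add: field_simps)
  qed
  define E where "E = {p\<in>?P. real (card (p ` Q \<inter> G)) < \<alpha> / 2 * ?m}"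
  have ge: "exp (l * ((1 - \<alpha>/2) * ?m)) \<le> (1 + u) ^ card {q\<in>Q. p q \<in> B}" if p: "p \<in> E" for p
  proof -
    have pp: "p permutes {..<n}" using p by (auto simp: E_def)
    have "card (p ` Q \<inter> G) = card (p ` {q\<in>Q. p q \<in> G})" by (rule arg_cong[of _ _ card]) auto
    also have "\<dots> = card {q\<in>Q. p q \<in> G}" by (intro card_image permutes_inj_on[OF pp])
    finally have 1: "card (p ` Q \<inter> G) = card {q\<in>Q. p q \<in> G}" .
    have Qs: "Q = {q\<in>Q. p q \<in> G} \<union> {q\<in>Q. p q \<in> B}"
      using Q permutes_in_image[OF pp] by (auto simp: B_def)
    have "card Q = card {q\<in>Q. p q \<in> G} + card {q\<in>Q. p q \<in> B}"
      by (subst Qs, subst card_Un_disjoint) (use fQ in \<open>auto simp: B_def\<close>)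
    then have "(1 - \<alpha>/2) * ?m \<le> card {q\<in>Q. p q \<in> B}"
      using p 1 by (auto simp: E_def algebra_simps)
    then have "l * ((1 - \<alpha>/2) * ?m) \<le> card {q\<in>Q. p q \<in> B} * l"
      using l by (simp add: mult.commute)
    then show ?thesis unfolding u(2) exp_of_nat_mult[symmetric] by simp
  qed
  have "card E * exp (l * ((1 - \<alpha>/2) * ?m)) \<le> (\<Sum>p\<in>E. (1 + u) ^ card {q\<in>Q. p q \<in> B})"
    using ge by (intro sum_bounded_below[where 'a = real]) auto
  also have "\<dots> \<le> (\<Sum>p\<in>?P. (1 + u) ^ card {q\<in>Q. p q \<in> B})"
    using finP u by (intro sum_mono2) (auto simp: E_def)
  also have "\<dots> \<le> fact n * (1 + u * (card B / n)) ^ ?m"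
    using Q u by (intro sum_permutes_exp_le) (auto simp: B_def)
  also have "\<dots> \<le> fact n * (1 + u * (1 - \<alpha>)) ^ ?m"
    using u cB by (intro mult_left_mono power_mono add_left_mono) auto
  finally have "card E / fact n \<le> (1 + u * (1 - \<alpha>)) ^ ?m * exp (- (l * ((1 - \<alpha>/2) * ?m)))"
    by (simp add: exp_minus field_simps)
  also have "\<dots> = ((1 + u * (1 - \<alpha>)) * exp (- (l * (1 - \<alpha>/2)))) ^ ?m"
    by (simp add: power_mult_distrib exp_of_nat_mult[symmetric] mult_ac)
  also have "\<dots> \<le> exp (- \<alpha>\<^sup>2 / 16) ^ ?m"
  proof (rule power_mono)
    show "0 \<le> (1 + u * (1 - \<alpha>)) * exp (- (l * (1 - \<alpha>/2)))" using u \<alpha> by simp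
    \<comment> \<open>Moment generating function of a Bernoulli variable of mean 1 - \<alpha>,
      centred at 1 - \<alpha>/2; the centred variable has mean -\<alpha>/2.\<close>
    have "(1 + u * (1 - \<alpha>)) * exp (- (l * (1 - \<alpha>/2))) =
        \<alpha> * exp (- (l * (1 - \<alpha>/2))) + (1 - \<alpha>) * exp (l * (\<alpha> / 2))"
    proof -
      have e: "1 + u * (1 - \<alpha>) = \<alpha> + (1 - \<alpha>) * exp l" by (simp add: u_def algebra_simps)
      moreover have "exp l * exp (- (l * (1 - \<alpha>/2))) = exp (l * (\<alpha> / 2))"
        by (simp add: exp_add[symmetric] algebra_simps)
      ultimately show ?thesis by (simp add: distrib_right mult.assoc)
    qed
    also have "\<dots> \<le> exp (- \<alpha>\<^sup>2 / 16)"
    proof -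
      have a: "l * (1 - \<alpha>/2) \<le> 1" "0 \<le> l * (1 - \<alpha>/2)" "l * (\<alpha>/2) \<le> 1" "0 \<le> l * (\<alpha>/2)"
        using \<alpha> l mult_le_one[of l \<alpha>] by (auto intro!: mult_le_one)
      have "\<alpha> * exp (- (l * (1 - \<alpha>/2))) + (1 - \<alpha>) * exp (l * (\<alpha> / 2))
        \<le> \<alpha> * (1 + - (l * (1 - \<alpha>/2)) + (- (l * (1 - \<alpha>/2)))\<^sup>2) + (1 - \<alpha>) * (1 + l * (\<alpha>/2) + (l * (\<alpha>/2))\<^sup>2)"
        using a \<alpha> by (intro add_mono mult_left_mono exp_le_quadratic) auto
      also have "\<dots> \<le> \<alpha> * (1 + - (l * (1 - \<alpha>/2)) + l\<^sup>2) + (1 - \<alpha>) * (1 + l * (\<alpha>/2) + l\<^sup>2)"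
      proof -
        have "(- (l * (1 - \<alpha>/2)))\<^sup>2 \<le> l\<^sup>2" "(l * (\<alpha>/2))\<^sup>2 \<le> l\<^sup>2"
          using \<alpha> l by (auto simp: power_mult_distrib power_le_one intro!: mult_left_le)
        then show ?thesis using \<alpha> l by (intro add_mono mult_left_mono) auto
      qed
      also have "\<dots> = 1 + - \<alpha>\<^sup>2 / 16"
        by (simp add: l_def power2_eq_square field_simps)
      also have "\<dots> \<le> exp (- \<alpha>\<^sup>2 / 16)" by (rule exp_ge_add_one_self)
      finally show ?thesis .
    qed
    finally show "(1 + u * (1 - \<alpha>)) * exp (- (l * (1 - \<alpha>/2))) \<le> exp (- \<alpha>\<^sup>2 / 16)" .
  qed
  also have "\<dots> = exp (- real ?m * \<alpha>\<^sup>2 / 16)" by (simp add: exp_of_nat_mult[symmetric])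
  finally show ?thesis
    using measure_pmf_of_set[OF neP finP] by (simp add: cP E_def Int_def)
qed

section \<open>Order statistics and the median\<close>

text \<open>For a downward closed \<open>P\<close> the entries satisfying it form an initial segment
  of a sorted list.\<close>

lemma sorted_nth_iff_less_length_filter:
  assumes "sorted xs" "i < length xs" and P: "\<And>a b. a \<le> b \<Longrightarrow> P b \<Longrightarrow> P a"
  shows "P (xs ! i) \<longleftrightarrow> i < length (filter P xs)"
  using assms(1,2)
proof (induction xs arbitrary: i)
  case (Cons x xs)
  show ?case
  proof (cases "P x")
    case True
    then show ?thesis using Cons by (cases i) auto
  next
    case False
    then have "\<not> P y" if "y \<in> set (x # xs)" for y
      using that P[of x y] Cons.prems by auto
    then have "filter P (x # xs) = []" by (simp add: filter_empty_conv)
    moreover have "(x # xs) ! i \<in> set (x # xs)" using Cons.prems(2) nth_mem by blast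
    ultimately show ?thesis using \<open>\<And>y. y \<in> set (x # xs) \<Longrightarrow> \<not> P y\<close> by auto
  qed
qed simp

text \<open>A general downward closed \<open>P\<close> serves the weak and the strict inequality at
  once; the upper tail needs the former, the lower tail the latter.\<close>

lemma median_antitone_iff:
  assumes A: "A \<noteq> {#}" and P: "\<And>a b. a \<le> b \<Longrightarrow> P b \<Longrightarrow> P a"
  shows "P (median A) \<longleftrightarrow> (size A - 1) div 2 < size (filter_mset P A)"
proof -
  let ?xs = "sorted_list_of_multiset A"
  have m: "mset ?xs = A" by simp
  then have len: "length ?xs = size A" by (metis size_mset)
  have "0 < size A" using A by (simp add: nonempty_has_size)
  then have "(size A - 1) div 2 < length ?xs" unfolding len by linarith
  then have "P (?xs ! ((size A - 1) div 2)) \<longleftrightarrow> (size A - 1) div 2 < length (filter P ?xs)"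
    by (intro sorted_nth_iff_less_length_filter[OF sorted_sorted_list_of_multiset _ P])
  also have "length (filter P ?xs) = size (filter_mset P A)"
    by (metis m mset_filter size_mset)
  finally show ?thesis using A by (simp add: median_def)
qed

lemma size_filter_image_filter_mset_set:
  assumes "finite S"
  shows "size (filter_mset P (image_mset f (filter_mset Q (mset_set S)))) = card {i\<in>S. Q i \<and> P (f i)}"
  using assms by (auto simp: filter_mset_image_mset filter_filter_mset intro!: arg_cong[of _ _ card])

text \<open>Both the size of the multiset and its order vary with the sample point. A sublevel set
  of the median, however, is determined by two integer counts, each a finite sum of measurable
  indicators.\<close>

lemma measurable_median:
  fixes f :: "'i \<Rightarrow> 'a \<Rightarrow> real"
  assumes S: "finite S"
    and [measurable]: "\<And>i. i \<in> S \<Longrightarrow> f i \<in> borel_measurable M" "\<And>i. i \<in> S \<Longrightarrow> Measurable.pred M (Q i)"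
  shows "(\<lambda>x. median (image_mset (\<lambda>i. f i x) (filter_mset (\<lambda>i. Q i x) (mset_set S)))) \<in> borel_measurable M"
proof (subst borel_measurable_iff_le, rule allI)
  fix a :: real
  let ?A = "\<lambda>x. image_mset (\<lambda>i. f i x) (filter_mset (\<lambda>i. Q i x) (mset_set S))"
  define N where "N = (\<lambda>x. \<Sum>i\<in>S. if Q i x then 1 else 0::nat)"
  define K where "K = (\<lambda>x. \<Sum>i\<in>S. if Q i x \<and> f i x \<le> a then 1 else 0::nat)"
  have N: "size (?A x) = N x" for x
    using S by (simp add: N_def sum.If_cases Int_def)
  have K: "size (filter_mset (\<lambda>v. v \<le> a) (?A x)) = K x" for x
    using S by (subst size_filter_image_filter_mset_set) (auto simp: K_def sum.If_cases Int_def)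
  have mN[measurable]: "N \<in> M \<rightarrow>\<^sub>M count_space UNIV" unfolding N_def by measurable
  have mK[measurable]: "K \<in> M \<rightarrow>\<^sub>M count_space UNIV" unfolding K_def by measurable
  \<comment> \<open>The case N x = 0 reflects the value 0 given to the median of the empty
    multiset.\<close>
  have "median (?A x) \<le> a \<longleftrightarrow> (if N x = 0 then 0 \<le> a else (N x - 1) div 2 < K x)" for x
  proof (cases "?A x = {#}")
    case True
    have "N x = 0" using N[of x] unfolding True by simp
    moreover have "median (?A x) = 0" unfolding True median_def by simp
    ultimately show ?thesis by simp
  next
    case False
    then have "N x \<noteq> 0" unfolding N[of x, symmetric] size_eq_0_iff_empty .
    moreover have "median (?A x) \<le> a \<longleftrightarrow> (N x - 1) div 2 < K x"
      by (subst median_antitone_iff[OF False, of "\<lambda>v. v \<le> a"]) (auto simp only: N K)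
    ultimately show ?thesis by simp
  qed
  note le_iff = this
  have "(\<lambda>x. (N x, K x)) \<in> M \<rightarrow>\<^sub>M count_space UNIV \<Otimes>\<^sub>M count_space UNIV" by measurable
  then have "(\<lambda>x. (N x, K x)) \<in> M \<rightarrow>\<^sub>M count_space UNIV" by (simp add: pair_measure_countable)
  then have "(\<lambda>x. case (N x, K x) of (n, k) \<Rightarrow> if n = 0 then 0 \<le> a else (n - 1) div 2 < k) \<in> M \<rightarrow>\<^sub>M count_space UNIV"
    by (rule measurable_compose) (rule measurable_count_space)
  then have "Measurable.pred M (\<lambda>x. if N x = 0 then 0 \<le> a else (N x - 1) div 2 < K x)"
    unfolding prod.case .
  then show "{w \<in> space M. median (?A w) \<le> a} \<in> sets M" unfolding le_iff pred_def .
qed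

text \<open>Passing the denominator as \<open>- x\<close> turns the upper tail into the lower one.\<close>

definition vote :: "real \<Rightarrow> real \<Rightarrow> real \<Rightarrow> real" where
  "vote \<delta> x z = (if \<bar>x\<bar> < 1/2 then 0 else if z / x > \<delta> then 1 else -1)"

lemma sum_vote_nonneg_iff:
  assumes "finite S"
  shows "(\<Sum>i\<in>S. vote \<delta> (x i) (z i)) \<ge> 0 \<longleftrightarrow>
    card {i\<in>S. \<bar>x i\<bar> \<ge> 1/2 \<and> z i / x i \<le> \<delta>} \<le> card {i\<in>S. \<bar>x i\<bar> \<ge> 1/2 \<and> z i / x i > \<delta>}"
proof -
  have "(\<Sum>i\<in>S. vote \<delta> (x i) (z i)) = (\<Sum>i\<in>S. (if \<bar>x i\<bar> \<ge> 1/2 \<and> z i / x i > \<delta> then 1 else 0)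
      - (if \<bar>x i\<bar> \<ge> 1/2 \<and> z i / x i \<le> \<delta> then 1 else 0))"
    by (intro sum.cong) (auto simp: vote_def)
  also have "\<dots> = real (card {i\<in>S. \<bar>x i\<bar> \<ge> 1/2 \<and> z i / x i > \<delta>}) - real (card {i\<in>S. \<bar>x i\<bar> \<ge> 1/2 \<and> z i / x i \<le> \<delta>})"
    using assms by (simp add: sum_subtractf sum.If_cases Int_def)
  finally show ?thesis by simp
qed

text \<open>A median above r + \<delta> means that the ratios exceeding r + \<delta> are at least as
  many as the others. A median below r - \<delta> gives the same after negating all denominators,
  which reflects the ratios about r. Either way a majority becomes the sign of a sum, which is what
  Chernoff's method can handle.\<close>

lemma median_deviation_votes:
  fixes q :: "'i \<Rightarrow> real"
  assumes S: "finite S"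
    and q: "\<And>i. i \<in> S \<Longrightarrow> \<bar>x i\<bar> \<ge> 1/2 \<Longrightarrow> q i = r + z i / x i"
    and dev: "\<bar>median (image_mset q (filter_mset (\<lambda>i. \<bar>x i\<bar> \<ge> 1/2) (mset_set S))) - r\<bar> > \<delta>"
  shows "(\<Sum>i\<in>S. vote \<delta> (x i) (z i)) \<ge> 0 \<or> (\<Sum>i\<in>S. vote \<delta> (- x i) (z i)) \<ge> 0"
proof -
  let ?A = "image_mset q (filter_mset (\<lambda>i. \<bar>x i\<bar> \<ge> 1/2) (mset_set S))"
  let ?M = "{i\<in>S. \<bar>x i\<bar> \<ge> 1/2}"
  have size: "size ?A = card ?M" using S by simp
  show ?thesis
  proof (cases "?A = {#}")
    \<comment> \<open>Without a usable denominator all votes vanish, and the sum 0 is covered by the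
      weak inequality.\<close>
    case True
    have "card ?M = 0" using size unfolding True by simp
    then have "?M = {}" using S by simp
    then have "vote \<delta> (x i) (z i) = 0" if "i \<in> S" for i using that by (auto simp: vote_def)
    then show ?thesis by simp
  next
    case False
    have split: "card ?M = card {i\<in>S. \<bar>x i\<bar> \<ge> 1/2 \<and> P i} + card {i\<in>S. \<bar>x i\<bar> \<ge> 1/2 \<and> \<not> P i}" for P
    proof -
      let ?A = "{i\<in>S. \<bar>x i\<bar> \<ge> 1/2 \<and> P i}" and ?B = "{i\<in>S. \<bar>x i\<bar> \<ge> 1/2 \<and> \<not> P i}"
      have "card (?A \<union> ?B) = card ?A + card ?B" using S by (intro card_Un_disjoint) auto
      moreover have "?A \<union> ?B = ?M" by blast
      ultimately show ?thesis by simp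
    qed
    have cnt: "size (filter_mset P ?A) = card {i\<in>S. \<bar>x i\<bar> \<ge> 1/2 \<and> P (q i)}" for P
      by (rule size_filter_image_filter_mset_set[OF S])
    have rank: "P (median ?A) \<longleftrightarrow> (card ?M - 1) div 2 < card {i\<in>S. \<bar>x i\<bar> \<ge> 1/2 \<and> P (q i)}"
      if "\<And>a b. a \<le> b \<Longrightarrow> P b \<Longrightarrow> P a" for P
      by (subst median_antitone_iff[OF False]) (use that in \<open>auto simp only: cnt size\<close>)
    show ?thesis
    proof (cases "median ?A - r > \<delta>")
      case True
      then have "\<not> median ?A \<le> r + \<delta>" by simp
      have "median ?A \<le> r + \<delta> \<longleftrightarrow> (card ?M - 1) div 2 < card {i\<in>S. \<bar>x i\<bar> \<ge> 1/2 \<and> q i \<le> r + \<delta>}"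
        by (rule rank[of "\<lambda>v. v \<le> r + \<delta>"]) linarith
      with \<open>\<not> median ?A \<le> r + \<delta>\<close> have "\<not> (card ?M - 1) div 2 < card {i\<in>S. \<bar>x i\<bar> \<ge> 1/2 \<and> q i \<le> r + \<delta>}"
        by blast
      moreover have "{i\<in>S. \<bar>x i\<bar> \<ge> 1/2 \<and> q i \<le> r + \<delta>} = {i\<in>S. \<bar>x i\<bar> \<ge> 1/2 \<and> z i / x i \<le> \<delta>}"
        using q by auto
      ultimately have "card {i\<in>S. \<bar>x i\<bar> \<ge> 1/2 \<and> z i / x i \<le> \<delta>} \<le> (card ?M - 1) div 2" by simp
      then have "card {i\<in>S. \<bar>x i\<bar> \<ge> 1/2 \<and> z i / x i \<le> \<delta>} \<le> card {i\<in>S. \<bar>x i\<bar> \<ge> 1/2 \<and> \<not> z i / x i \<le> \<delta>}"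
        using split[of "\<lambda>i. z i / x i \<le> \<delta>"] by linarith
      then show ?thesis unfolding sum_vote_nonneg_iff[OF S] not_le by blast
    next
      case False2: False
      then have "median ?A < r - \<delta>" using dev by auto
      \<comment> \<open>For an even number of ratios the lower median falls below r - \<delta> as
        soon as exactly half of them do. This tie is why the vote sums are compared with 0 by
        \<ge>.\<close>
      have "median ?A < r - \<delta> \<longleftrightarrow> (card ?M - 1) div 2 < card {i\<in>S. \<bar>x i\<bar> \<ge> 1/2 \<and> q i < r - \<delta>}"
        by (rule rank[of "\<lambda>v. v < r - \<delta>"]) linarith
      with \<open>median ?A < r - \<delta>\<close> have "(card ?M - 1) div 2 < card {i\<in>S. \<bar>x i\<bar> \<ge> 1/2 \<and> q i < r - \<delta>}"
        by blast
      moreover have "{i\<in>S. \<bar>x i\<bar> \<ge> 1/2 \<and> q i < r - \<delta>} = {i\<in>S. \<bar>- x i\<bar> \<ge> 1/2 \<and> z i / - x i > \<delta>}"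
        using q by auto
      ultimately have "(card ?M - 1) div 2 < card {i\<in>S. \<bar>- x i\<bar> \<ge> 1/2 \<and> z i / - x i > \<delta>}" by simp
      then have "card {i\<in>S. \<bar>- x i\<bar> \<ge> 1/2 \<and> z i / - x i \<le> \<delta>} \<le> card {i\<in>S. \<bar>- x i\<bar> \<ge> 1/2 \<and> z i / - x i > \<delta>}"
        using split[of "\<lambda>i. z i / - x i \<le> \<delta>"] unfolding not_le abs_minus_cancel by linarith
      then show ?thesis unfolding sum_vote_nonneg_iff[OF S] by blast
    qed
  qed
qed

section \<open>Gaussian integrals\<close>

lemma prob_space_std_gauss: "prob_space std_gauss"
  unfolding std_gauss_def by (rule prob_space_normal_density) simp

lemma sets_std_gauss[measurable_cong, simp]: "sets std_gauss = sets borel"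
  by (simp add: std_gauss_def)

lemma space_std_gauss[simp]: "space std_gauss = UNIV"
  by (simp add: std_gauss_def)

interpretation std_gauss: prob_space std_gauss by (rule prob_space_std_gauss)

interpretation gauss_prod: product_prob_space "\<lambda>_. std_gauss" UNIV
  by standard

lemma nn_integral_std_gauss:
  fixes f :: "real \<Rightarrow> ennreal"
  shows "f \<in> borel_measurable borel \<Longrightarrow> (\<integral>\<^sup>+x. f x \<partial>std_gauss) = (\<integral>\<^sup>+x. std_normal_density x * f x \<partial>lborel)"
  unfolding std_gauss_def by (subst nn_integral_density) auto

lemma distr_scaled_std_gauss:
  assumes "a \<noteq> 0"
  shows "distr std_gauss borel (\<lambda>x. a * x) = density lborel (normal_density 0 \<bar>a\<bar>)"
proof -
  have "distributed std_gauss lborel (\<lambda>x. x) (normal_density 0 1)"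
    by (simp add: distributed_def std_gauss_def distr_id2)
  then have "distributed std_gauss lborel (\<lambda>x. 0 + a * x) (normal_density (0 + a * 0) (\<bar>a\<bar> * 1))"
    using assms by (intro std_gauss.normal_density_affine) auto
  then show ?thesis by (simp add: distributed_def cong: distr_cong)
qed

lemma nn_integral_gauss_scaled:
  fixes f :: "real \<Rightarrow> ennreal"
  assumes [measurable]: "f \<in> borel_measurable borel" and "a \<noteq> 0"
  shows "(\<integral>\<^sup>+x. f (a * x) \<partial>std_gauss) = (\<integral>\<^sup>+x. f x \<partial>density lborel (normal_density 0 \<bar>a\<bar>))"
  by (subst distr_scaled_std_gauss[symmetric, OF assms(2)], subst nn_integral_distr) auto

text \<open>Reflection invariance of the Gaussian. With \<bar>a\<bar> = 1 it removes a sign from the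
  integrand.\<close>

lemma nn_integral_gauss_abs:
  fixes f :: "real \<Rightarrow> ennreal"
  assumes [measurable]: "f \<in> borel_measurable borel"
  shows "(\<integral>\<^sup>+x. f (\<bar>a\<bar> * x) \<partial>std_gauss) = (\<integral>\<^sup>+x. f (a * x) \<partial>std_gauss)"
  by (cases "a = 0") (simp_all add: nn_integral_gauss_scaled)

text \<open>Convolution of two centred normal densities. The cases a = 0 and b = 0 are separate
  because a normal law of standard deviation 0 has no density.\<close>

lemma nn_integral_gauss_pair:
  fixes f :: "real \<Rightarrow> ennreal"
  assumes [measurable]: "f \<in> borel_measurable borel"
  shows "(\<integral>\<^sup>+x. \<integral>\<^sup>+y. f (a * x + b * y) \<partial>std_gauss \<partial>std_gauss) = (\<integral>\<^sup>+x. f (sqrt (a\<^sup>2 + b\<^sup>2) * x) \<partial>std_gauss)"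
proof -
  consider "a = 0" | "b = 0" | "a \<noteq> 0" "b \<noteq> 0" by blast
  then show ?thesis
  proof cases
    case 1
    then show ?thesis using nn_integral_gauss_abs[of f b] std_gauss.emeasure_space_1 by simp
  next
    case 2
    then show ?thesis using nn_integral_gauss_abs[of f a] std_gauss.emeasure_space_1 by simp
  next
    case 3
    let ?N = "\<lambda>a. density lborel (\<lambda>x. ennreal (normal_density 0 \<bar>a\<bar> x))"
    have fin: "finite_measure (?N c)" if "c \<noteq> 0" for c
      using that prob_space.finite_measure[OF prob_space_normal_density[of "\<bar>c\<bar>" 0]] by simp
    have pos: "a\<^sup>2 + b\<^sup>2 > 0" using 3 by (simp add: sum_power2_gt_zero_iff)
    have "(\<integral>\<^sup>+x. \<integral>\<^sup>+y. f (a * x + b * y) \<partial>std_gauss \<partial>std_gauss) = (\<integral>\<^sup>+x. \<integral>\<^sup>+y. f (a * x + y) \<partial>?N b \<partial>std_gauss)"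
      using 3 by (subst nn_integral_gauss_scaled[symmetric]) auto
    also have "\<dots> = (\<integral>\<^sup>+x. \<integral>\<^sup>+y. f (x + y) \<partial>?N b \<partial>?N a)"
    proof -
      interpret finite_measure "?N b" using fin 3 by simp
      show ?thesis using 3
        by (subst nn_integral_gauss_scaled[where f = "\<lambda>x. \<integral>\<^sup>+y. f (x + y) \<partial>?N b", symmetric]) auto
    qed
    also have "\<dots> = (\<integral>\<^sup>+x. f x \<partial>(convolution (?N a) (?N b)))"
      using 3 by (intro nn_integral_convolution[symmetric] fin) auto
    also have "convolution (?N a) (?N b) = ?N (sqrt (a\<^sup>2 + b\<^sup>2))"
      using 3 conv_normal_density_zero_mean[of "\<bar>a\<bar>" "\<bar>b\<bar>"]
      by (subst convolution_density) (auto simp: fin ennreal_mult'[symmetric])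
    also have "(\<integral>\<^sup>+x. f x \<partial>\<dots>) = (\<integral>\<^sup>+x. f (sqrt (a\<^sup>2 + b\<^sup>2) * x) \<partial>std_gauss)"
      using pos by (subst nn_integral_gauss_scaled) auto
    finally show ?thesis .
  qed
qed

text \<open>Rotation invariance of the Gaussian vector, obtained by absorbing one coordinate at a
  time. The integrand stays arbitrary in the induction because the summand split off shifts its
  argument.\<close>

lemma nn_integral_gauss_linear:
  fixes f :: "real \<Rightarrow> ennreal" and a :: "'i \<Rightarrow> real"
  assumes "finite I" and f[measurable]: "f \<in> borel_measurable borel"
  shows "(\<integral>\<^sup>+x. f (\<Sum>i\<in>I. a i * x i) \<partial>Pi\<^sub>M I (\<lambda>_. std_gauss)) = (\<integral>\<^sup>+g. f (sqrt (\<Sum>i\<in>I. (a i)\<^sup>2) * g) \<partial>std_gauss)"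
  using assms
proof (induction I arbitrary: f rule: finite_induct)
  case empty
  then show ?case using std_gauss.emeasure_space_1 by (simp add: PiM_empty nn_integral_count_space_finite)
next
  case (insert i I)
  note [measurable] = insert.prems
  have "(\<integral>\<^sup>+x. f (\<Sum>i\<in>insert i I. a i * x i) \<partial>Pi\<^sub>M (insert i I) (\<lambda>_. std_gauss))
     = (\<integral>\<^sup>+y. \<integral>\<^sup>+x. f (\<Sum>k\<in>insert i I. a k * (x(i := y)) k) \<partial>Pi\<^sub>M I (\<lambda>_. std_gauss) \<partial>std_gauss)"
    using insert.hyps by (subst gauss_prod.product_nn_integral_insert_rev) auto
  also have "\<dots> = (\<integral>\<^sup>+y. \<integral>\<^sup>+x. f (a i * y + (\<Sum>k\<in>I. a k * x k)) \<partial>Pi\<^sub>M I (\<lambda>_. std_gauss) \<partial>std_gauss)"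
  proof -
    have "(\<Sum>k\<in>insert i I. a k * (x(i := y)) k) = a i * y + (\<Sum>k\<in>I. a k * x k)" for x and y::real
      using insert.hyps by (subst sum.insert) (auto intro!: sum.cong)
    then show ?thesis by simp
  qed
  also have "\<dots> = (\<integral>\<^sup>+y. \<integral>\<^sup>+g. f (a i * y + sqrt (\<Sum>i\<in>I. (a i)\<^sup>2) * g) \<partial>std_gauss \<partial>std_gauss)"
    by (subst insert.IH) auto
  also have "\<dots> = (\<integral>\<^sup>+g. f (sqrt (\<Sum>i\<in>insert i I. (a i)\<^sup>2) * g) \<partial>std_gauss)"
    using insert.hyps by (subst nn_integral_gauss_pair) (auto simp: sum_nonneg)
  finally show ?case .
qed

text \<open>On [-3/2, 3/2] the density is at least 1 / (3 * (10/3)), since sqrt (2 pi) \<le> 3 and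
  exp (9/8) \<le> 10/3. The interval is wide enough for the denominators in [1/2, 3/2] and for
  windows of half-width 1/2 shifted by at most 1.\<close>

lemma emeasure_std_gauss_interval_ge:
  assumes "-3/2 \<le> a" "a \<le> b" "b \<le> 3/2"
  shows "ennreal ((b - a) / 10) \<le> emeasure std_gauss {a..b}"
proof -
  have low: "1/10 \<le> std_normal_density x" if "x \<in> {a..b}" for x
  proof -
    have "\<bar>x\<bar> \<le> 3/2" using that assms by auto
    then have "x\<^sup>2 \<le> (3/2)\<^sup>2" using abs_le_square_iff[of x "3/2"] by simp
    then have "exp (x\<^sup>2 / 2) \<le> exp (9/8)" by (simp add: power2_eq_square)
    also have "exp (9/8) \<le> (10/3 :: real)"
    proof -
      have "exp (9/8) = exp (1/8) * exp (1::real)" by (simp add: exp_add[symmetric])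
      also have "\<dots> \<le> (1 + 1/8 + (1/8)\<^sup>2) * (272/100)"
        using e_less_272 by (intro mult_mono exp_bound) auto
      also have "\<dots> \<le> 10/3" by (simp add: power2_eq_square)
      finally show ?thesis .
    qed
    finally have "exp (x\<^sup>2 / 2) \<le> 10/3" .
    moreover have "sqrt (2 * pi) \<le> 3" using pi_less_4 by (intro real_le_lsqrt) auto
    ultimately have "exp (x\<^sup>2/2) * sqrt (2 * pi) \<le> (10/3) * 3" by (intro mult_mono) auto
    then show ?thesis by (simp add: std_normal_density_def exp_minus field_simps)
  qed
  have "ennreal ((b - a) / 10) = (\<integral>\<^sup>+x. ennreal (1/10) * indicator {a..b} x \<partial>lborel)"
    using assms by (subst nn_integral_cmult_indicator) (auto simp: ennreal_mult''[symmetric] )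
  also have "\<dots> \<le> (\<integral>\<^sup>+x. ennreal (std_normal_density x) * indicator {a..b} x \<partial>lborel)"
    using low by (intro nn_integral_mono) (auto simp: indicator_def intro!: ennreal_leI)
  also have "\<dots> = emeasure std_gauss {a..b}"
    unfolding std_gauss_def by (subst emeasure_density) auto
  finally show ?thesis .
qed

text \<open>The chi-square moment generating function at 1/4: the integrand times the density is
  sqrt 2 times the normal density of variance 2.\<close>

lemma nn_integral_gauss_exp_square:
  "(\<integral>\<^sup>+x. exp (x\<^sup>2 / 4) \<partial>std_gauss) = ennreal (sqrt 2)"
proof -
  have "(\<integral>\<^sup>+x. exp (x\<^sup>2 / 4) \<partial>std_gauss) = (\<integral>\<^sup>+x. ennreal (sqrt 2) * ennreal (normal_density 0 (sqrt 2) x) \<partial>lborel)"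
  proof (subst nn_integral_std_gauss, simp, rule nn_integral_cong)
    fix x :: real
    have "exp (- x\<^sup>2 / 2) * exp (x\<^sup>2 / 4) = exp (- x\<^sup>2 / 4)" by (simp add: exp_add[symmetric])
    then show "ennreal (std_normal_density x) * ennreal (exp (x\<^sup>2 / 4)) = ennreal (sqrt 2) * ennreal (normal_density 0 (sqrt 2) x)"
      by (simp add: ennreal_mult'[symmetric] normal_density_def real_sqrt_mult field_simps)
  qed
  also have "\<dots> = ennreal (sqrt 2)"
    using prob_space.emeasure_space_1[OF prob_space_normal_density[of "sqrt 2" 0]]
    by (subst nn_integral_cmult) (auto simp: emeasure_density)
  finally show ?thesis .
qed

section \<open>Exponential moments of a single vote\<close>

lemma borel_measurable_vote[measurable (raw)]:
  assumes [measurable]: "f \<in> borel_measurable M" "g \<in> borel_measurable M"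
  shows "(\<lambda>x. vote \<delta> (f x) (g x)) \<in> borel_measurable M"
  unfolding vote_def by measurable

text \<open>Averaging over \<open>x\<close> and \<open>- x\<close> cancels the votes, except where \<open>\<bar>z / x\<bar> \<le> \<delta>\<close>; there
  both are negative, which produces the linear gain.\<close>

lemma exp_vote_symmetrized:
  assumes \<delta>: "0 \<le> \<delta>" and l: "0 \<le> l" "l \<le> 1"
  shows "exp (l * vote \<delta> x z) + exp (l * vote \<delta> (- x) z)
    + 2 * l * (indicator {1/2..3/2} x * indicator {-\<delta>/2..\<delta>/2} z) \<le> 2 * (1 + l\<^sup>2)"
proof (cases "\<bar>x\<bar> < 1/2")
  case True
  then have "indicator {1/2..3/2} x = (0::real)" by (auto simp: indicator_def)
  then show ?thesis using True by (simp add: vote_def)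
next
  case x: False
  have e: "exp l \<le> 1 + l + l\<^sup>2" "exp (- l) \<le> 1 - l + l\<^sup>2"
    using exp_le_quadratic[of l] exp_le_quadratic[of "- l"] l by auto
  show ?thesis
  proof (cases "\<bar>z / x\<bar> \<le> \<delta>")
    case True
    then have "z / x \<le> \<delta>" "- (z / x) \<le> \<delta>" by linarith+
    then have v: "vote \<delta> x z = -1" "vote \<delta> (- x) z = -1" using x by (auto simp: vote_def)
    have "2 * l * (indicator {1/2..3/2} x * indicator {-\<delta>/2..\<delta>/2} z) \<le> 2 * l * 1"
      using l by (intro mult_left_mono) (auto simp: indicator_def)
    then show ?thesis using e(2) by (simp add: v)
  next
    case False
    \<comment> \<open>x \<ge> 1/2 and \<bar>z\<bar> \<le> \<delta>/2 would force \<bar>z / x\<bar>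
      \<le> \<delta>: this product of intervals lies inside the region where both votes are
      negative.\<close>
    have i0: "indicator {1/2..3/2} x * indicator {-\<delta>/2..\<delta>/2} z = (0::real)"
    proof (rule ccontr)
      assume "\<not> ?thesis"
      then have a: "1/2 \<le> x" "\<bar>z\<bar> \<le> \<delta> / 2" by (auto simp: indicator_def split: if_splits)
      have "\<bar>z\<bar> \<le> \<delta> * (1/2)" using a by simp
      also have "\<dots> \<le> \<delta> * x" using a \<delta> by (intro mult_left_mono) auto
      finally show False using False a(1) by (simp add: abs_divide divide_le_eq)
    qed
    have "vote \<delta> x z + vote \<delta> (- x) z = 0" "\<bar>vote \<delta> x z\<bar> = 1"
      using False x \<delta> by (auto simp: vote_def)
    then have ex: "exp (l * vote \<delta> x z) + exp (l * vote \<delta> (- x) z) = exp l + exp (- l)"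
      by (cases "vote \<delta> x z = 1") (auto simp: eq_neg_iff_add_eq_0[symmetric] add_eq_0_iff abs_if split: if_splits)
    show ?thesis using e unfolding i0 ex by simp
  qed
qed

text \<open>Average of the pointwise symmetrized bound, x and -x having the same law; l/10 is half
  of 2 l times the mass 1/10 of [1/2, 3/2]. The gain stands on the left as a summand because
  subtraction in \<open>ennreal\<close> truncates.\<close>

lemma nn_integral_exp_vote:
  assumes \<delta>: "0 \<le> \<delta>" and l: "0 \<le> l" "l \<le> 1"
  shows "(\<integral>\<^sup>+x. exp (l * vote \<delta> x z) \<partial>std_gauss) + ennreal (l / 10) * indicator {-\<delta>/2..\<delta>/2} z \<le> ennreal (1 + l\<^sup>2)"
proof -
  let ?I = "\<integral>\<^sup>+x. exp (l * vote \<delta> x z) \<partial>std_gauss"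
  let ?q = "indicator {-\<delta>/2..\<delta>/2} z :: ennreal"
  have sym: "?I = (\<integral>\<^sup>+x. exp (l * vote \<delta> (- x) z) \<partial>std_gauss)"
    using nn_integral_gauss_abs[of "\<lambda>x. exp (l * vote \<delta> x z)" "-1"] by simp
  have "2 * (?I + ennreal (l / 10) * ?q) = ?I + ?I + ennreal (2 * l) * ?q * ennreal ((3/2 - 1/2) / 10)"
  proof -
    have "ennreal 2 * ennreal (l / 10) = ennreal (2 * l) * ennreal ((3/2 - 1/2) / 10)"
      using l by (simp add: ennreal_mult'[symmetric] del: ennreal_numeral)
    then have "2 * (ennreal (l / 10) * ?q) = ennreal (2 * l) * ?q * ennreal ((3/2 - 1/2) / 10)"
      by (simp add: mult_ac) (metis mult.assoc mult.left_commute)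
    then show ?thesis by (simp only: distrib_left mult_2)
  qed
  also have "\<dots> \<le> ?I + ?I + ennreal (2 * l) * ?q * emeasure std_gauss {1/2..3/2}"
    by (intro add_left_mono mult_left_mono emeasure_std_gauss_interval_ge) auto
  also have "\<dots> = (\<integral>\<^sup>+x. ennreal (exp (l * vote \<delta> x z)) + ennreal (exp (l * vote \<delta> (- x) z))
      + ennreal (2 * l) * ?q * indicator {1/2..3/2} x \<partial>std_gauss)"
    by (subst (2) sym) (simp add: nn_integral_add nn_integral_cmult_indicator)
  also have "\<dots> \<le> (\<integral>\<^sup>+x. ennreal (2 * (1 + l\<^sup>2)) \<partial>std_gauss)"
  proof (rule nn_integral_mono)
    fix x
    have "ennreal (exp (l * vote \<delta> x z)) + ennreal (exp (l * vote \<delta> (- x) z)) + ennreal (2 * l) * ?q * indicator {1/2..3/2} x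
      = ennreal (exp (l * vote \<delta> x z) + exp (l * vote \<delta> (- x) z)
    + 2 * l * (indicator {1/2..3/2} x * indicator {-\<delta>/2..\<delta>/2} z))"
      using l by (auto simp: indicator_def ennreal_plus[symmetric] simp del: ennreal_plus)
    also have "\<dots> \<le> ennreal (2 * (1 + l\<^sup>2))"
      by (intro ennreal_leI exp_vote_symmetrized assms)
    finally show "ennreal (exp (l * vote \<delta> x z)) + ennreal (exp (l * vote \<delta> (- x) z)) + ennreal (2 * l) * ?q * indicator {1/2..3/2} x
      \<le> ennreal (2 * (1 + l\<^sup>2))" .
  qed
  also have "\<dots> = 2 * ennreal (1 + l\<^sup>2)"
    using std_gauss.emeasure_space_1 by (simp add: ennreal_mult')
  finally show ?thesis by (rule iffD1[OF ennreal_mult_le_mult_iff, rotated 2]) simp_all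
qed

text \<open>After division by \<sigma> the window contains an interval of length \<theta> centred at
  -e/\<sigma>, and \<bar>e\<bar> \<le> 1 \<le> \<sigma> keeps it inside [-3/2, 3/2]. Two scales
  occur because the threshold involves the full error norm while the numerator omits coordinate
  j.\<close>

lemma emeasure_gauss_small_ball:
  assumes \<theta>: "0 \<le> \<theta>" "\<theta> \<le> 1" and \<sigma>: "1 \<le> \<sigma>" "\<sigma> \<le> \<sigma>'" and e: "\<bar>e\<bar> \<le> 1"
  shows "ennreal (\<theta> / 10) \<le> (\<integral>\<^sup>+g. indicator {-(\<theta> * \<sigma>')/2..\<theta> * \<sigma>'/2} (\<sigma> * g + e) \<partial>std_gauss)"
proof -
  let ?J = "{- \<theta>/2 - e / \<sigma> .. \<theta>/2 - e / \<sigma>}"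
  have e': "\<bar>e / \<sigma>\<bar> \<le> 1" using e \<sigma> by (simp add: abs_divide divide_le_eq)
  have b: "- (e / \<sigma>) \<le> 1" "e / \<sigma> \<le> 1" using e' by linarith+
  have "ennreal (\<theta> / 10) = ennreal (((\<theta>/2 - e / \<sigma>) - (- \<theta>/2 - e / \<sigma>)) / 10)" by simp
  also have "\<dots> \<le> emeasure std_gauss ?J"
    using b \<theta> by (intro emeasure_std_gauss_interval_ge) linarith+
  also have "\<dots> = (\<integral>\<^sup>+g. indicator ?J g \<partial>std_gauss)" by simp
  also have "\<dots> \<le> (\<integral>\<^sup>+g. indicator {-(\<theta> * \<sigma>')/2..\<theta> * \<sigma>'/2} (\<sigma> * g + e) \<partial>std_gauss)"
  proof (rule nn_integral_mono)
    fix g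
    have "\<sigma> * g + e \<in> {-(\<theta> * \<sigma>')/2..\<theta> * \<sigma>'/2}" if g: "g \<in> ?J"
    proof -
      have "\<bar>g + e / \<sigma>\<bar> \<le> \<theta> / 2" using g unfolding atLeastAtMost_iff by linarith
      then have "\<sigma> * \<bar>g + e / \<sigma>\<bar> \<le> \<sigma> * (\<theta> / 2)" using \<sigma> by (intro mult_left_mono) auto
      moreover have "\<sigma> * \<bar>g + e / \<sigma>\<bar> = \<bar>\<sigma> * g + e\<bar>"
      proof -
        have "\<sigma> * \<bar>g + e / \<sigma>\<bar> = \<bar>\<sigma> * (g + e / \<sigma>)\<bar>" using \<sigma> by (simp add: abs_mult)
        also have "\<sigma> * (g + e / \<sigma>) = \<sigma> * g + e" using \<sigma> by (simp add: distrib_left)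
        finally show ?thesis .
      qed
      moreover have "\<sigma> * (\<theta> / 2) \<le> \<sigma>' * (\<theta> / 2)" using \<sigma> \<theta> by (intro mult_right_mono) auto
      ultimately have "\<bar>\<sigma> * g + e\<bar> \<le> \<sigma>' * (\<theta> / 2)" by linarith
      then have "\<bar>\<sigma> * g + e\<bar> \<le> (\<theta> * \<sigma>') / 2" by (simp add: mult.commute)
      then show ?thesis unfolding atLeastAtMost_iff by linarith
    qed
    then show "indicator ?J g \<le> (indicator {-(\<theta> * \<sigma>')/2..\<theta> * \<sigma>'/2} (\<sigma> * g + e) :: ennreal)"
      by (auto simp: indicator_def)
  qed
  finally show ?thesis .
qed

text \<open>The entry in column j is independent of the numerator, whose remaining entries and noise
  merge into one Gaussian of deviation \<sigma>. A row with \<bar>e\<bar> \<le> 1 gains (l/10)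
  (\<theta>/10); any other row costs at most l^2. The factor \<open>c\<close> carries the choice of
  the tail together with the sign of the row.\<close>

lemma nn_integral_row_vote:
  fixes d j :: nat and a :: "nat \<Rightarrow> real"
  assumes j: "j < d" and c: "\<bar>c\<bar> = 1" and \<theta>: "0 \<le> \<theta>" "\<theta> \<le> 1" and l: "0 \<le> l" "l \<le> 1"
    and R: "(\<Sum>k\<in>{..<d}-{j}. (a k)\<^sup>2) \<le> R" and \<delta>: "\<delta> = \<theta> * sqrt (1 + R)"
  shows "(\<integral>\<^sup>+x. \<integral>\<^sup>+w. exp (l * vote \<delta> (c * x j) ((\<Sum>k\<in>{..<d}-{j}. a k * x k) + e + w)) \<partial>std_gauss
      \<partial>Pi\<^sub>M {..<d} (\<lambda>_. std_gauss)) \<le> ennreal (exp (l\<^sup>2 - (if \<bar>e\<bar> \<le> 1 then l * \<theta> / 100 else 0)))"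
proof -
  define J where "J = {..<d} - {j}"
  define \<sigma> where "\<sigma> = sqrt ((\<Sum>k\<in>J. (a k)\<^sup>2) + 1)"
  have insJ: "{..<d} = insert j J" "j \<notin> J" "finite J" using j by (auto simp: J_def)
  have R0: "0 \<le> R" using R by (meson order.trans sum_nonneg zero_le_power2)
  have \<delta>0: "0 \<le> \<delta>" using \<theta> R0 by (simp add: \<delta>)
  have \<sigma>: "1 \<le> \<sigma>" "\<sigma> \<le> sqrt (1 + R)"
    using R by (auto simp: \<sigma>_def J_def intro: sum_nonneg)
  have "(\<integral>\<^sup>+x. \<integral>\<^sup>+w. exp (l * vote \<delta> (c * x j) ((\<Sum>k\<in>J. a k * x k) + e + w)) \<partial>std_gauss \<partial>Pi\<^sub>M (insert j J) (\<lambda>_. std_gauss))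
     = (\<integral>\<^sup>+y. \<integral>\<^sup>+x. \<integral>\<^sup>+w. exp (l * vote \<delta> (c * y) ((\<Sum>k\<in>J. a k * (x(j := y)) k) + e + w)) \<partial>std_gauss \<partial>Pi\<^sub>M J (\<lambda>_. std_gauss) \<partial>std_gauss)"
    using insJ by (subst gauss_prod.product_nn_integral_insert_rev) auto
  also have "\<dots> = (\<integral>\<^sup>+y. \<integral>\<^sup>+x. \<integral>\<^sup>+w. exp (l * vote \<delta> (c * y) ((\<Sum>k\<in>J. a k * x k) + e + w)) \<partial>std_gauss \<partial>Pi\<^sub>M J (\<lambda>_. std_gauss) \<partial>std_gauss)"
  proof -
    have "(\<Sum>k\<in>J. a k * (x(j := y)) k) = (\<Sum>k\<in>J. a k * x k)" for x and y :: real
      using insJ by (intro sum.cong) auto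
    then show ?thesis by simp
  qed
  also have "\<dots> = (\<integral>\<^sup>+y. \<integral>\<^sup>+g. \<integral>\<^sup>+w. exp (l * vote \<delta> (c * y) (sqrt (\<Sum>k\<in>J. (a k)\<^sup>2) * g + e + w)) \<partial>std_gauss \<partial>std_gauss \<partial>std_gauss)"
    using insJ(3) by (subst nn_integral_gauss_linear[where f = "\<lambda>t. \<integral>\<^sup>+w. exp (l * vote \<delta> (c * y) (t + e + w)) \<partial>std_gauss" for y]) auto
  \<comment> \<open>The noise enters with coefficient 1 and supplies the 1 in \<sigma>^2; hence
    \<sigma> \<ge> 1 even when the error is small.\<close>
  also have "\<dots> = (\<integral>\<^sup>+y. \<integral>\<^sup>+g. \<integral>\<^sup>+w. exp (l * vote \<delta> (c * y) ((sqrt (\<Sum>k\<in>J. (a k)\<^sup>2) * g + 1 * w) + e)) \<partial>std_gauss \<partial>std_gauss \<partial>std_gauss)"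
    by (simp add: ac_simps)
  also have "\<dots> = (\<integral>\<^sup>+y. \<integral>\<^sup>+g. exp (l * vote \<delta> (c * y) (\<sigma> * g + e)) \<partial>std_gauss \<partial>std_gauss)"
    by (subst nn_integral_gauss_pair[where f = "\<lambda>t. ennreal (exp (l * vote \<delta> (c * y) (t + e)))" for y])
       (auto simp: \<sigma>_def sum_nonneg)
  also have "\<dots> = (\<integral>\<^sup>+y. \<integral>\<^sup>+g. exp (l * vote \<delta> y (\<sigma> * g + e)) \<partial>std_gauss \<partial>std_gauss)"
    using nn_integral_gauss_abs[of "\<lambda>y. \<integral>\<^sup>+g. exp (l * vote \<delta> y (\<sigma> * g + e)) \<partial>std_gauss" c] c by simp
  \<comment> \<open>With the numerator outermost, the bound for a fixed numerator applies under the
    integral.\<close>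
  also have "\<dots> = (\<integral>\<^sup>+g. \<integral>\<^sup>+y. exp (l * vote \<delta> y (\<sigma> * g + e)) \<partial>std_gauss \<partial>std_gauss)"
  proof -
    interpret P: pair_sigma_finite std_gauss std_gauss ..
    show ?thesis by (rule P.Fubini') measurable
  qed
  finally have eq: "(\<integral>\<^sup>+x. \<integral>\<^sup>+w. exp (l * vote \<delta> (c * x j) ((\<Sum>k\<in>J. a k * x k) + e + w)) \<partial>std_gauss \<partial>Pi\<^sub>M (insert j J) (\<lambda>_. std_gauss)) = \<dots>" .
  let ?I = "\<integral>\<^sup>+g. \<integral>\<^sup>+y. exp (l * vote \<delta> y (\<sigma> * g + e)) \<partial>std_gauss \<partial>std_gauss"
  let ?q = "\<integral>\<^sup>+g. indicator {-\<delta>/2..\<delta>/2} (\<sigma> * g + e) \<partial>std_gauss"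
  have "?I + ennreal (l / 10) * ?q = (\<integral>\<^sup>+g. (\<integral>\<^sup>+y. exp (l * vote \<delta> y (\<sigma> * g + e)) \<partial>std_gauss)
       + ennreal (l / 10) * indicator {-\<delta>/2..\<delta>/2} (\<sigma> * g + e) \<partial>std_gauss)"
    by (subst nn_integral_add) (auto simp: nn_integral_cmult)
  also have "\<dots> \<le> (\<integral>\<^sup>+g. ennreal (1 + l\<^sup>2) \<partial>std_gauss)"
    by (intro nn_integral_mono nn_integral_exp_vote \<delta>0 l)
  also have "\<dots> = ennreal (1 + l\<^sup>2)" using std_gauss.emeasure_space_1 by simp
  finally have main: "?I + ennreal (l / 10) * ?q \<le> ennreal (1 + l\<^sup>2)" .
  have "?I \<le> ennreal (1 + l\<^sup>2 - (if \<bar>e\<bar> \<le> 1 then l * \<theta> / 100 else 0))"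
  proof (cases "\<bar>e\<bar> \<le> 1")
    case True
    have "ennreal (\<theta> / 10) \<le> ?q"
      using emeasure_gauss_small_ball[OF \<theta> \<sigma> True] by (simp add: \<delta>)
    then have "ennreal (l / 10) * ennreal (\<theta> / 10) \<le> ennreal (l / 10) * ?q" by (rule mult_left_mono) simp
    then have "?I + ennreal (l * \<theta> / 100) \<le> ennreal (1 + l\<^sup>2)"
      using main l by (simp add: ennreal_mult'[symmetric]) (meson add_left_mono order.trans)
    then have "?I \<le> ennreal (1 + l\<^sup>2) - ennreal (l * \<theta> / 100)"
      by (subst ennreal_le_minus_iff) (auto simp: add.commute)
    also have "ennreal (1 + l\<^sup>2) - ennreal (l * \<theta> / 100) = ennreal (1 + l\<^sup>2 - l * \<theta> / 100)"
      using l \<theta> by (intro ennreal_minus) auto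
    finally show ?thesis using True by simp
  next
    case False
    have "?I \<le> ?I + ennreal (l / 10) * ?q" by simp
    with main False show ?thesis by (simp only: if_False diff_zero)
  qed
  also have "\<dots> \<le> ennreal (exp (l\<^sup>2 - (if \<bar>e\<bar> \<le> 1 then l * \<theta> / 100 else 0)))"
    using exp_ge_add_one_self[of "l\<^sup>2 - (if \<bar>e\<bar> \<le> 1 then l * \<theta> / 100 else 0)"]
    by (intro ennreal_leI) (simp only: add_diff_eq)
  finally show ?thesis unfolding J_def[symmetric] using eq insJ(1) by simp
qed

section \<open>One run of the coordinate-wise median\<close>

abbreviation row_gauss :: "nat \<Rightarrow> (nat \<Rightarrow> real) measure" where
  "row_gauss d \<equiv> Pi\<^sub>M {..<d} (\<lambda>_. std_gauss)"

interpretation row_gauss: prob_space "row_gauss d" for d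
  by (intro prob_space_PiM prob_space_std_gauss)

interpretation row_prod: product_prob_space "\<lambda>_. row_gauss d" UNIV for d
  by standard

text \<open>Outside the index set the points of a product space take the value \<open>undefined\<close>, so every
  coordinate is measurable.\<close>

lemma borel_measurable_PiM_coordinate:
  fixes N :: "real measure"
  assumes N: "(\<lambda>x. x) \<in> borel_measurable N" and f: "f \<in> M \<rightarrow>\<^sub>M Pi\<^sub>M I (\<lambda>_. N)"
  shows "(\<lambda>x. f x k) \<in> borel_measurable M"
proof -
  have "(\<lambda>x. x k) \<in> borel_measurable (Pi\<^sub>M I (\<lambda>_. N))"
  proof (cases "k \<in> I")
    case True
    show ?thesis by (rule measurable_compose[OF measurable_component_singleton[OF True] N])
  next
    case False
    have "(\<lambda>x. x k) \<in> borel_measurable (Pi\<^sub>M I (\<lambda>_. N)) \<longleftrightarrow> (\<lambda>_. undefined :: real) \<in> borel_measurable (Pi\<^sub>M I (\<lambda>_. N))"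
      using False by (intro measurable_cong) (auto simp: space_PiM PiE_def extensional_def)
    then show ?thesis by simp
  qed
  then show ?thesis by (rule measurable_compose[OF f])
qed

lemma borel_measurable_PiM_PiM_coordinate:
  fixes N :: "real measure"
  assumes N: "(\<lambda>x. x) \<in> borel_measurable N" and f: "f \<in> M \<rightarrow>\<^sub>M Pi\<^sub>M I (\<lambda>_. Pi\<^sub>M J (\<lambda>_. N))"
  shows "(\<lambda>x. f x k i) \<in> borel_measurable M"
proof -
  have "(\<lambda>x. x k i) \<in> borel_measurable (Pi\<^sub>M I (\<lambda>_. Pi\<^sub>M J (\<lambda>_. N)))"
  proof (cases "k \<in> I")
    case True
    show ?thesis by (rule borel_measurable_PiM_coordinate[OF N measurable_component_singleton[OF True]])
  next
    case False
    have "(\<lambda>x. x k i) \<in> borel_measurable (Pi\<^sub>M I (\<lambda>_. Pi\<^sub>M J (\<lambda>_. N))) \<longleftrightarrow>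
      (\<lambda>_. undefined i :: real) \<in> borel_measurable (Pi\<^sub>M I (\<lambda>_. Pi\<^sub>M J (\<lambda>_. N)))"
      using False by (intro measurable_cong) (auto simp: space_PiM PiE_def extensional_def)
    then show ?thesis by simp
  qed
  then show ?thesis by (rule measurable_compose[OF f])
qed

lemma borel_measurable_id_std_gauss: "(\<lambda>x. x) \<in> borel_measurable std_gauss"
  by (rule measurable_ident_sets) simp

lemmas gauss_coordinates =
  borel_measurable_PiM_coordinate[OF borel_measurable_id_std_gauss]
  borel_measurable_PiM_PiM_coordinate[OF borel_measurable_id_std_gauss]

text \<open>The noise of a stage has a coordinate for every row, while only the rows of its block
  enter the product; the other coordinates integrate to 1.\<close>

lemma (in product_prob_space) nn_integral_PiM_prod_subset:
  assumes K: "finite K" "S \<subseteq> K" and f: "\<And>k. k \<in> S \<Longrightarrow> f k \<in> borel_measurable (M k)"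
  shows "(\<integral>\<^sup>+x. (\<Prod>k\<in>S. f k (x k)) \<partial>Pi\<^sub>M K M) = (\<Prod>k\<in>S. integral\<^sup>N (M k) (f k))"
proof -
  let ?g = "\<lambda>k. if k \<in> S then f k else (\<lambda>_. 1)"
  have "(\<integral>\<^sup>+x. (\<Prod>k\<in>S. f k (x k)) \<partial>Pi\<^sub>M K M) = (\<integral>\<^sup>+x. (\<Prod>k\<in>K. ?g k (x k)) \<partial>Pi\<^sub>M K M)"
    using K by (intro nn_integral_cong prod.mono_neutral_cong_left) auto
  also have "\<dots> = (\<Prod>k\<in>K. integral\<^sup>N (M k) (?g k))"
    using K f by (intro product_nn_integral_prod) auto
  also have "\<dots> = (\<Prod>k\<in>S. integral\<^sup>N (M k) (f k))"
    using K M.emeasure_space_1 by (intro prod.mono_neutral_cong_right) auto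
  finally show ?thesis .
qed

text \<open>Chernoff's method: the indicator of a nonnegative vote sum is at most exp (l * sum),
  which factors over the independent rows and noises.\<close>

lemma nn_integral_vote_majority:
  fixes r \<eta> s :: "nat \<Rightarrow> real" and S :: "nat set"
  assumes j: "j < d" and c: "\<bar>c\<bar> = 1" and S: "S \<subseteq> {..<n}" and s: "\<And>k. k \<in> S \<Longrightarrow> \<bar>s k\<bar> = 1"
    and \<theta>: "0 \<le> \<theta>" "\<theta> \<le> 1" and \<alpha>: "0 \<le> \<alpha>" "\<alpha> \<le> 1"
    and good: "real (card {k\<in>S. \<bar>\<eta> k\<bar> \<le> 1}) \<ge> \<alpha> / 2 * card S"
    and \<delta>: "\<delta> = \<theta> * sqrt (1 + (\<Sum>i<d. (r i)\<^sup>2))"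
  shows "(\<integral>\<^sup>+X. \<integral>\<^sup>+w. indicator {0..} (\<Sum>k\<in>S. vote \<delta> (c * s k * X k j)
      ((\<Sum>i\<in>{..<d}-{j}. s k * r i * X k i) + s k * \<eta> k + w k)) \<partial>Pi\<^sub>M {..<n} (\<lambda>_. std_gauss)
      \<partial>Pi\<^sub>M S (\<lambda>_. row_gauss d)) \<le> ennreal (exp (- real (card S) * \<theta>\<^sup>2 * \<alpha>\<^sup>2 / 160000))"
proof -
  \<comment> \<open>Minimiser of l^2 - l \<theta> \<alpha> / 200, the average exponent per row when
    a fraction \<alpha>/2 of the rows is good. The minimum is -l^2, and 160000 = 400^2.\<close>
  define l where "l = \<theta> * \<alpha> / 400"
  have \<theta>\<alpha>: "0 \<le> \<theta> * \<alpha>" "\<theta> * \<alpha> \<le> 1" using \<theta> \<alpha> by (auto intro: mult_le_one)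
  have l: "0 \<le> l" "l \<le> 1" using \<theta>\<alpha> by (auto simp: l_def)
  define F where "F = (\<lambda>k x w. ennreal (exp (l * vote \<delta> (c * s k * x j)
      ((\<Sum>i\<in>{..<d}-{j}. s k * r i * x i) + s k * \<eta> k + w))))"
  have fS: "finite S" using S by (rule finite_subset) simp
  have F_meas[measurable]: "(\<lambda>(x, w). F k x w) \<in> borel_measurable (row_gauss d \<Otimes>\<^sub>M std_gauss)" for k
  proof -
    note gauss_coordinates [measurable (raw)]
    show ?thesis unfolding F_def by measurable
  qed
  have "(\<integral>\<^sup>+X. \<integral>\<^sup>+w. indicator {0..} (\<Sum>k\<in>S. vote \<delta> (c * s k * X k j)
      ((\<Sum>i\<in>{..<d}-{j}. s k * r i * X k i) + s k * \<eta> k + w k)) \<partial>Pi\<^sub>M {..<n} (\<lambda>_. std_gauss)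
      \<partial>Pi\<^sub>M S (\<lambda>_. row_gauss d))
    \<le> (\<integral>\<^sup>+X. \<integral>\<^sup>+w. (\<Prod>k\<in>S. F k (X k) (w k)) \<partial>Pi\<^sub>M {..<n} (\<lambda>_. std_gauss) \<partial>Pi\<^sub>M S (\<lambda>_. row_gauss d))"
  proof (intro nn_integral_mono)
    fix X :: "nat \<Rightarrow> nat \<Rightarrow> real" and w :: "nat \<Rightarrow> real"
    let ?V = "\<lambda>k. vote \<delta> (c * s k * X k j) ((\<Sum>i\<in>{..<d}-{j}. s k * r i * X k i) + s k * \<eta> k + w k)"
    have "(\<Prod>k\<in>S. F k (X k) (w k)) = ennreal (exp (l * sum ?V S))"
      using fS by (simp add: F_def prod_ennreal exp_sum sum_distrib_left)
    moreover have "indicator {0..} (sum ?V S) \<le> ennreal (exp (l * sum ?V S))"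
      using l by (auto simp: indicator_def)
    ultimately show "indicator {0..} (sum ?V S) \<le> (\<Prod>k\<in>S. F k (X k) (w k))" by simp
  qed
  also have "\<dots> = (\<integral>\<^sup>+X. (\<Prod>k\<in>S. \<integral>\<^sup>+w. F k (X k) w \<partial>std_gauss) \<partial>Pi\<^sub>M S (\<lambda>_. row_gauss d))"
  proof (rule nn_integral_cong)
    fix X assume X: "X \<in> space (Pi\<^sub>M S (\<lambda>_. row_gauss d))"
    show "(\<integral>\<^sup>+w. (\<Prod>k\<in>S. F k (X k) (w k)) \<partial>Pi\<^sub>M {..<n} (\<lambda>_. std_gauss)) = (\<Prod>k\<in>S. \<integral>\<^sup>+w. F k (X k) w \<partial>std_gauss)"
      using S by (intro gauss_prod.nn_integral_PiM_prod_subset[where f = "\<lambda>k. F k (X k)"]) (auto simp: F_def)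
  qed
  also have "\<dots> = (\<Prod>k\<in>S. \<integral>\<^sup>+x. \<integral>\<^sup>+w. F k x w \<partial>std_gauss \<partial>row_gauss d)"
    using fS by (intro row_prod.product_nn_integral_prod) auto
  also have "\<dots> \<le> (\<Prod>k\<in>S. ennreal (exp (l\<^sup>2 - (if \<bar>\<eta> k\<bar> \<le> 1 then l * \<theta> / 100 else 0))))"
  proof (rule prod_mono_ennreal)
    fix k assume k: "k \<in> S"
    have s2: "(s k)\<^sup>2 = 1" using s[OF k] by (metis power2_abs one_power2)
    have "(\<Sum>i\<in>{..<d}-{j}. (s k * r i)\<^sup>2) \<le> (\<Sum>i<d. (r i)\<^sup>2)"
      by (simp add: power_mult_distrib s2) (intro sum_mono2, auto)
    then have "(\<integral>\<^sup>+x. \<integral>\<^sup>+w. exp (l * vote \<delta> ((c * s k) * x j) ((\<Sum>i\<in>{..<d}-{j}. (s k * r i) * x i) + s k * \<eta> k + w)) \<partial>std_gauss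
      \<partial>row_gauss d) \<le> ennreal (exp (l\<^sup>2 - (if \<bar>s k * \<eta> k\<bar> \<le> 1 then l * \<theta> / 100 else 0)))"
      using s[OF k] c by (intro nn_integral_row_vote[where R = "\<Sum>i<d. (r i)\<^sup>2"] j \<theta> l) (auto simp: abs_mult \<delta>)
    then show "(\<integral>\<^sup>+x. \<integral>\<^sup>+w. F k x w \<partial>std_gauss \<partial>row_gauss d)
        \<le> ennreal (exp (l\<^sup>2 - (if \<bar>\<eta> k\<bar> \<le> 1 then l * \<theta> / 100 else 0)))"
      using s[OF k] by (simp add: F_def abs_mult)
  qed
  also have "\<dots> = ennreal (exp (\<Sum>k\<in>S. l\<^sup>2 - (if \<bar>\<eta> k\<bar> \<le> 1 then l * \<theta> / 100 else 0)))"
    using fS by (simp add: prod_ennreal exp_sum)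
  also have "\<dots> \<le> ennreal (exp (- real (card S) * \<theta>\<^sup>2 * \<alpha>\<^sup>2 / 160000))"
  proof -
    have "(\<Sum>k\<in>S. l\<^sup>2 - (if \<bar>\<eta> k\<bar> \<le> 1 then l * \<theta> / 100 else 0)) = card S * l\<^sup>2 - l * \<theta> / 100 * card {k\<in>S. \<bar>\<eta> k\<bar> \<le> 1}"
      using fS by (simp add: sum_subtractf sum.If_cases Int_def)
    also have "\<dots> \<le> card S * l\<^sup>2 - l * \<theta> / 100 * (\<alpha> / 2 * card S)"
      using good l \<theta> by (intro diff_left_mono mult_left_mono) auto
    also have "\<dots> = - real (card S) * \<theta>\<^sup>2 * \<alpha>\<^sup>2 / 160000"
      by (simp add: l_def power2_eq_square field_simps)
    finally show ?thesis by (intro ennreal_leI) simp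
  qed
  finally show ?thesis .
qed

text \<open>Dividing a signed response by its signed entry in column j isolates \<open>r j\<close>;
  the remaining coordinates, the corruption and the noise form the numerator. The value c = -1
  stands for the lower tail.\<close>

lemma cwm_alg_deviation:
  fixes r \<eta> s :: "nat \<Rightarrow> real" and S :: "nat set"
  assumes S: "finite S" and s: "\<And>k. k \<in> S \<Longrightarrow> \<bar>s k\<bar> = 1" and j: "j < d"
    and dev: "\<bar>cwm_alg d S (\<lambda>k. (\<Sum>i<d. X k i * r i) + \<eta> k) X w s j - r j\<bar> > \<delta>"
  shows "\<exists>c\<in>{1, -1}. (\<Sum>k\<in>S. vote \<delta> (c * s k * X k j)
      ((\<Sum>i\<in>{..<d}-{j}. s k * r i * X k i) + s k * \<eta> k + w k)) \<ge> 0"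
proof -
  let ?z = "\<lambda>k. (\<Sum>i\<in>{..<d}-{j}. s k * r i * X k i) + s k * \<eta> k + w k"
  have "(\<Sum>k\<in>S. vote \<delta> (s k * X k j) (?z k)) \<ge> 0 \<or> (\<Sum>k\<in>S. vote \<delta> (- (s k * X k j)) (?z k)) \<ge> 0"
  proof (rule median_deviation_votes[OF S])
    show "\<bar>median (image_mset (\<lambda>i. (s i * ((\<Sum>l<d. X i l * r l) + \<eta> i) + w i) / (s i * X i j))
        (filter_mset (\<lambda>i. 1/2 \<le> \<bar>s i * X i j\<bar>) (mset_set S))) - r j\<bar> > \<delta>"
      using dev j by (simp add: cwm_alg_def)
    fix k assume k: "k \<in> S" "1/2 \<le> \<bar>s k * X k j\<bar>"
    then have nz: "s k * X k j \<noteq> 0" by auto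
    have "(\<Sum>i<d. X k i * r i) = X k j * r j + (\<Sum>i\<in>{..<d}-{j}. X k i * r i)"
      using j by (subst sum.remove[of _ j]) auto
    then have "s k * ((\<Sum>i<d. X k i * r i) + \<eta> k) + w k = r j * (s k * X k j) + ?z k"
      by (simp add: algebra_simps sum_distrib_left)
    then show "(s k * ((\<Sum>i<d. X k i * r i) + \<eta> k) + w k) / (s k * X k j) = r j + ?z k / (s k * X k j)"
      using nz by (simp only: add_divide_distrib) simp
  qed
  then show ?thesis by auto
qed

text \<open>Union bound over d coordinates and two tails. The vector \<open>r\<close> is arbitrary
  but fixed here; later it is the error left by the preceding stages.\<close>

lemma nn_integral_cwm_alg_deviation:
  fixes r \<eta> s :: "nat \<Rightarrow> real" and S :: "nat set"
  assumes S: "S \<subseteq> {..<n}" and s: "\<And>k. k \<in> S \<Longrightarrow> \<bar>s k\<bar> = 1"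
    and \<theta>: "0 \<le> \<theta>" "\<theta> \<le> 1" and \<alpha>: "0 \<le> \<alpha>" "\<alpha> \<le> 1"
    and good: "real (card {k\<in>S. \<bar>\<eta> k\<bar> \<le> 1}) \<ge> \<alpha> / 2 * card S"
  shows "(\<integral>\<^sup>+X. \<integral>\<^sup>+w. indicator {X. \<exists>j<d. \<bar>cwm_alg d S (\<lambda>k. (\<Sum>i<d. X k i * r i) + \<eta> k) X w s j - r j\<bar>
        > \<theta> * sqrt (1 + (\<Sum>i<d. (r i)\<^sup>2))} X \<partial>Pi\<^sub>M {..<n} (\<lambda>_. std_gauss) \<partial>Pi\<^sub>M S (\<lambda>_. row_gauss d))
     \<le> ennreal (2 * real d * exp (- real (card S) * \<theta>\<^sup>2 * \<alpha>\<^sup>2 / 160000))"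
proof -
  define \<delta> where "\<delta> = \<theta> * sqrt (1 + (\<Sum>i<d. (r i)\<^sup>2))"
  have fS: "finite S" using S by (rule finite_subset) simp
  define V where "V = (\<lambda>j c X w. \<Sum>k\<in>S. vote \<delta> (c * s k * X k j)
      ((\<Sum>i\<in>{..<d}-{j}. s k * r i * X k i) + s k * \<eta> k + w k))"
  have V_meas[measurable]: "(\<lambda>(X, w). V j c X w) \<in> borel_measurable (Pi\<^sub>M S (\<lambda>_. row_gauss d) \<Otimes>\<^sub>M Pi\<^sub>M {..<n} (\<lambda>_. std_gauss))"
    for j c
  proof -
    note gauss_coordinates [measurable (raw)]
    show ?thesis unfolding V_def by measurable
  qed
  have "(\<integral>\<^sup>+X. \<integral>\<^sup>+w. indicator {X. \<exists>j<d. \<bar>cwm_alg d S (\<lambda>k. (\<Sum>i<d. X k i * r i) + \<eta> k) X w s j - r j\<bar>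
        > \<delta>} X \<partial>Pi\<^sub>M {..<n} (\<lambda>_. std_gauss) \<partial>Pi\<^sub>M S (\<lambda>_. row_gauss d))
     \<le> (\<integral>\<^sup>+X. \<integral>\<^sup>+w. (\<Sum>j<d. \<Sum>c\<in>{1, -1}. indicator {0..} (V j c X w)) \<partial>Pi\<^sub>M {..<n} (\<lambda>_. std_gauss) \<partial>Pi\<^sub>M S (\<lambda>_. row_gauss d))"
  proof (intro nn_integral_mono)
    fix X :: "nat \<Rightarrow> nat \<Rightarrow> real" and w
    show "indicator {X. \<exists>j<d. \<bar>cwm_alg d S (\<lambda>k. (\<Sum>i<d. X k i * r i) + \<eta> k) X w s j - r j\<bar> > \<delta>} X
        \<le> (\<Sum>j<d. \<Sum>c\<in>{1, -1}. indicator {0..} (V j c X w) :: ennreal)"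
    proof (cases "\<exists>j<d. \<bar>cwm_alg d S (\<lambda>k. (\<Sum>i<d. X k i * r i) + \<eta> k) X w s j - r j\<bar> > \<delta>")
      case True
      then obtain j where j: "j < d" "\<bar>cwm_alg d S (\<lambda>k. (\<Sum>i<d. X k i * r i) + \<eta> k) X w s j - r j\<bar> > \<delta>" by blast
      obtain c where jc: "c \<in> {1, -1}" "V j c X w \<ge> 0"
        using cwm_alg_deviation[OF fS s j] unfolding V_def by blast
      have "(1::ennreal) = indicator {0..} (V j c X w)" using jc by simp
      also have "\<dots> \<le> (\<Sum>c\<in>{1, -1}. indicator {0..} (V j c X w))"
        using jc by (intro member_le_sum) auto
      also have "\<dots> \<le> (\<Sum>j<d. \<Sum>c\<in>{1, -1}. indicator {0..} (V j c X w))"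
        using j by (intro member_le_sum) auto
      finally show ?thesis by (auto simp: indicator_def)
    next
      case False
      then show ?thesis by (subst indicator_simps(2)) auto
    qed
  qed
  also have "\<dots> = (\<Sum>j<d. \<Sum>c\<in>{1, -1}. \<integral>\<^sup>+X. \<integral>\<^sup>+w. indicator {0..} (V j c X w) \<partial>Pi\<^sub>M {..<n} (\<lambda>_. std_gauss) \<partial>Pi\<^sub>M S (\<lambda>_. row_gauss d))"
  \<comment> \<open>The sums are moved out over the product measure, where joint measurability of
    the votes is available.\<close>
  proof -
    let ?P = "Pi\<^sub>M S (\<lambda>_. row_gauss d) \<Otimes>\<^sub>M row_gauss n"
    have I[measurable]: "(\<lambda>p. indicator {0..} (V j c (fst p) (snd p)) :: ennreal) \<in> borel_measurable ?P" for j c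
      using V_meas[of j c] by (simp add: case_prod_beta')
    have "(\<integral>\<^sup>+X. \<integral>\<^sup>+w. (\<Sum>j<d. \<Sum>c\<in>{1, -1}. indicator {0..} (V j c X w)) \<partial>row_gauss n \<partial>Pi\<^sub>M S (\<lambda>_. row_gauss d))
       = (\<integral>\<^sup>+p. (\<Sum>j<d. \<Sum>c\<in>{1, -1}. indicator {0..} (V j c (fst p) (snd p))) \<partial>?P)"
      by (subst row_gauss.nn_integral_fst[symmetric]) simp_all
    also have "\<dots> = (\<Sum>j<d. \<Sum>c\<in>{1, -1}. \<integral>\<^sup>+p. indicator {0..} (V j c (fst p) (snd p)) \<partial>?P)"
      by (subst nn_integral_sum, simp, intro sum.cong refl, subst nn_integral_sum, simp, simp)
    also have "\<dots> = (\<Sum>j<d. \<Sum>c\<in>{1, -1}. \<integral>\<^sup>+X. \<integral>\<^sup>+w. indicator {0..} (V j c X w) \<partial>row_gauss n \<partial>Pi\<^sub>M S (\<lambda>_. row_gauss d))"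
      by (subst row_gauss.nn_integral_fst[OF I, symmetric]) simp
    finally show ?thesis .
  qed
  also have "\<dots> \<le> (\<Sum>j<d. \<Sum>c\<in>{1, -1::real}. ennreal (exp (- real (card S) * \<theta>\<^sup>2 * \<alpha>\<^sup>2 / 160000)))"
    unfolding V_def using S s by (intro sum_mono nn_integral_vote_majority \<theta> \<alpha> good \<delta>_def) auto
  also have "\<dots> = ennreal (2 * real d * exp (- real (card S) * \<theta>\<^sup>2 * \<alpha>\<^sup>2 / 160000))"
    by (simp add: ennreal_mult' ennreal_of_nat_eq_real_of_nat mult_ac)
  finally show ?thesis by (simp only: \<delta>_def)
qed

section \<open>The operator norm of a Gaussian matrix\<close>

text \<open>Chernoff's method with exp (q / (4 \<rho>)), where q is the squared norm of the image
  vector. Each row contributes the chi-square moment sqrt 2 \<le> exp (1/2) at most.\<close>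

lemma nn_integral_gaussian_matrix_vector:
  fixes u :: "nat \<Rightarrow> real"
  assumes u: "(\<Sum>i<d. (u i)\<^sup>2) \<le> \<rho>" and \<rho>: "0 < \<rho>"
  shows "(\<integral>\<^sup>+X. indicator {\<rho> * t<..} (\<Sum>k<n. (\<Sum>i<d. X k i * u i)\<^sup>2) \<partial>Pi\<^sub>M {..<n} (\<lambda>_. row_gauss d))
    \<le> ennreal (exp (real n / 2 - t / 4))"
proof -
  define f where "f = (\<lambda>x :: nat \<Rightarrow> real. ennreal (exp ((\<Sum>i<d. x i * u i)\<^sup>2 / (4 * \<rho>))))"
  have [measurable]: "f \<in> borel_measurable (row_gauss d)"
  proof -
    note gauss_coordinates [measurable (raw)]
    show ?thesis unfolding f_def by measurable
  qed
  have "(\<integral>\<^sup>+X. indicator {\<rho> * t<..} (\<Sum>k<n. (\<Sum>i<d. X k i * u i)\<^sup>2) \<partial>Pi\<^sub>M {..<n} (\<lambda>_. row_gauss d))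
     \<le> (\<integral>\<^sup>+X. ennreal (exp (- t / 4)) * (\<Prod>k<n. f (X k)) \<partial>Pi\<^sub>M {..<n} (\<lambda>_. row_gauss d))"
  proof (rule nn_integral_mono)
    fix X :: "nat \<Rightarrow> nat \<Rightarrow> real"
    let ?Q = "\<Sum>k<n. (\<Sum>i<d. X k i * u i)\<^sup>2"
    have "(\<Prod>k<n. f (X k)) = ennreal (exp (?Q / (4 * \<rho>)))"
      by (simp add: f_def prod_ennreal exp_sum[symmetric] sum_divide_distrib)
    then have "ennreal (exp (- t / 4)) * (\<Prod>k<n. f (X k)) = ennreal (exp (- t / 4 + ?Q / (4 * \<rho>)))"
      by (simp only: exp_add) (subst ennreal_mult'', auto)
    moreover have "1 \<le> ennreal (exp (- t / 4 + ?Q / (4 * \<rho>)))" if "\<rho> * t < ?Q"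
    proof -
      have "0 \<le> - t / 4 + ?Q / (4 * \<rho>)" using that \<rho> by (simp add: field_simps)
      then show ?thesis by (simp del: times_divide_eq_right)
    qed
    ultimately show "indicator {\<rho> * t<..} ?Q \<le> ennreal (exp (- t / 4)) * (\<Prod>k<n. f (X k))"
      by (auto simp: indicator_def)
  qed
  also have "\<dots> = ennreal (exp (- t / 4)) * (\<Prod>k<n. \<integral>\<^sup>+x. f x \<partial>row_gauss d)"
    by (subst nn_integral_cmult, simp, subst row_prod.product_nn_integral_prod) simp_all
  also have "\<dots> \<le> ennreal (exp (- t / 4)) * (\<Prod>k<n. ennreal (exp (1/2)))"
  proof (intro mult_left_mono prod_mono_ennreal)
    let ?\<sigma> = "sqrt (\<Sum>i<d. (u i)\<^sup>2)"
    have "(\<integral>\<^sup>+x. f x \<partial>row_gauss d) = (\<integral>\<^sup>+x. ennreal (exp ((\<Sum>i<d. u i * x i)\<^sup>2 / (4 * \<rho>))) \<partial>row_gauss d)"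
      unfolding f_def by (simp add: mult.commute)
    also have "\<dots> = (\<integral>\<^sup>+g. ennreal (exp ((?\<sigma> * g)\<^sup>2 / (4 * \<rho>))) \<partial>std_gauss)"
      by (rule nn_integral_gauss_linear[where f = "\<lambda>t. ennreal (exp (t\<^sup>2 / (4 * \<rho>)))"]) auto
    also have "\<dots> \<le> (\<integral>\<^sup>+g. ennreal (exp (g\<^sup>2 / 4)) \<partial>std_gauss)"
    proof (intro nn_integral_mono ennreal_leI)
      fix g :: real
      have "(?\<sigma> * g)\<^sup>2 = (\<Sum>i<d. (u i)\<^sup>2) * g\<^sup>2" by (simp add: power_mult_distrib sum_nonneg)
      also have "\<dots> \<le> \<rho> * g\<^sup>2" using u by (intro mult_right_mono) auto
      finally show "exp ((?\<sigma> * g)\<^sup>2 / (4 * \<rho>)) \<le> exp (g\<^sup>2 / 4)" using \<rho> by (simp add: field_simps)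
    qed
    also have "\<dots> = ennreal (sqrt 2)" by (rule nn_integral_gauss_exp_square)
    also have "\<dots> \<le> ennreal (exp (1/2))"
    proof (rule ennreal_leI)
      have "(1 + 1/2 :: real) \<le> exp (1/2)" by (rule exp_ge_add_one_self)
      moreover have "sqrt 2 \<le> 1 + 1/2" by (intro real_le_lsqrt) (auto simp: power2_eq_square)
      ultimately show "sqrt 2 \<le> exp (1/2)" by linarith
    qed
    finally show "(\<integral>\<^sup>+x. f x \<partial>row_gauss d) \<le> ennreal (exp (1/2))" .
  qed auto
  also have "\<dots> = ennreal (exp (real n / 2 - t / 4))"
  proof -
    have "exp (- t / 4) * exp (1/2) ^ n = exp (real n / 2 - t / 4)"
      by (simp add: exp_of_nat_mult[symmetric] exp_add[symmetric])
    then show ?thesis by (simp add: ennreal_power ennreal_mult''[symmetric])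
  qed
  finally show ?thesis .
qed

text \<open>The terms at k and -k are at most (1/2)^k each. The subtracted term is exactly the
  geometric tail still to come, which lets the induction close.\<close>

lemma sum_exp_neg_square_int_le:
  "(\<Sum>k\<in>{- int N..int N}. exp (- (real_of_int k)\<^sup>2)) \<le> 3 - 2 * (1/2) ^ N"
proof (induction N)
  case (Suc N)
  have e: "{- int (Suc N)..int (Suc N)} = insert (int (Suc N)) (insert (- int (Suc N)) {- int N..int N})" by auto
  have "exp (- (real (Suc N))\<^sup>2) \<le> exp (- real (Suc N))"
    using power_increasing[of 1 2 "real (Suc N)"] by simp
  also have "\<dots> = exp (- 1) ^ Suc N" by (subst exp_of_nat_mult[symmetric]) simp
  also have "\<dots> \<le> (1/2) ^ Suc N"
  proof (rule power_mono)
    have "2 \<le> exp (1::real)" using exp_ge_add_one_self[of 1] by simp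
    then show "exp (- 1) \<le> (1/2::real)" by (simp add: exp_minus field_simps)
  qed simp
  finally have "exp (- (real (Suc N))\<^sup>2) \<le> (1/2) ^ Suc N" .
  moreover have "(\<Sum>k\<in>{- int (Suc N)..int (Suc N)}. exp (- (real_of_int k)\<^sup>2))
     = 2 * exp (- (real (Suc N))\<^sup>2) + (\<Sum>k\<in>{- int N..int N}. exp (- (real_of_int k)\<^sup>2))"
    unfolding e by (subst sum.insert, simp, simp, subst sum.insert) (simp_all add: power2_eq_square algebra_simps)
  ultimately show ?case using Suc by simp
qed simp

text \<open>The net for the unit ball is \<open>z / (2 * sqrt d)\<close> with \<open>z\<close> in \<open>lattice_net d\<close>.\<close>

definition lattice_net :: "nat \<Rightarrow> (nat \<Rightarrow> int) set" where
  "lattice_net d = {z \<in> {..<d} \<rightarrow>\<^sub>E {- int (3 * d)..int (3 * d)}. (\<Sum>i<d. (real_of_int (z i))\<^sup>2) \<le> 9 * real d}"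

lemma finite_lattice_net: "finite (lattice_net d)"
  unfolding lattice_net_def by (rule finite_subset[of _ "{..<d} \<rightarrow>\<^sub>E {- int (3 * d)..int (3 * d)}"]) (auto intro: finite_PiE)

text \<open>Every net point has weight exp (9 d - |z|^2) \<ge> 1. Summed over the whole box this
  weight factors into d one-dimensional sums, each at most 3 \<le> exp 2, whence 9 + 2 = 11.\<close>

lemma card_lattice_net_le: "real (card (lattice_net d)) \<le> exp (11 * real d)"
proof -
  let ?B = "{- int (3 * d)..int (3 * d)}"
  have "real (card (lattice_net d)) = (\<Sum>z\<in>lattice_net d. 1)" by simp
  also have "\<dots> \<le> (\<Sum>z\<in>lattice_net d. exp (9 * real d - (\<Sum>i<d. (real_of_int (z i))\<^sup>2)))"
    by (intro sum_mono) (auto simp: lattice_net_def)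
  also have "\<dots> \<le> (\<Sum>z\<in>{..<d} \<rightarrow>\<^sub>E ?B. exp (9 * real d - (\<Sum>i<d. (real_of_int (z i))\<^sup>2)))"
    by (intro sum_mono2 finite_PiE) (auto simp: lattice_net_def)
  also have "\<dots> = (\<Sum>z\<in>{..<d} \<rightarrow>\<^sub>E ?B. exp (9 * real d) * (\<Prod>i<d. exp (- (real_of_int (z i))\<^sup>2)))"
    by (intro sum.cong refl) (simp add: exp_sum[symmetric] sum_negf exp_add[symmetric])
  also have "\<dots> = exp (9 * real d) * (\<Prod>i<d. \<Sum>k\<in>?B. exp (- (real_of_int k)\<^sup>2))"
    by (subst prod_sum_PiE) (auto simp: sum_distrib_left)
  also have "\<dots> \<le> exp (9 * real d) * (\<Prod>i<d. exp 2)"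
  proof (intro mult_left_mono prod_mono conjI)
    have "(\<Sum>k\<in>?B. exp (- (real_of_int k)\<^sup>2)) \<le> 3"
      using sum_exp_neg_square_int_le[of "3 * d"] zero_le_power[of "1/2::real" "3 * d"] by linarith
    also have "(3::real) \<le> exp 2" using exp_ge_add_one_self[of 2] by simp
    finally show "(\<Sum>k\<in>?B. exp (- (real_of_int k)\<^sup>2)) \<le> exp 2" .
  qed (auto intro: sum_nonneg)
  also have "\<dots> = exp (11 * real d)" by (simp add: exp_of_nat_mult[symmetric] exp_add[symmetric])
  finally show ?thesis .
qed

text \<open>Round each coordinate of 2 sqrt d * v down. The rounding error has norm at most sqrt d,
  which is distance 1/2 after rescaling. The rounded vector has norm at most 2 sqrt d + sqrt d,
  hence the radius 3 sqrt d, and its coordinates stay below 3 d.\<close>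

lemma lattice_net_approx:
  fixes v :: "nat \<Rightarrow> real"
  assumes d: "0 < d" and v: "(\<Sum>i<d. (v i)\<^sup>2) \<le> 1"
  obtains z where "z \<in> lattice_net d" "(\<Sum>i<d. (v i - z i / (2 * sqrt d))\<^sup>2) \<le> 1/4"
proof
  let ?h = "2 * sqrt (real d)"
  define z where "z = (\<lambda>i\<in>{..<d}. \<lfloor>?h * v i\<rfloor>)"
  have h: "0 < ?h" "?h\<^sup>2 = 4 * real d" using d by (auto simp: power_mult_distrib)
  have err: "(?h * v i - z i)\<^sup>2 \<le> 1" if "i < d" for i
  proof -
    have "0 \<le> ?h * v i - z i" "?h * v i - z i \<le> 1" using that by (auto simp: z_def) linarith+
    then show ?thesis by (simp add: power_le_one)
  qed
  have "(\<Sum>i<d. (?h * v i - z i)\<^sup>2) \<le> (\<Sum>i<d. 1)" by (intro sum_mono err) auto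
  then have err2: "(\<Sum>i<d. (?h * v i - z i)\<^sup>2) \<le> real d" by simp
  have "(\<Sum>i<d. (v i - z i / ?h)\<^sup>2) = (\<Sum>i<d. (?h * v i - z i)\<^sup>2 / ?h\<^sup>2)"
    using h(1) by (intro sum.cong) (auto simp: power_divide[symmetric] field_simps)
  also have "\<dots> \<le> 1/4" using err2 d unfolding h(2) sum_divide_distrib[symmetric] by (simp add: field_simps)
  finally show "(\<Sum>i<d. (v i - z i / ?h)\<^sup>2) \<le> 1/4" .
  have "L2_set (\<lambda>i. real_of_int (z i)) {..<d} = L2_set (\<lambda>i. ?h * v i + (z i - ?h * v i)) {..<d}" by simp
  also have "\<dots> \<le> L2_set (\<lambda>i. ?h * v i) {..<d} + L2_set (\<lambda>i. z i - ?h * v i) {..<d}"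
    by (rule L2_set_triangle_ineq)
  also have "\<dots> \<le> ?h * 1 + sqrt d"
  proof (intro add_mono)
    have "L2_set (\<lambda>i. ?h * v i) {..<d} = ?h * L2_set v {..<d}" using h by (simp add: L2_set_right_distrib)
    also have "\<dots> \<le> ?h * 1" using h v by (intro mult_left_mono) (auto simp: L2_set_def)
    finally show "L2_set (\<lambda>i. ?h * v i) {..<d} \<le> ?h * 1" .
    show "L2_set (\<lambda>i. z i - ?h * v i) {..<d} \<le> sqrt d"
      unfolding L2_set_def using err2 by (simp add: power2_commute)
  qed
  finally have "L2_set (\<lambda>i. real_of_int (z i)) {..<d} \<le> 3 * sqrt d" by simp
  then have "(L2_set (\<lambda>i. real_of_int (z i)) {..<d})\<^sup>2 \<le> (3 * sqrt d)\<^sup>2" by (intro power_mono) auto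
  then have sq: "(\<Sum>i<d. (real_of_int (z i))\<^sup>2) \<le> 9 * real d"
    by (simp add: L2_set_def sum_nonneg power_mult_distrib)
  have "z i \<in> {- int (3 * d)..int (3 * d)}" if i: "i < d" for i
  proof -
    have "(real_of_int (z i))\<^sup>2 \<le> (\<Sum>i<d. (real_of_int (z i))\<^sup>2)" using i by (intro member_le_sum) auto
    also have "\<dots> \<le> (3 * real d)\<^sup>2"
    proof -
      have "real d * 1 \<le> real d * real d" using d by (intro mult_left_mono) auto
      then show ?thesis using sq by (simp add: power2_eq_square)
    qed
    finally have "\<bar>real_of_int (z i)\<bar> \<le> 3 * real d" using abs_le_square_iff[of "real_of_int (z i)" "3 * real d"] by simp
    then show ?thesis by (auto simp: abs_le_iff)
  qed
  then show "z \<in> lattice_net d" using sq by (auto simp: lattice_net_def z_def)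
qed

text \<open>Successive approximation: a vector of the unit ball is a net point plus half of another
  vector of the unit ball. Iterating gives sqrt T (1 + 1/2 + 1/4 + ...) = 2 sqrt T, up to a crude
  bound \<open>F\<close> divided by 2^m, which vanishes in the limit. The conclusion holds for every
  \<open>v\<close>, including one that depends on the matrix.\<close>

lemma matrix_norm_from_net:
  fixes X :: "nat \<Rightarrow> nat \<Rightarrow> real"
  assumes d: "0 < d" and T: "0 \<le> T"
    and net: "\<And>z. z \<in> lattice_net d \<Longrightarrow> (\<Sum>k<n. (\<Sum>i<d. X k i * (z i / (2 * sqrt d)))\<^sup>2) \<le> T"
  shows "(\<Sum>k<n. (\<Sum>i<d. X k i * v i)\<^sup>2) \<le> 4 * T * (\<Sum>i<d. (v i)\<^sup>2)"
proof -
  define A where "A = (\<lambda>v. L2_set (\<lambda>k. \<Sum>i<d. X k i * v i) {..<n})"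
  define F where "F = L2_set (\<lambda>k. \<Sum>i<d. \<bar>X k i\<bar>) {..<n}"
  have A_add: "A (\<lambda>i. u i + v i) \<le> A u + A v" for u v
    unfolding A_def by (simp add: distrib_left sum.distrib L2_set_triangle_ineq)
  have A_scale: "A (\<lambda>i. c * v i) = c * A v" if "0 \<le> c" for c v
    unfolding A_def using that by (simp add: L2_set_right_distrib sum_distrib_left mult.left_commute)
  have bound: "A v \<le> 2 * sqrt T + F / 2 ^ m" if "(\<Sum>i<d. (v i)\<^sup>2) \<le> 1" for v m
    using that
  proof (induction m arbitrary: v)
    case 0
    have "A v \<le> F"
    proof -
      have "\<bar>\<Sum>i<d. X k i * v i\<bar> \<le> (\<Sum>i<d. \<bar>X k i\<bar>)" for k
      proof -
        have "\<bar>v i\<bar> \<le> 1" if "i < d" for i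
        proof -
          have "(v i)\<^sup>2 \<le> (\<Sum>i<d. (v i)\<^sup>2)" using that by (intro member_le_sum) auto
          then show ?thesis using 0 abs_square_le_1 by (metis order.trans)
        qed
        then have "(\<Sum>i<d. \<bar>X k i * v i\<bar>) \<le> (\<Sum>i<d. \<bar>X k i\<bar>)"
          by (intro sum_mono) (auto simp: abs_mult mult_left_le)
        then show ?thesis by (rule order.trans[OF sum_abs])
      qed
      then have "L2_set (\<lambda>k. \<bar>\<Sum>i<d. X k i * v i\<bar>) {..<n} \<le> F" unfolding F_def by (intro L2_set_mono) auto
      then show ?thesis by (simp add: A_def L2_set_def)
    qed
    moreover have "0 \<le> sqrt T" using T by simp
    ultimately show ?case unfolding power_0 div_by_1 by linarith
  next
    case (Suc m)
    obtain z where z: "z \<in> lattice_net d" "(\<Sum>i<d. (v i - z i / (2 * sqrt d))\<^sup>2) \<le> 1/4"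
      using lattice_net_approx[OF d Suc.prems] .
    let ?u = "\<lambda>i. z i / (2 * sqrt d)"
    have "(\<Sum>i<d. (2 * (v i - ?u i))\<^sup>2) \<le> 1" using z(2) by (simp only: power_mult_distrib sum_distrib_left[symmetric]) simp
    then have IH: "A (\<lambda>i. 2 * (v i - ?u i)) \<le> 2 * sqrt T + F / 2 ^ m" by (rule Suc.IH)
    have "a + (1/2) * (2 * (b - a)) = b" for a b :: real by (simp add: field_simps)
    then have "A v = A (\<lambda>i. ?u i + (1/2) * (2 * (v i - ?u i)))" by (simp only:)
    also have "\<dots> \<le> A ?u + (1/2) * A (\<lambda>i. 2 * (v i - ?u i))" by (subst A_scale[symmetric], simp, rule A_add)
    also have "A ?u \<le> sqrt T" unfolding A_def L2_set_def using net[OF z(1)] by simp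
    finally have "A v \<le> sqrt T + (1/2) * A (\<lambda>i. 2 * (v i - ?u i))" by simp
    moreover have "x \<le> s + (1/2) * a \<Longrightarrow> a \<le> 2 * s + g \<Longrightarrow> x \<le> 2 * s + g / 2" for x s a g :: real by linarith
    ultimately have "A v \<le> 2 * sqrt T + F / 2 ^ m / 2" using IH by blast
    then show ?case by (simp add: mult.commute)
  qed
  have unit: "A v \<le> 2 * sqrt T" if v: "(\<Sum>i<d. (v i)\<^sup>2) \<le> 1" for v
  proof (rule LIMSEQ_le_const)
    show "(\<lambda>m. 2 * sqrt T + F / 2 ^ m) \<longlonglongrightarrow> 2 * sqrt T"
      using tendsto_add[OF tendsto_const[of "2 * sqrt T"] LIMSEQ_divide_realpow_zero[of 2 F]] by simp
    show "\<exists>N. \<forall>m\<ge>N. A v \<le> 2 * sqrt T + F / 2 ^ m" using bound[OF v] by blast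
  qed
  have "A v \<le> 2 * sqrt T * L2_set v {..<d}"
  proof (cases "L2_set v {..<d} = 0")
    case True
    then have "v i = 0" if "i < d" for i using that by (simp add: L2_set_eq_0_iff)
    then have "A v = 0" unfolding A_def by (simp add: L2_set_def)
    then show ?thesis using True by simp
  next
    case False
    let ?L = "L2_set v {..<d}"
    have L: "0 < ?L" using False L2_set_nonneg[of v "{..<d}"] by linarith
    have "(\<Sum>i<d. (v i)\<^sup>2) = ?L\<^sup>2" by (simp add: L2_set_def sum_nonneg)
    then have "(\<Sum>i<d. ((1 / ?L) * v i)\<^sup>2) = 1"
      using L by (simp only: power_mult_distrib sum_distrib_left[symmetric]) (simp add: power_divide)
    then have "A (\<lambda>i. (1 / ?L) * v i) \<le> 2 * sqrt T" by (intro unit) simp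
    moreover have "A (\<lambda>i. (1 / ?L) * v i) = (1 / ?L) * A v" using L by (intro A_scale) simp
    ultimately have "(1 / ?L) * A v \<le> 2 * sqrt T" by simp
    then show ?thesis using L by (simp add: field_simps)
  qed
  then have "(A v)\<^sup>2 \<le> (2 * sqrt T * L2_set v {..<d})\<^sup>2"
    by (intro power_mono) (auto simp: A_def)
  then show ?thesis using T by (simp add: A_def L2_set_def sum_nonneg power_mult_distrib)
qed

text \<open>Rescaled net points have squared norm at most 9/4. Thus t = 4 n turns the threshold into
  9 n and the exponent into n/2 - n, and the union bound over the net costs exp (11 d).\<close>

lemma nn_integral_lattice_net:
  "(\<integral>\<^sup>+X. indicator {X. \<exists>z\<in>lattice_net d. 9 * real n < (\<Sum>k<n. (\<Sum>i<d. X k i * (z i / (2 * sqrt d)))\<^sup>2)} X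
      \<partial>Pi\<^sub>M {..<n} (\<lambda>_. row_gauss d)) \<le> ennreal (exp (11 * real d - real n / 2))"
proof -
  let ?q = "\<lambda>z X. (\<Sum>k<n. (\<Sum>i<d. X k i * (z i / (2 * sqrt d)))\<^sup>2)"
  have q_meas[measurable]: "?q z \<in> borel_measurable (Pi\<^sub>M {..<n} (\<lambda>_. row_gauss d))" for z :: "nat \<Rightarrow> int"
  proof -
    note gauss_coordinates [measurable (raw)]
    show ?thesis by measurable
  qed
  have "(\<integral>\<^sup>+X. indicator {X. \<exists>z\<in>lattice_net d. 9 * real n < ?q z X} X \<partial>Pi\<^sub>M {..<n} (\<lambda>_. row_gauss d))
     \<le> (\<integral>\<^sup>+X. (\<Sum>z\<in>lattice_net d. indicator {9 * real n<..} (?q z X)) \<partial>Pi\<^sub>M {..<n} (\<lambda>_. row_gauss d))"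
  proof (rule nn_integral_mono)
    fix X
    show "indicator {X. \<exists>z\<in>lattice_net d. 9 * real n < ?q z X} X \<le> (\<Sum>z\<in>lattice_net d. indicator {9 * real n<..} (?q z X) :: ennreal)"
    proof (cases "\<exists>z\<in>lattice_net d. 9 * real n < ?q z X")
      case True
      then obtain z where z: "z \<in> lattice_net d" "9 * real n < ?q z X" by blast
      then have "(1::ennreal) = indicator {9 * real n<..} (?q z X)" by simp
      also have "\<dots> \<le> (\<Sum>z\<in>lattice_net d. indicator {9 * real n<..} (?q z X))"
        using z by (intro member_le_sum finite_lattice_net) auto
      finally show ?thesis by (auto simp: indicator_def)
    next
      case False
      then show ?thesis by (subst indicator_simps(2)) auto
    qed
  qed
  also have "\<dots> = (\<Sum>z\<in>lattice_net d. \<integral>\<^sup>+X. indicator {9 * real n<..} (?q z X) \<partial>Pi\<^sub>M {..<n} (\<lambda>_. row_gauss d))"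
    by (rule nn_integral_sum) measurable
  also have "\<dots> \<le> (\<Sum>z\<in>lattice_net d. ennreal (exp (real n / 2 - (4 * real n) / 4)))"
  proof (rule sum_mono)
    fix z assume z: "z \<in> lattice_net d"
    have "(\<Sum>i<d. (z i / (2 * sqrt d))\<^sup>2) = (\<Sum>i<d. (real_of_int (z i))\<^sup>2) / (4 * real d)"
      by (simp add: power_divide power_mult_distrib sum_divide_distrib)
    also have "\<dots> \<le> 9 / 4" using z by (cases "d = 0") (auto simp: lattice_net_def field_simps)
    finally show "(\<integral>\<^sup>+X. indicator {9 * real n<..} (?q z X) \<partial>Pi\<^sub>M {..<n} (\<lambda>_. row_gauss d))
        \<le> ennreal (exp (real n / 2 - (4 * real n) / 4))"
      using nn_integral_gaussian_matrix_vector[where u = "\<lambda>i. z i / (2 * sqrt d)" and \<rho> = "9/4" and t = "4 * real n" and n = n and d = d] by simp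
  qed
  also have "\<dots> = ennreal (card (lattice_net d) * exp (- real n / 2))"
    by (simp add: ennreal_of_nat_eq_real_of_nat ennreal_mult'')
  also have "\<dots> \<le> ennreal (exp (11 * real d) * exp (- real n / 2))"
    by (intro ennreal_leI mult_right_mono card_lattice_net_le) auto
  also have "\<dots> = ennreal (exp (11 * real d - real n / 2))" by (simp add: exp_add[symmetric])
  finally show ?thesis .
qed

section \<open>The bootstrapped algorithm\<close>

text \<open>Separates the random permutation from the deterministic positions, so inclusion,
  disjointness and size of the blocks need checking for \<open>id\<close> only.\<close>

lemma part_set_image: "part_set n t p i = p ` part_set n t id i"
  by (simp add: part_set_def)

lemma finite_part_set: "finite (part_set n t p i)"
  by (simp add: part_set_def)

text \<open>Short blocks end by position n div 2, which leaves room for a last block of length n div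
  2.\<close>

lemma blocks_le_half:
  fixes i n t :: nat
  assumes "i + 1 \<le> t" shows "(i + 1) * (n div (2 * t)) \<le> n div 2"
proof -
  have "(i + 1) * (n div (2 * t)) \<le> t * (n div (2 * t))" using assms by (intro mult_right_mono) auto
  also have "\<dots> = t * (n div 2 div t)" by (simp add: div_mult2_eq)
  also have "\<dots> \<le> n div 2" by simp
  finally show ?thesis .
qed

lemma part_set_id_subset:
  assumes "i < t" shows "part_set n t id i \<subseteq> {..<n}"
proof (cases "i + 1 < t")
  case True
  then show ?thesis using blocks_le_half[of i t n] by (auto simp: part_set_def)
next
  case False
  \<comment> \<open>The last block starts after t - 1 short ones, at position 0 if t = 1.\<close>
  have "(t - 1) * (n div (2 * t)) \<le> n div 2"
    using blocks_le_half[of "t - 2" t n] assms by (cases "t \<ge> 2") (auto simp: Suc_diff_Suc numeral_2_eq_2 not_le less_Suc_eq)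
  then show ?thesis using False by (auto simp: part_set_def)
qed

lemma part_set_id_disjoint:
  assumes "i < j" "j < t" shows "part_set n t id i \<inter> part_set n t id j = {}"
proof -
  have "(i + 1) * (n div (2 * t)) \<le> j * (n div (2 * t))" "(i + 1) * (n div (2 * t)) \<le> (t - 1) * (n div (2 * t))"
    using assms by (auto intro!: mult_right_mono simp del: mult_Suc)
  then show ?thesis using assms by (auto simp: part_set_def)
qed

lemma card_part_set_id:
  "card (part_set n t id i) = (if i + 1 < t then n div (2 * t) else n div 2)"
  by (simp add: part_set_def)

lemma cwm_alg_cong:
  assumes "\<And>k. k \<in> S \<Longrightarrow> y k = y' k" "\<And>k. k \<in> S \<Longrightarrow> X k = X' k"
  shows "cwm_alg d S y X w s = cwm_alg d S y' X' w s"
proof (cases "finite S")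
  case True
  have "filter_mset (\<lambda>i. \<bar>s i * X i j\<bar> \<ge> 1/2) (mset_set S) = filter_mset (\<lambda>i. \<bar>s i * X' i j\<bar> \<ge> 1/2) (mset_set S)" for j
    using assms True by (intro filter_mset_cong) auto
  moreover have "image_mset (\<lambda>i. (s i * y i + w i) / (s i * X i j)) (filter_mset P (mset_set S))
     = image_mset (\<lambda>i. (s i * y' i + w i) / (s i * X' i j)) (filter_mset P (mset_set S))" for j P
    using assms True by (intro image_mset_cong) auto
  ultimately show ?thesis unfolding cwm_alg_def by (simp only:)
next
  case False
  then have "mset_set S = {#}" by simp
  then show ?thesis unfolding cwm_alg_def by (simp only: filter_empty_mset image_mset_empty)
qed

text \<open>In terms of the error \<open>boot_err\<close> of the accumulated estimate, a stage of the algorithm is a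
  coordinate-wise median run on responses whose coefficient vector is that error.\<close>

definition response :: "nat \<Rightarrow> (nat \<Rightarrow> real) \<Rightarrow> (nat \<Rightarrow> real) \<Rightarrow> (nat \<Rightarrow> nat \<Rightarrow> real) \<Rightarrow> nat \<Rightarrow> real" where
  "response d \<beta> \<eta> X = (\<lambda>k. (\<Sum>j<d. X k j * \<beta> j) + \<eta> k)"

definition boot_err :: "nat \<Rightarrow> nat \<Rightarrow> nat \<Rightarrow> (nat \<Rightarrow> real) \<Rightarrow> (nat \<Rightarrow> real) \<Rightarrow> (nat \<Rightarrow> nat \<Rightarrow> real)
    \<Rightarrow> (nat \<Rightarrow> nat \<Rightarrow> real) \<Rightarrow> (nat \<Rightarrow> nat \<Rightarrow> real) \<Rightarrow> (nat \<Rightarrow> nat) \<Rightarrow> nat \<Rightarrow> nat \<Rightarrow> real" where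
  "boot_err d n t \<beta> \<eta> X w s p i = (\<lambda>j. \<beta> j - boot_acc d n t (response d \<beta> \<eta> X) X w s p i j)"

lemma boot_err_0: "boot_err d n t \<beta> \<eta> X w s p 0 = \<beta>"
  by (simp add: boot_err_def)

lemma boot_err_Suc:
  "boot_err d n t \<beta> \<eta> X w s p (Suc i) = (\<lambda>j. boot_err d n t \<beta> \<eta> X w s p i j
    - cwm_alg d (part_set n t p i) (\<lambda>k. (\<Sum>l<d. X k l * boot_err d n t \<beta> \<eta> X w s p i l) + \<eta> k) X (w i) (s i) j)"
  (is "?l = ?r")
proof -
  let ?b = "boot_acc d n t (response d \<beta> \<eta> X) X w s p i"
  have "(\<lambda>k. response d \<beta> \<eta> X k - (\<Sum>l<d. X k l * ?b l)) = (\<lambda>k. (\<Sum>l<d. X k l * boot_err d n t \<beta> \<eta> X w s p i l) + \<eta> k)"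
    by (simp add: boot_err_def response_def right_diff_distrib sum_subtractf diff_add_eq)
  then show ?thesis by (simp add: boot_err_def[of d n t \<beta> \<eta> X w s p "Suc i"] Let_def) (simp add: boot_err_def diff_diff_eq)
qed

text \<open>This is the freshness of a stage: the error before it sees only the earlier blocks and
  noises. Varying the permutation as well allows it to be replaced by its restriction to
  \<open>{..<n}\<close> when measurability is proved.\<close>

lemma boot_err_cong:
  assumes "\<And>i' k. i' < i \<Longrightarrow> k \<in> part_set n t p i' \<Longrightarrow> X k = X' k" "\<And>i'. i' < i \<Longrightarrow> w i' = w' i'"
    and "\<And>i'. i' < i \<Longrightarrow> part_set n t p i' = part_set n t p' i'"
  shows "boot_err d n t \<beta> \<eta> X w s p i = boot_err d n t \<beta> \<eta> X' w' s p' i"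
  using assms
proof (induction i)
  case (Suc i)
  let ?e = "boot_err d n t \<beta> \<eta> X w s p i"
  have IH: "?e = boot_err d n t \<beta> \<eta> X' w' s p' i"
    by (rule Suc.IH) (metis Suc.prems(1) less_SucI, metis Suc.prems(2) less_SucI, metis Suc.prems(3) less_SucI)
  have "cwm_alg d (part_set n t p i) (\<lambda>k. (\<Sum>l<d. X k l * ?e l) + \<eta> k) X (w i) (s i)
     = cwm_alg d (part_set n t p' i) (\<lambda>k. (\<Sum>l<d. X' k l * ?e l) + \<eta> k) X' (w' i) (s i)"
    unfolding Suc.prems(2)[of i, simplified] Suc.prems(3)[of i, simplified, symmetric]
    by (intro cwm_alg_cong) (simp_all add: Suc.prems(1)[OF lessI])
  then show ?case unfolding boot_err_Suc IH by simp
qed (simp add: boot_err_0)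

section \<open>Measurability and failure of a single stage\<close>

lemma borel_measurable_cwm_alg:
  assumes "finite S"
    and [measurable]: "\<And>k. (\<lambda>\<omega>. y \<omega> k) \<in> borel_measurable M" "\<And>k j. (\<lambda>\<omega>. X \<omega> k j) \<in> borel_measurable M"
      "\<And>k. (\<lambda>\<omega>. w \<omega> k) \<in> borel_measurable M" "\<And>k. (\<lambda>\<omega>. s \<omega> k) \<in> borel_measurable M"
  shows "(\<lambda>\<omega>. cwm_alg d S (y \<omega>) (X \<omega>) (w \<omega>) (s \<omega>) j) \<in> borel_measurable M"
proof (cases "j < d")
  case True
  have "(\<lambda>\<omega>. median (image_mset (\<lambda>i. (s \<omega> i * y \<omega> i + w \<omega> i) / (s \<omega> i * X \<omega> i j))
               (filter_mset (\<lambda>i. \<bar>s \<omega> i * X \<omega> i j\<bar> \<ge> 1/2) (mset_set S)))) \<in> borel_measurable M"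
    by (rule measurable_median[OF assms(1)]) measurable
  then show ?thesis using True by (simp add: cwm_alg_def)
qed (simp add: cwm_alg_def)

lemma borel_measurable_boot_err:
  assumes X[measurable]: "\<And>k j. (\<lambda>\<omega>. X \<omega> k j) \<in> borel_measurable M"
    and w: "\<And>i k. (\<lambda>\<omega>. w \<omega> i k) \<in> borel_measurable M" and s: "\<And>i k. (\<lambda>\<omega>. s \<omega> i k) \<in> borel_measurable M"
  shows "(\<lambda>\<omega>. boot_err d n t \<beta> \<eta> (X \<omega>) (w \<omega>) (s \<omega>) p i j) \<in> borel_measurable M"
proof (induction i arbitrary: j)
  case (Suc i)
  note [measurable] = Suc.IH
  show ?case unfolding boot_err_Suc
    by (intro borel_measurable_diff Suc.IH borel_measurable_cwm_alg finite_part_set X w s) measurable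
qed (simp add: boot_err_0)

text \<open>The threshold scales with the current error, so the failure probability can be bounded
  uniformly over all earlier outcomes.\<close>

definition stage_fails :: "nat \<Rightarrow> nat \<Rightarrow> nat \<Rightarrow> (nat \<Rightarrow> real) \<Rightarrow> (nat \<Rightarrow> real) \<Rightarrow> real \<Rightarrow> (nat \<Rightarrow> nat \<Rightarrow> real)
    \<Rightarrow> (nat \<Rightarrow> nat \<Rightarrow> real) \<Rightarrow> (nat \<Rightarrow> nat \<Rightarrow> real) \<Rightarrow> (nat \<Rightarrow> nat) \<Rightarrow> nat \<Rightarrow> bool" where
  "stage_fails d n t \<beta> \<eta> \<theta> X w s p i \<longleftrightarrow> (let r = boot_err d n t \<beta> \<eta> X w s p i in
    \<exists>j<d. \<bar>cwm_alg d (part_set n t p i) (\<lambda>k. (\<Sum>l<d. X k l * r l) + \<eta> k) X (w i) (s i) j - r j\<bar>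
      > \<theta> * sqrt (1 + (\<Sum>j<d. (r j)\<^sup>2)))"

lemma stage_contraction:
  assumes "\<not> stage_fails d n t \<beta> \<eta> \<theta> X w s p i" "0 \<le> \<theta>"
  shows "(\<Sum>j<d. (boot_err d n t \<beta> \<eta> X w s p (Suc i) j)\<^sup>2)
    \<le> real d * \<theta>\<^sup>2 * (1 + (\<Sum>j<d. (boot_err d n t \<beta> \<eta> X w s p i j)\<^sup>2))"
proof -
  define r where "r = boot_err d n t \<beta> \<eta> X w s p i"
  let ?R = "1 + (\<Sum>j<d. (r j)\<^sup>2)"
  have R: "0 \<le> ?R" by (simp add: sum_nonneg)
  have "(boot_err d n t \<beta> \<eta> X w s p (Suc i) j)\<^sup>2 \<le> \<theta>\<^sup>2 * ?R" if "j < d" for j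
  proof -
    have "\<bar>boot_err d n t \<beta> \<eta> X w s p (Suc i) j\<bar> \<le> \<theta> * sqrt ?R"
      using assms(1) that unfolding stage_fails_def boot_err_Suc Let_def r_def[symmetric]
      by (subst abs_minus_commute) (meson not_less)
    then have "\<bar>boot_err d n t \<beta> \<eta> X w s p (Suc i) j\<bar>\<^sup>2 \<le> (\<theta> * sqrt ?R)\<^sup>2" by (intro power_mono) auto
    then show ?thesis using R by (simp add: power_mult_distrib)
  qed
  then have "(\<Sum>j<d. (boot_err d n t \<beta> \<eta> X w s p (Suc i) j)\<^sup>2) \<le> (\<Sum>j<d. \<theta>\<^sup>2 * ?R)" by (intro sum_mono) auto
  then show ?thesis by (simp add: r_def)
qed

lemma pred_stage_fails:
  assumes X[measurable]: "\<And>k j. (\<lambda>\<omega>. X \<omega> k j) \<in> borel_measurable M"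
    and w: "\<And>i k. (\<lambda>\<omega>. w \<omega> i k) \<in> borel_measurable M" and s: "\<And>i k. (\<lambda>\<omega>. s \<omega> i k) \<in> borel_measurable M"
  shows "Measurable.pred M (\<lambda>\<omega>. stage_fails d n t \<beta> \<eta> \<theta> (X \<omega>) (w \<omega>) (s \<omega>) p i)"
proof -
  note [measurable] = borel_measurable_boot_err[of X M w s d n t \<beta> \<eta> p i, OF X w s]
  have [measurable]: "(\<lambda>\<omega>. cwm_alg d (part_set n t p i) (\<lambda>k. (\<Sum>l<d. X \<omega> k l * boot_err d n t \<beta> \<eta> (X \<omega>) (w \<omega>) (s \<omega>) p i l) + \<eta> k)
      (X \<omega>) (w \<omega> i) (s \<omega> i) j) \<in> borel_measurable M" for j
    by (intro borel_measurable_cwm_alg finite_part_set X w s) measurable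
  show ?thesis unfolding stage_fails_def Let_def by measurable
qed

text \<open>Integrating out the rows in a block \<open>S\<close> and the noise of one stage first, with everything else fixed.\<close>

lemma nn_integral_fresh_block:
  fixes M :: "'i \<Rightarrow> 'a measure" and N :: "'j \<Rightarrow> 'b measure"
  assumes "\<And>i. prob_space (M i)" "\<And>i. prob_space (N i)"
    and fin: "finite I" "finite S" "finite T" and disj: "I \<inter> S = {}" "i \<notin> T"
    and f: "f \<in> borel_measurable (Pi\<^sub>M (I \<union> S) M \<Otimes>\<^sub>M Pi\<^sub>M (insert i T) N)"
    and bound: "\<And>x v. x \<in> space (Pi\<^sub>M I M) \<Longrightarrow> v \<in> space (Pi\<^sub>M T N) \<Longrightarrow>
      (\<integral>\<^sup>+y. \<integral>\<^sup>+w. f (merge I S (x, y), v(i := w)) \<partial>N i \<partial>Pi\<^sub>M S M) \<le> c"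
  shows "(\<integral>\<^sup>+X. \<integral>\<^sup>+W. f (X, W) \<partial>Pi\<^sub>M (insert i T) N \<partial>Pi\<^sub>M (I \<union> S) M) \<le> c"
proof -
  interpret M: product_prob_space M UNIV
    by (simp add: product_prob_space_def product_prob_space_axioms_def product_sigma_finite_def assms prob_space_imp_sigma_finite)
  interpret N: product_prob_space N UNIV
    by (simp add: product_prob_space_def product_prob_space_axioms_def product_sigma_finite_def assms prob_space_imp_sigma_finite)
  interpret PI: prob_space "Pi\<^sub>M I M" by (intro prob_space_PiM assms)
  interpret PS: prob_space "Pi\<^sub>M S M" by (intro prob_space_PiM assms)
  interpret PT: prob_space "Pi\<^sub>M T N" by (intro prob_space_PiM assms)
  interpret Pi: prob_space "Pi\<^sub>M (insert i T) N" by (intro prob_space_PiM assms)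
  interpret ST: pair_sigma_finite "Pi\<^sub>M S M" "Pi\<^sub>M T N" ..
  note [measurable] = f
  have fx: "(\<lambda>W. f (X, W)) \<in> borel_measurable (Pi\<^sub>M (insert i T) N)" if "X \<in> space (Pi\<^sub>M (I \<union> S) M)" for X
    using that by measurable
  have "(\<integral>\<^sup>+X. \<integral>\<^sup>+W. f (X, W) \<partial>Pi\<^sub>M (insert i T) N \<partial>Pi\<^sub>M (I \<union> S) M)
     = (\<integral>\<^sup>+x. \<integral>\<^sup>+y. \<integral>\<^sup>+W. f (merge I S (x, y), W) \<partial>Pi\<^sub>M (insert i T) N \<partial>Pi\<^sub>M S M \<partial>Pi\<^sub>M I M)"
    using fin disj by (intro M.product_nn_integral_fold) auto
  also have "\<dots> = (\<integral>\<^sup>+x. \<integral>\<^sup>+v. \<integral>\<^sup>+y. \<integral>\<^sup>+w. f (merge I S (x, y), v(i := w)) \<partial>N i \<partial>Pi\<^sub>M S M \<partial>Pi\<^sub>M T N \<partial>Pi\<^sub>M I M)"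
  proof (rule nn_integral_cong)
    fix x assume x[measurable]: "x \<in> space (Pi\<^sub>M I M)"
    have "(\<integral>\<^sup>+y. \<integral>\<^sup>+W. f (merge I S (x, y), W) \<partial>Pi\<^sub>M (insert i T) N \<partial>Pi\<^sub>M S M)
       = (\<integral>\<^sup>+y. \<integral>\<^sup>+v. \<integral>\<^sup>+w. f (merge I S (x, y), v(i := w)) \<partial>N i \<partial>Pi\<^sub>M T N \<partial>Pi\<^sub>M S M)"
    proof (rule nn_integral_cong)
      fix y assume y: "y \<in> space (Pi\<^sub>M S M)"
      have "merge I S (x, y) \<in> space (Pi\<^sub>M (I \<union> S) M)"
        using measurable_space[OF measurable_merge, of "(x, y)" I M S] x y by (simp add: space_pair_measure)
      from fx[OF this] show "(\<integral>\<^sup>+W. f (merge I S (x, y), W) \<partial>Pi\<^sub>M (insert i T) N)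
        = (\<integral>\<^sup>+v. \<integral>\<^sup>+w. f (merge I S (x, y), v(i := w)) \<partial>N i \<partial>Pi\<^sub>M T N)"
        using fin disj by (intro N.product_nn_integral_insert) auto
    qed
    \<comment> \<open>The noises of the other stages are moved outside the block, so that they are
      fixed when \<open>bound\<close> is applied.\<close>
    also have "\<dots> = (\<integral>\<^sup>+v. \<integral>\<^sup>+y. \<integral>\<^sup>+w. f (merge I S (x, y), v(i := w)) \<partial>N i \<partial>Pi\<^sub>M S M \<partial>Pi\<^sub>M T N)"
    proof (rule ST.Fubini'[symmetric])
      have 1: "(\<lambda>q. merge I S (x, fst (fst q))) \<in> (Pi\<^sub>M S M \<Otimes>\<^sub>M Pi\<^sub>M T N) \<Otimes>\<^sub>M N i \<rightarrow>\<^sub>M Pi\<^sub>M (I \<union> S) M"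
        by (rule measurable_compose[OF _ measurable_merge]) measurable
      have 2: "(\<lambda>q. (snd (fst q))(i := snd q)) \<in> (Pi\<^sub>M S M \<Otimes>\<^sub>M Pi\<^sub>M T N) \<Otimes>\<^sub>M N i \<rightarrow>\<^sub>M Pi\<^sub>M (insert i T) N"
        by (rule measurable_fun_upd[where J = T]) auto
      have "(\<lambda>q. f (merge I S (x, fst (fst q)), (snd (fst q))(i := snd q))) \<in> borel_measurable ((Pi\<^sub>M S M \<Otimes>\<^sub>M Pi\<^sub>M T N) \<Otimes>\<^sub>M N i)"
        by (rule measurable_compose[OF measurable_Pair[OF 1 2] f])
      from sigma_finite_measure.borel_measurable_nn_integral_fst[OF prob_space_imp_sigma_finite[OF assms(2)] this]
      show "(\<lambda>(y, v). \<integral>\<^sup>+w. f (merge I S (x, y), v(i := w)) \<partial>N i) \<in> borel_measurable (Pi\<^sub>M S M \<Otimes>\<^sub>M Pi\<^sub>M T N)"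
        by (simp add: case_prod_beta')
    qed
    finally show "(\<integral>\<^sup>+y. \<integral>\<^sup>+W. f (merge I S (x, y), W) \<partial>Pi\<^sub>M (insert i T) N \<partial>Pi\<^sub>M S M)
       = (\<integral>\<^sup>+v. \<integral>\<^sup>+y. \<integral>\<^sup>+w. f (merge I S (x, y), v(i := w)) \<partial>N i \<partial>Pi\<^sub>M S M \<partial>Pi\<^sub>M T N)" .
  qed
  also have "\<dots> \<le> (\<integral>\<^sup>+x. \<integral>\<^sup>+v. c \<partial>Pi\<^sub>M T N \<partial>Pi\<^sub>M I M)"
    by (intro nn_integral_mono bound)
  also have "\<dots> = c" by (simp add: PI.emeasure_space_1 PT.emeasure_space_1)
  finally show ?thesis .
qed

text \<open>Once the rows outside the block and the noises of the other stages are fixed, the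
  current error is a constant vector, and the bound for one run of the coordinate-wise median
  applies to the fresh block.\<close>

lemma nn_integral_stage_fails:
  fixes \<eta> :: "nat \<Rightarrow> real" and s :: "nat \<Rightarrow> nat \<Rightarrow> real"
  assumes i: "i < t" and p: "p permutes {..<n}" and s: "\<And>k. k < n \<Longrightarrow> \<bar>s i k\<bar> = 1"
    and \<theta>: "0 \<le> \<theta>" "\<theta> \<le> 1" and \<alpha>: "0 \<le> \<alpha>" "\<alpha> \<le> 1"
    and good: "real (card (p ` part_set n t id i \<inter> {k. k < n \<and> \<bar>\<eta> k\<bar> \<le> 1})) \<ge> \<alpha> / 2 * card (part_set n t id i)"
  shows "(\<integral>\<^sup>+X. \<integral>\<^sup>+W. (if stage_fails d n t \<beta> \<eta> \<theta> X W s p i then 1 else 0)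
      \<partial>Pi\<^sub>M {..<t} (\<lambda>_. row_gauss n) \<partial>Pi\<^sub>M {..<n} (\<lambda>_. row_gauss d))
    \<le> ennreal (2 * real d * exp (- real (card (part_set n t id i)) * \<theta>\<^sup>2 * \<alpha>\<^sup>2 / 160000))"
proof -
  define S where "S = part_set n t p i"
  define I where "I = {..<n} - S"
  define T where "T = {..<t} - {i}"
  have S: "S \<subseteq> {..<n}"
    unfolding S_def part_set_image[of n t p] using part_set_id_subset[OF i] permutes_image[OF p] by blast
  have IS: "{..<n} = I \<union> S" "I \<inter> S = {}" and IT: "{..<t} = insert i T" "i \<notin> T"
    using S i by (auto simp: I_def T_def)
  have prev: "part_set n t p i' \<subseteq> I" if i': "i' < i" for i'
  proof -
    have "p ` part_set n t id i' \<inter> p ` part_set n t id i = p ` (part_set n t id i' \<inter> part_set n t id i)"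
      by (rule image_Int[symmetric]) (rule permutes_inj[OF p])
    then have "part_set n t p i' \<inter> S = {}"
      using part_set_id_disjoint[OF i' i] unfolding S_def part_set_image[of n t p] by simp
    moreover have "part_set n t p i' \<subseteq> {..<n}"
      unfolding part_set_image[of n t p] using part_set_id_subset[of i' t n] i i' permutes_image[OF p] by force
    ultimately show ?thesis by (auto simp: I_def)
  qed
  define f where "f = (\<lambda>(X, W). if stage_fails d n t \<beta> \<eta> \<theta> X W s p i then 1 else 0 :: ennreal)"
  have cards: "card S = card (part_set n t id i)"
    unfolding S_def part_set_image[of n t p] by (intro card_image permutes_inj_on[OF p])
  have good': "real (card {k\<in>S. \<bar>\<eta> k\<bar> \<le> 1}) \<ge> \<alpha> / 2 * card S"
  proof -
    have "{k\<in>S. \<bar>\<eta> k\<bar> \<le> 1} = p ` part_set n t id i \<inter> {k. k < n \<and> \<bar>\<eta> k\<bar> \<le> 1}"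
      using S unfolding S_def part_set_image[of n t p] by auto
    then show ?thesis using good cards by simp
  qed
  have "(\<integral>\<^sup>+X. \<integral>\<^sup>+W. f (X, W) \<partial>Pi\<^sub>M (insert i T) (\<lambda>_. row_gauss n) \<partial>Pi\<^sub>M (I \<union> S) (\<lambda>_. row_gauss d))
    \<le> ennreal (2 * real d * exp (- real (card (part_set n t id i)) * \<theta>\<^sup>2 * \<alpha>\<^sup>2 / 160000))"
  proof (rule nn_integral_fresh_block)
    show "prob_space (row_gauss d)" "prob_space (row_gauss n)" by unfold_locales
    show "finite I" "finite S" "finite T" "I \<inter> S = {}" "i \<notin> T"
      using S finite_subset[OF S] by (auto simp: I_def T_def)
    have [measurable]: "Measurable.pred (Pi\<^sub>M (I \<union> S) (\<lambda>_. row_gauss d) \<Otimes>\<^sub>M Pi\<^sub>M (insert i T) (\<lambda>_. row_gauss n))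
      (\<lambda>\<omega>. stage_fails d n t \<beta> \<eta> \<theta> (fst \<omega>) (snd \<omega>) s p i)"
      by (rule pred_stage_fails) (auto intro!: gauss_coordinates measurable_fst measurable_snd)
    show "f \<in> borel_measurable (Pi\<^sub>M (I \<union> S) (\<lambda>_. row_gauss d) \<Otimes>\<^sub>M Pi\<^sub>M (insert i T) (\<lambda>_. row_gauss n))"
      unfolding f_def case_prod_beta' by measurable
    fix x :: "nat \<Rightarrow> nat \<Rightarrow> real" and v :: "nat \<Rightarrow> nat \<Rightarrow> real"
    define r where "r = boot_err d n t \<beta> \<eta> x v s p i"
    have "f (merge I S (x, y), v(i := w)) = indicator {X. \<exists>j<d. \<bar>cwm_alg d S (\<lambda>k. (\<Sum>l<d. X k l * r l) + \<eta> k) X w (s i) j - r j\<bar>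
        > \<theta> * sqrt (1 + (\<Sum>j<d. (r j)\<^sup>2))} y" for y w
    proof -
      let ?X = "merge I S (x, y)"
      \<comment> \<open>Earlier blocks lie in \<open>I\<close>, so neither the fresh rows
        \<open>y\<close> nor the fresh noise \<open>w\<close> influences the error before this
        stage.\<close>
      have 1: "boot_err d n t \<beta> \<eta> ?X (v(i := w)) s p i = r"
        unfolding r_def using prev by (intro boot_err_cong) (auto simp: merge_def)
      have 2: "cwm_alg d S (\<lambda>k. (\<Sum>l<d. ?X k l * r l) + \<eta> k) ?X w (s i)
        = cwm_alg d S (\<lambda>k. (\<Sum>l<d. y k l * r l) + \<eta> k) y w (s i)"
        using IS by (intro cwm_alg_cong) (auto simp: merge_def)
      show ?thesis
        by (simp add: f_def stage_fails_def Let_def 1 S_def[symmetric] 2 indicator_def)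
    qed
    then show "(\<integral>\<^sup>+y. \<integral>\<^sup>+w. f (merge I S (x, y), v(i := w)) \<partial>row_gauss n \<partial>Pi\<^sub>M S (\<lambda>_. row_gauss d))
      \<le> ennreal (2 * real d * exp (- real (card (part_set n t id i)) * \<theta>\<^sup>2 * \<alpha>\<^sup>2 / 160000))"
      using nn_integral_cwm_alg_deviation[OF S _ \<theta> \<alpha> good', of "s i" d r] S s cards by auto
  qed
  then show ?thesis unfolding IS(1)[symmetric] IT(1)[symmetric] f_def by simp
qed

section \<open>Integration over the joint space, with signs and permutation outermost\<close>

lemma nn_integral_triple:
  assumes "sigma_finite_measure A" "sigma_finite_measure B" "sigma_finite_measure C"
    and f: "f \<in> borel_measurable (A \<Otimes>\<^sub>M (B \<Otimes>\<^sub>M C))"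
  shows "integral\<^sup>N (A \<Otimes>\<^sub>M (B \<Otimes>\<^sub>M C)) f = (\<integral>\<^sup>+z. \<integral>\<^sup>+x. \<integral>\<^sup>+y. f (x, (y, z)) \<partial>B \<partial>A \<partial>C)"
proof -
  interpret A: sigma_finite_measure A by fact
  interpret B: sigma_finite_measure B by fact
  interpret C: sigma_finite_measure C by fact
  interpret BC: pair_sigma_finite B C ..
  interpret AC: pair_sigma_finite A C ..
  note [measurable] = f
  have "integral\<^sup>N (A \<Otimes>\<^sub>M (B \<Otimes>\<^sub>M C)) f = (\<integral>\<^sup>+x. \<integral>\<^sup>+q. f (x, q) \<partial>(B \<Otimes>\<^sub>M C) \<partial>A)"
    by (rule BC.P.nn_integral_fst[symmetric]) (rule f)
  also have "\<dots> = (\<integral>\<^sup>+x. \<integral>\<^sup>+z. \<integral>\<^sup>+y. f (x, (y, z)) \<partial>B \<partial>C \<partial>A)"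
  proof (rule nn_integral_cong)
    fix x assume x[measurable]: "x \<in> space A"
    show "(\<integral>\<^sup>+q. f (x, q) \<partial>(B \<Otimes>\<^sub>M C)) = (\<integral>\<^sup>+z. \<integral>\<^sup>+y. f (x, (y, z)) \<partial>B \<partial>C)"
      by (subst BC.nn_integral_snd[symmetric]) (auto simp: case_prod_beta')
  qed
  also have "\<dots> = (\<integral>\<^sup>+z. \<integral>\<^sup>+x. \<integral>\<^sup>+y. f (x, (y, z)) \<partial>B \<partial>A \<partial>C)"
    by (rule AC.Fubini'[symmetric]) measurable
  finally show ?thesis .
qed

lemma AE_rademacher_abs: "AE x in rademacher. \<bar>x\<bar> = 1"
  unfolding rademacher_def AE_measure_pmf_iff by (simp add: set_pmf_of_set)

abbreviation sign_space :: "nat \<Rightarrow> nat \<Rightarrow> (nat \<Rightarrow> nat \<Rightarrow> real) measure" where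
  "sign_space n t \<equiv> \<Pi>\<^sub>M i\<in>{..<t}. \<Pi>\<^sub>M k\<in>{..<n}. rademacher"

lemma prob_space_rademacher: "prob_space rademacher"
  unfolding rademacher_def by (rule prob_space_measure_pmf)

lemma prob_space_sign_space: "prob_space (sign_space n t)"
  by (intro prob_space_PiM prob_space_rademacher)

text \<open>The sign measures live on all reals, so absolute value 1 holds only almost
  everywhere.\<close>

lemma AE_sign_space: "AE s in sign_space n t. \<forall>i<t. \<forall>k<n. \<bar>s i k\<bar> = 1"
proof -
  have "AE s in sign_space n t. \<forall>i\<in>{..<t}. \<forall>k\<in>{..<n}. \<bar>s i k\<bar> = 1"
    by (intro eventually_ball_finite ballI AE_PiM_component[where P = "\<lambda>r. \<forall>k\<in>{..<n}. \<bar>r k\<bar> = 1"]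
        AE_PiM_component[where P = "\<lambda>x. \<bar>x\<bar> = 1"] prob_space_PiM prob_space_rademacher AE_rademacher_abs) auto
  then show ?thesis by (rule eventually_mono) auto
qed

text \<open>The deterministic part of the argument enters only through \<open>cover\<close>. The
  three terms account for a large matrix norm, a failing stage, and a partition that gives some
  block too few good rows; the first two are integrated with signs and permutation fixed.\<close>

lemma emeasure_boot_space_le:
  fixes \<eta> :: "nat \<Rightarrow> real" and \<theta> :: "nat \<Rightarrow> real"
  assumes A: "A \<in> sets (boot_space n d t)" and n: "0 < n"
    and \<theta>: "\<And>i. i < t \<Longrightarrow> 0 \<le> \<theta> i \<and> \<theta> i \<le> 1" and \<alpha>: "0 < \<alpha>" "\<alpha> \<le> 1"
    and G: "real (card {k. k < n \<and> \<bar>\<eta> k\<bar> \<le> 1}) \<ge> \<alpha> * real n"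
    and cover: "\<And>X w s p. (X, w, s, p) \<in> A \<Longrightarrow> p permutes {..<n} \<Longrightarrow>
        (\<exists>z\<in>lattice_net d. 9 * real n < (\<Sum>k<n. (\<Sum>i<d. X k i * (z i / (2 * sqrt d)))\<^sup>2)) \<or>
        (\<exists>i<t. stage_fails d n t \<beta> \<eta> (\<theta> i) X w s p i)"
  shows "emeasure (boot_space n d t) A \<le> ennreal (exp (11 * real d - real n / 2)
    + (\<Sum>i<t. 2 * real d * exp (- real (card (part_set n t id i)) * (\<theta> i)\<^sup>2 * \<alpha>\<^sup>2 / 160000))
    + (\<Sum>i<t. exp (- real (card (part_set n t id i)) * \<alpha>\<^sup>2 / 16)))"
proof -
  let ?MX = "Pi\<^sub>M {..<n} (\<lambda>_. row_gauss d)" and ?MW = "Pi\<^sub>M {..<t} (\<lambda>_. row_gauss n)"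
  let ?MP = "measure_pmf (pmf_of_set {p. p permutes {..<n}})"
  let ?Q = "sign_space n t \<Otimes>\<^sub>M ?MP"
  let ?G = "{k. k < n \<and> \<bar>\<eta> k\<bar> \<le> 1}"
  interpret MX: prob_space ?MX by (intro prob_space_PiM prob_space_std_gauss)
  interpret MW: prob_space ?MW by (intro prob_space_PiM prob_space_std_gauss)
  interpret MS: prob_space "sign_space n t" by (rule prob_space_sign_space)
  interpret SP: pair_prob_space "sign_space n t" ?MP ..
  have M: "boot_space n d t = ?MX \<Otimes>\<^sub>M (?MW \<Otimes>\<^sub>M ?Q)" by (simp add: boot_space_def)
  define c1 where "c1 = exp (11 * real d - real n / 2)"
  define c2 where "c2 = (\<Sum>i<t. 2 * real d * exp (- real (card (part_set n t id i)) * (\<theta> i)\<^sup>2 * \<alpha>\<^sup>2 / 160000))"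
  define c3 where "c3 = (\<Sum>i<t. exp (- real (card (part_set n t id i)) * \<alpha>\<^sup>2 / 16))"
  have c0: "0 \<le> c1" "0 \<le> c2" "0 \<le> c3" by (auto simp: c1_def c2_def c3_def intro!: sum_nonneg)
  define P where "P = (\<Union>i<t. {p. real (card (p ` part_set n t id i \<inter> ?G)) < \<alpha> / 2 * card (part_set n t id i)})"
  have finP: "finite {p. p permutes {..<n}}" by (simp add: finite_permutations)
  have neP: "{p. p permutes {..<n}} \<noteq> {}" by (auto intro!: exI[of _ id] permutes_id)
  have P: "emeasure ?MP P \<le> ennreal c3"
  proof -
    have "measure ?MP P \<le> (\<Sum>i<t. measure ?MP {p. real (card (p ` part_set n t id i \<inter> ?G)) < \<alpha> / 2 * card (part_set n t id i)})"
      unfolding P_def by (intro measure_pmf.finite_measure_subadditive_finite) auto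
    also have "\<dots> \<le> c3" unfolding c3_def
      using part_set_id_subset n G \<alpha> by (intro sum_mono random_subset_tail) auto
    finally show ?thesis by (simp add: measure_pmf.emeasure_eq_measure ennreal_leI)
  qed
  have inner: "(\<integral>\<^sup>+X. \<integral>\<^sup>+w. indicator A (X, (w, (s, p))) \<partial>?MW \<partial>?MX) \<le> ennreal (c1 + c2)"
    if s: "\<And>i k. i < t \<Longrightarrow> k < n \<Longrightarrow> \<bar>s i k\<bar> = 1" and p: "p permutes {..<n}" and pP: "p \<notin> P" for s p
  proof -
    let ?Z = "{X. \<exists>z\<in>lattice_net d. 9 * real n < (\<Sum>k<n. (\<Sum>i<d. X k i * (z i / (2 * sqrt d)))\<^sup>2)}"
    let ?F = "\<lambda>i X w. if stage_fails d n t \<beta> \<eta> (\<theta> i) X w s p i then 1 else 0 :: ennreal"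
    have F_meas: "Measurable.pred (?MX \<Otimes>\<^sub>M ?MW) (\<lambda>\<omega>. stage_fails d n t \<beta> \<eta> (\<theta> i) (fst \<omega>) (snd \<omega>) s p i)" for i
      by (rule pred_stage_fails) (auto intro!: gauss_coordinates measurable_fst measurable_snd)
    have Fm[measurable]: "(\<lambda>\<omega>. ?F i (fst \<omega>) (snd \<omega>)) \<in> borel_measurable (?MX \<Otimes>\<^sub>M ?MW)" for i
      using F_meas[of i] by measurable
    have Z[measurable]: "(\<lambda>\<omega>. indicator ?Z (fst \<omega>) :: ennreal) \<in> borel_measurable (?MX \<Otimes>\<^sub>M ?MW)"
    proof -
      note gauss_coordinates [measurable (raw)]
      have "Measurable.pred (?MX \<Otimes>\<^sub>M ?MW) (\<lambda>\<omega>. fst \<omega> \<in> ?Z)"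
        unfolding mem_Collect_eq using finite_lattice_net[of d] by measurable
      then show ?thesis unfolding indicator_def by measurable
    qed
    have "(\<integral>\<^sup>+X. \<integral>\<^sup>+w. indicator A (X, (w, (s, p))) \<partial>?MW \<partial>?MX)
       \<le> (\<integral>\<^sup>+X. \<integral>\<^sup>+w. indicator ?Z X + (\<Sum>i<t. ?F i X w) \<partial>?MW \<partial>?MX)"
    proof (intro nn_integral_mono)
      fix X w
      show "indicator A (X, (w, (s, p))) \<le> indicator ?Z X + (\<Sum>i<t. ?F i X w)"
      proof (cases "(X, (w, (s, p))) \<in> A")
        case True
        from cover[OF this p] show ?thesis
        proof
          assume "\<exists>i<t. stage_fails d n t \<beta> \<eta> (\<theta> i) X w s p i"
          then obtain i where i: "i < t" "stage_fails d n t \<beta> \<eta> (\<theta> i) X w s p i" by blast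
          have "indicator A (X, (w, (s, p))) \<le> ?F i X w" using i by (simp add: indicator_def)
          also have "\<dots> \<le> (\<Sum>i<t. ?F i X w)" using i(1) by (intro member_le_sum) auto
          also have "\<dots> \<le> indicator ?Z X + (\<Sum>i<t. ?F i X w)" by simp
          finally show ?thesis .
        next
          assume "\<exists>z\<in>lattice_net d. 9 * real n < (\<Sum>k<n. (\<Sum>i<d. X k i * (z i / (2 * sqrt d)))\<^sup>2)"
          then have "indicator ?Z X = (1::ennreal)" by (intro indicator_simps(1)) simp
          moreover have "indicator A (X, (w, (s, p))) \<le> (1::ennreal)" by (simp add: indicator_def)
          ultimately show ?thesis by (simp add: add_increasing2)
        qed
      qed simp
    qed
    also have "\<dots> = (\<integral>\<^sup>+\<omega>. indicator ?Z (fst \<omega>) + (\<Sum>i<t. ?F i (fst \<omega>) (snd \<omega>)) \<partial>(?MX \<Otimes>\<^sub>M ?MW))"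
    proof -
      have "(\<lambda>\<omega>. indicator ?Z (fst \<omega>) + (\<Sum>i<t. ?F i (fst \<omega>) (snd \<omega>))) \<in> borel_measurable (?MX \<Otimes>\<^sub>M ?MW)"
        by (intro borel_measurable_add borel_measurable_sum Z Fm)
      from MW.nn_integral_fst[OF this] show ?thesis by (simp only: fst_conv snd_conv)
    qed
    also have "\<dots> = (\<integral>\<^sup>+\<omega>. indicator ?Z (fst \<omega>) \<partial>(?MX \<Otimes>\<^sub>M ?MW)) + (\<Sum>i<t. \<integral>\<^sup>+\<omega>. ?F i (fst \<omega>) (snd \<omega>) \<partial>(?MX \<Otimes>\<^sub>M ?MW))"
      by (subst nn_integral_add[OF Z borel_measurable_sum[OF Fm]], subst nn_integral_sum[OF Fm], rule refl)
    also have "\<dots> = (\<integral>\<^sup>+X. indicator ?Z X \<partial>?MX) + (\<Sum>i<t. \<integral>\<^sup>+X. \<integral>\<^sup>+w. ?F i X w \<partial>?MW \<partial>?MX)"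
      by (simp only: MW.nn_integral_fst[OF Z, symmetric] MW.nn_integral_fst[OF Fm, symmetric])
         (simp add: MW.emeasure_space_1)
    also have "\<dots> \<le> ennreal c1 + (\<Sum>i<t. ennreal (2 * real d * exp (- real (card (part_set n t id i)) * (\<theta> i)\<^sup>2 * \<alpha>\<^sup>2 / 160000)))"
    proof (intro add_mono sum_mono)
      show "(\<integral>\<^sup>+X. indicator ?Z X \<partial>?MX) \<le> ennreal c1" unfolding c1_def by (rule nn_integral_lattice_net)
      fix i assume i: "i \<in> {..<t}"
      then have "real (card (p ` part_set n t id i \<inter> ?G)) \<ge> \<alpha> / 2 * card (part_set n t id i)"
        using pP by (auto simp: P_def not_less)
      then show "(\<integral>\<^sup>+X. \<integral>\<^sup>+w. ?F i X w \<partial>?MW \<partial>?MX) \<le> ennreal (2 * real d * exp (- real (card (part_set n t id i)) * (\<theta> i)\<^sup>2 * \<alpha>\<^sup>2 / 160000))"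
        using i s p \<theta>[of i] \<alpha> by (intro nn_integral_stage_fails) auto
    qed
    also have "\<dots> = ennreal (c1 + c2)" unfolding c2_def
      using c0(1) by (subst sum_ennreal) (auto simp: ennreal_plus[symmetric] sum_nonneg simp del: ennreal_plus)
    finally show ?thesis .
  qed
  have P_meas: "(\<lambda>q. indicator P (snd q) :: ennreal) \<in> borel_measurable ?Q"
    by (rule measurable_compose[OF measurable_snd]) simp
  have AEq: "AE q in ?Q. (\<forall>i<t. \<forall>k<n. \<bar>fst q i k\<bar> = 1) \<and> snd q permutes {..<n}"
  proof (rule AE_conjI)
    show "AE q in ?Q. \<forall>i<t. \<forall>k<n. \<bar>fst q i k\<bar> = 1"
    proof (rule AE_distrD[of fst ?Q "sign_space n t"])
      show "AE s in distr ?Q (sign_space n t) fst. \<forall>i<t. \<forall>k<n. \<bar>s i k\<bar> = 1"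
        unfolding measure_pmf.distr_pair_fst by (rule AE_sign_space)
    qed simp
    have "AE p in ?MP. p permutes {..<n}" using neP finP by (simp add: AE_measure_pmf_iff)
    then have AEp: "AE s in sign_space n t. AE p in ?MP. p permutes {..<n}" by simp
    show "AE q in ?Q. snd q permutes {..<n}"
    proof (rule SP.AE_pair_measure)
      have "Measurable.pred ?Q (\<lambda>q. snd q permutes {..<n})"
        by (rule measurable_compose[OF measurable_snd]) simp
      then show "{q \<in> space ?Q. snd q permutes {..<n}} \<in> sets ?Q" by (rule predE)
    qed (use AEp in simp)
  qed
  have "emeasure (boot_space n d t) A = (\<integral>\<^sup>+\<omega>. indicator A \<omega> \<partial>(?MX \<Otimes>\<^sub>M (?MW \<Otimes>\<^sub>M ?Q)))"
    using A by (simp add: M)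
  also have "\<dots> = (\<integral>\<^sup>+q. \<integral>\<^sup>+X. \<integral>\<^sup>+w. indicator A (X, (w, q)) \<partial>?MW \<partial>?MX \<partial>?Q)"
    using A by (intro nn_integral_triple) (auto simp: M intro: prob_space_imp_sigma_finite MX.prob_space_axioms MW.prob_space_axioms SP.prob_space_axioms)
  \<comment> \<open>For an unbalanced partition the inner integral is bounded by 1, which the
    indicator of \<open>P\<close> pays for.\<close>
  also have "\<dots> \<le> (\<integral>\<^sup>+q. ennreal (c1 + c2) + indicator P (snd q) \<partial>?Q)"
  proof (rule nn_integral_mono_AE, use AEq in eventually_elim)
    fix q :: "(nat \<Rightarrow> nat \<Rightarrow> real) \<times> (nat \<Rightarrow> nat)"
    assume q: "(\<forall>i<t. \<forall>k<n. \<bar>fst q i k\<bar> = 1) \<and> snd q permutes {..<n}"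
    show "(\<integral>\<^sup>+X. \<integral>\<^sup>+w. indicator A (X, (w, q)) \<partial>?MW \<partial>?MX) \<le> ennreal (c1 + c2) + indicator P (snd q)"
    proof (cases "snd q \<in> P")
      case False
      then show ?thesis using inner[of "fst q" "snd q"] q by simp
    next
      case True
      have "(\<integral>\<^sup>+X. \<integral>\<^sup>+w. indicator A (X, (w, q)) \<partial>?MW \<partial>?MX) \<le> (\<integral>\<^sup>+X. \<integral>\<^sup>+w. 1 \<partial>?MW \<partial>?MX)"
        by (intro nn_integral_mono) (simp add: indicator_def)
      also have "\<dots> = 1" by (simp add: MW.emeasure_space_1 MX.emeasure_space_1)
      finally show ?thesis using True by (simp add: add_increasing)
    qed
  qed
  also have "\<dots> = ennreal (c1 + c2) + (\<integral>\<^sup>+q. indicator P (snd q) \<partial>?Q)"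
    by (subst nn_integral_add[OF _ P_meas]) (auto simp: SP.emeasure_space_1)
  also have "(\<integral>\<^sup>+q. indicator P (snd q) \<partial>?Q) = emeasure ?MP P"
    by (subst measure_pmf.nn_integral_fst[OF P_meas, symmetric]) (simp add: MS.emeasure_space_1)
  also have "ennreal (c1 + c2) + \<dots> \<le> ennreal (c1 + c2) + ennreal c3"
    by (intro add_left_mono P)
  also have "\<dots> = ennreal (c1 + c2 + c3)" using c0 by (subst ennreal_plus[symmetric]) auto
  finally show ?thesis by (simp add: c1_def c2_def c3_def)
qed

section \<open>Choice of the parameters\<close>

text \<open>All failure terms are to be a small multiple of \<epsilon>. The factor 768 is 8 * 16 *
  6: short blocks have at least n / (8 L) rows, \<theta>^2 = 1/(16 d) in a short stage, and the
  exponent aimed at is 6 (a + ln L).\<close>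

lemma sample_size_bounds:
  fixes d n t :: nat and \<Delta> \<epsilon> \<alpha> :: real
  defines "a \<equiv> ln (real d / \<epsilon>)" and "L \<equiv> ln \<Delta>"
  assumes d: "d \<ge> 1" and \<alpha>: "0 < \<alpha>" "\<alpha> \<le> 1" and \<Delta>: "\<Delta> \<ge> 3" and \<epsilon>: "0 < \<epsilon>" "\<epsilon> \<le> 1/2"
    and t: "t = boot_t \<Delta>"
    and n: "real n \<ge> 768 * 160000 * (real d * L / \<alpha>\<^sup>2) * (a + ln L)"
  shows "1/2 \<le> a" "1 \<le> L" "L \<le> real t" "real t \<le> 2 * L" "2 \<le> t"
    "exp (11 * real d - real n / 2) \<le> \<epsilon> / 32"
    "2 * real d * real t * exp (- real (n div (2 * t)) * (1 / (16 * real d)) * \<alpha>\<^sup>2 / 160000) \<le> \<epsilon> / 8"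
    "24 * 160000 * a / (\<alpha>\<^sup>2 * real n) \<le> 1" "0 < n"
    "2 * real d * exp (- real (n div 2) * (24 * 160000 * a / (\<alpha>\<^sup>2 * real n)) * \<alpha>\<^sup>2 / 160000) \<le> \<epsilon> / 16"
    "real t * exp (- real (n div (2 * t)) * \<alpha>\<^sup>2 / 16) \<le> \<epsilon> / 16"
    "n div (2 * t) \<le> n div 2"
proof -
  let ?c = "160000 :: real"
  have d1: "1 \<le> real d" using d by simp
  \<comment> \<open>Strict because \<Delta> \<ge> 3 > e; hence t \<ge> 2, and there is at least one
    short stage.\<close>
  have "1 < L"
  proof -
    have "exp 1 < (272/100::real)" by (rule e_less_272)
    also have "\<dots> < \<Delta>" using \<Delta> by simp
    finally show ?thesis using ln_less_cancel_iff[of "exp 1" \<Delta>] \<Delta> by (simp add: L_def)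
  qed
  then show L1: "1 \<le> L" by simp
  have b0: "0 \<le> ln L" using L1 by simp
  have q: "2 \<le> real d / \<epsilon>" using d1 \<epsilon> by (simp add: field_simps)
  show a2: "1/2 \<le> a"
  proof -
    have "1/2 \<le> ln (2::real)" using ln2_ge_two_thirds by simp
    also have "\<dots> \<le> a" using q unfolding a_def by simp
    finally show ?thesis .
  qed
  have tdef: "real t = of_int \<lceil>L\<rceil>" using L1 unfolding t boot_t_def L_def by simp
  show Lt: "L \<le> real t" unfolding tdef by (rule le_of_int_ceiling)
  have "real t < L + 1" unfolding tdef by linarith
  then show t2L: "real t \<le> 2 * L" using L1 by simp
  show t2: "2 \<le> t" using Lt \<open>1 < L\<close> by linarith
  \<comment> \<open>E = \<epsilon> / (d L) is the failure probability that d coordinates and about L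
    stages can afford. Since E \<le> 1/2, the power E^6 gains another factor 1/32, which absorbs all
    numerical constants.\<close>
  define E where "E = exp (- (a + ln L))"
  have E: "E = \<epsilon> / (real d * L)" "exp (- a) = \<epsilon> / real d"
    using d1 L1 \<epsilon> by (auto simp: E_def a_def exp_diff exp_minus exp_add)
  have "\<epsilon> / real d \<le> 1/2" using \<epsilon> d1 by (simp add: divide_le_eq)
  then have Ea: "exp (- a) \<le> 1/2" "0 < exp (- a)" unfolding E(2)[symmetric] by auto
  have E0: "0 < E" "E \<le> exp (- a)" using b0 by (auto simp: E_def)
  have dLE: "real d * L * E = \<epsilon>" using E d1 L1 by simp
  have E6: "E ^ 6 \<le> E * (1/32)"
  proof -
    have "E ^ 5 \<le> (1/2) ^ 5" using E0 Ea by (intro power_mono) auto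
    then have "E * E ^ 5 \<le> E * (1/2) ^ 5" using E0 by (intro mult_left_mono) auto
    then show ?thesis by (simp add: power_Suc[symmetric] power_divide eval_nat_numeral)
  qed
  have A6: "exp (- a) ^ 6 \<le> exp (- a) * (1/32)"
  proof -
    have "exp (- a) ^ 5 \<le> (1/2) ^ 5" using Ea by (intro power_mono) auto
    then have "exp (- a) * exp (- a) ^ 5 \<le> exp (- a) * (1/2) ^ 5" by (intro mult_left_mono) auto
    then show ?thesis by (simp add: power_Suc[symmetric] power_divide eval_nat_numeral)
  qed
  have exp6: "exp (- 6 * x) = exp (- x) ^ 6" for x :: real by (simp add: exp_of_nat_mult[symmetric])
  have n1: "768 * ?c * (real d * L * (a + ln L)) \<le> real n * \<alpha>\<^sup>2"
    using n \<alpha> by (simp add: field_simps)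
  have al: "0 < \<alpha>\<^sup>2" "\<alpha>\<^sup>2 \<le> 1" using \<alpha> by (auto simp: power_le_one)
  have n2: "real n * \<alpha>\<^sup>2 \<le> real n" using al by (simp add: mult_left_le)
  have s1: "L * (a + ln L) \<le> real d * L * (a + ln L)" "real d * (a + ln L) \<le> real d * L * (a + ln L)"
      "a + ln L \<le> real d * L * (a + ln L)"
  proof -
    have "1 * (L * (a + ln L)) \<le> real d * (L * (a + ln L))" using d1 L1 a2 b0 by (intro mult_right_mono) auto
    then show *: "L * (a + ln L) \<le> real d * L * (a + ln L)" by (simp add: mult.assoc)
    have "(real d * (a + ln L)) * 1 \<le> (real d * (a + ln L)) * L" using d1 L1 a2 b0 by (intro mult_left_mono) auto
    then show "real d * (a + ln L) \<le> real d * L * (a + ln L)" by (simp add: mult_ac)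
    have "1 * (a + ln L) \<le> L * (a + ln L)" using L1 a2 b0 by (intro mult_right_mono) auto
    then show "a + ln L \<le> real d * L * (a + ln L)" using * by simp
  qed
  have half: "1/2 \<le> a + ln L" using a2 b0 by linarith
  have s2: "L * (1/2) \<le> L * (a + ln L)" "real d * (1/2) \<le> real d * (a + ln L)"
    by (rule mult_left_mono[OF half], use L1 in simp) (rule mult_left_mono[OF half], simp)
  have n4: "4 * L \<le> real n" "22 * real d + 12 * a \<le> real n"
    using n1 n2 s1 s2 b0 L1 d1 a2 by linarith+
  have nt: "2 * t \<le> n" using n4(1) t2L by linarith
  show n0: "0 < n" using nt t2 by linarith
  show "n div (2 * t) \<le> n div 2" by (rule div_le_mono2) (use t2 in auto)
  \<comment> \<open>As 2 t \<le> n, the quotient m = n div (2 t) is at least 1, so rounding loses at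
    most a factor 2: n < 2 t (m + 1) \<le> 4 t m \<le> 8 L m.\<close>
  have m1: "real n \<le> 8 * L * real (n div (2 * t))"
  proof -
    have "n < (n div (2 * t) + 1) * (2 * t)"
      using dividend_less_div_times[of "2 * t" n] t2 by (simp add: algebra_simps)
    moreover have "1 \<le> n div (2 * t)" using nt t2 by (simp add: div_greater_zero_iff Suc_le_eq)
    then have "(n div (2 * t) + 1) * (2 * t) \<le> (2 * (n div (2 * t))) * (2 * t)" by (intro mult_right_mono) auto
    ultimately have "real n \<le> real ((2 * (n div (2 * t))) * (2 * t))" by linarith
    also have "\<dots> = 4 * real (n div (2 * t)) * real t" by simp
    also have "\<dots> \<le> 4 * real (n div (2 * t)) * (2 * L)" using t2L by (intro mult_left_mono) auto
    finally show ?thesis by (simp add: mult_ac)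
  qed
  have m2: "real n \<le> 4 * real (n div 2)" using nt t2 by linarith
  have k1: "6 * (a + ln L) \<le> real (n div (2 * t)) * (1 / (16 * real d)) * \<alpha>\<^sup>2 / ?c"
  proof -
    have "768 * ?c * (real d * L * (a + ln L)) \<le> 8 * L * real (n div (2 * t)) * \<alpha>\<^sup>2"
      using n1 mult_right_mono[OF m1, of "\<alpha>\<^sup>2"] al by linarith
    then have "L * (768 * ?c * (real d * (a + ln L))) \<le> L * (8 * real (n div (2 * t)) * \<alpha>\<^sup>2)" by (simp add: mult_ac)
    then have "768 * ?c * (real d * (a + ln L)) \<le> 8 * real (n div (2 * t)) * \<alpha>\<^sup>2"
      using L1 by (subst (asm) mult_le_cancel_left_pos) auto
    then show ?thesis using d1 by (simp add: field_simps)
  qed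
  have e1: "exp (- real (n div (2 * t)) * (1 / (16 * real d)) * \<alpha>\<^sup>2 / ?c) \<le> E ^ 6"
  proof -
    have "exp (- real (n div (2 * t)) * (1 / (16 * real d)) * \<alpha>\<^sup>2 / ?c) \<le> exp (- 6 * (a + ln L))" using k1 by simp
    then show ?thesis unfolding exp6 E_def .
  qed
  have tE: "real d * real t * E \<le> 2 * \<epsilon>"
  proof -
    have "real d * real t * E \<le> real d * (2 * L) * E" using t2L d1 E0 by (intro mult_right_mono mult_left_mono) auto
    then show ?thesis using dLE by (simp add: mult_ac)
  qed
  have tE6: "real d * real t * E ^ 6 \<le> \<epsilon> / 16"
  proof -
    have "real d * real t * E ^ 6 \<le> real d * real t * (E * (1/32))" using E6 d1 by (intro mult_left_mono) auto
    then show ?thesis using tE by simp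
  qed
  show "2 * real d * real t * exp (- real (n div (2 * t)) * (1 / (16 * real d)) * \<alpha>\<^sup>2 / ?c) \<le> \<epsilon> / 8"
  proof -
    have "real d * real t * exp (- real (n div (2 * t)) * (1 / (16 * real d)) * \<alpha>\<^sup>2 / ?c) \<le> real d * real t * E ^ 6"
      using e1 d1 by (intro mult_left_mono) auto
    then show ?thesis using tE6 by simp
  qed
  show "real t * exp (- real (n div (2 * t)) * \<alpha>\<^sup>2 / 16) \<le> \<epsilon> / 16"
  proof -
    \<comment> \<open>The exponent of the sampling bound is larger than that of a short stage by the
      factor 160000 d, so the estimate already proved covers it.\<close>
    have "real (n div (2 * t)) * (1 / (16 * real d)) * \<alpha>\<^sup>2 / ?c \<le> real (n div (2 * t)) * \<alpha>\<^sup>2 / 16"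
    proof -
      have "real (n div (2 * t)) * \<alpha>\<^sup>2 * (1 / (real d * ?c)) \<le> real (n div (2 * t)) * \<alpha>\<^sup>2 * 1"
        using d1 al by (intro mult_left_mono) (auto simp: divide_le_eq)
      then show ?thesis by (simp add: mult_ac)
    qed
    then have "exp (- real (n div (2 * t)) * \<alpha>\<^sup>2 / 16) \<le> E ^ 6" using e1 by (rule_tac order.trans[OF _ e1]) simp
    then have "real t * exp (- real (n div (2 * t)) * \<alpha>\<^sup>2 / 16) \<le> real t * E ^ 6" by (intro mult_left_mono) auto
    also have "\<dots> \<le> real d * (real t * E ^ 6)" using d1 E0 mult_right_mono[of 1 "real d" "real t * E ^ 6"] by simp
    finally show ?thesis using tE6 by (simp add: mult.assoc)
  qed
  have e2: "exp (- (6 * a)) \<le> exp (- a) / 32" using A6 exp6[of a] by simp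
  have Ede: "real d * exp (- a) = \<epsilon>" using E(2) d1 by simp
  show "exp (11 * real d - real n / 2) \<le> \<epsilon> / 32"
  proof -
    have "exp (11 * real d - real n / 2) \<le> exp (- (6 * a))" using n4(2) by simp
    also have "\<dots> \<le> exp (- a) / 32" by (rule e2)
    also have "exp (- a) \<le> \<epsilon>" using Ede d1 mult_right_mono[of 1 "real d" "exp (- a)"] by simp
    finally show ?thesis by simp
  qed
  have pos: "0 < \<alpha>\<^sup>2 * real n" using al n0 by simp
  show "24 * ?c * a / (\<alpha>\<^sup>2 * real n) \<le> 1"
  proof -
    have "24 * ?c * a \<le> 768 * ?c * (real d * L * (a + ln L))" using s1(3) b0 a2 by linarith
    then have "24 * ?c * a \<le> real n * \<alpha>\<^sup>2" using n1 by (rule order.trans)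
    then show ?thesis using pos by (simp add: divide_le_eq mult.commute)
  qed
  \<comment> \<open>The last block has at least n/4 rows, so 24 a becomes the exponent 6 a. No ln L
    is needed because this stage occurs only once.\<close>
  show "2 * real d * exp (- real (n div 2) * (24 * ?c * a / (\<alpha>\<^sup>2 * real n)) * \<alpha>\<^sup>2 / ?c) \<le> \<epsilon> / 16"
  proof -
    have "real (n div 2) * (24 * ?c * a / (\<alpha>\<^sup>2 * real n)) * \<alpha>\<^sup>2 / ?c = 24 * a * real (n div 2) / real n"
      using al n0 by (simp add: field_simps)
    also have "\<dots> \<ge> 6 * a"
    proof -
      have "6 * a * real n \<le> 6 * a * (4 * real (n div 2))" using m2 a2 by (intro mult_left_mono) auto
      then show ?thesis using n0 by (simp add: le_divide_eq mult_ac)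
    qed
    finally have "exp (- real (n div 2) * (24 * ?c * a / (\<alpha>\<^sup>2 * real n)) * \<alpha>\<^sup>2 / ?c) \<le> exp (- (6 * a))" by simp
    also note e2
    finally have "2 * real d * exp (- real (n div 2) * (24 * ?c * a / (\<alpha>\<^sup>2 * real n)) * \<alpha>\<^sup>2 / ?c) \<le> 2 * real d * (exp (- a) / 32)"
      by (intro mult_left_mono) auto
    then show ?thesis using Ede by simp
  qed
qed

text \<open>The permutation ranges over the uncountable type of all functions on the naturals. Only
  its restriction to \<open>{..<n}\<close> matters, which takes countably many values, so
  measurability for each fixed permutation can be glued.\<close>

lemma borel_measurable_boot_err_boot_space:
  "(\<lambda>(X, w, s, p). boot_err d n t \<beta> \<eta> X w s p t j) \<in> borel_measurable (boot_space n d t)"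
proof -
  let ?M = "boot_space n d t"
  let ?r = "\<lambda>\<omega> :: (nat \<Rightarrow> nat \<Rightarrow> real) \<times> (nat \<Rightarrow> nat \<Rightarrow> real) \<times> (nat \<Rightarrow> nat \<Rightarrow> real) \<times> (nat \<Rightarrow> nat). restrict (snd (snd (snd \<omega>))) {..<n}"
  let ?f = "\<lambda>q \<omega>. boot_err d n t \<beta> \<eta> (fst \<omega>) (fst (snd \<omega>)) (fst (snd (snd \<omega>))) q t j"
  have rad: "(\<lambda>x. x) \<in> borel_measurable rademacher"
    by (simp add: rademacher_def)
  have X: "fst \<in> ?M \<rightarrow>\<^sub>M (\<Pi>\<^sub>M i\<in>{..<n}. row_gauss d)"
    and w: "(\<lambda>\<omega>. fst (snd \<omega>)) \<in> ?M \<rightarrow>\<^sub>M (\<Pi>\<^sub>M i\<in>{..<t}. row_gauss n)"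
    and s: "(\<lambda>\<omega>. fst (snd (snd \<omega>))) \<in> ?M \<rightarrow>\<^sub>M sign_space n t"
    and p: "(\<lambda>\<omega>. snd (snd (snd \<omega>))) \<in> ?M \<rightarrow>\<^sub>M measure_pmf (pmf_of_set {p. p permutes {..<n}})"
    unfolding boot_space_def by measurable
  have f: "?f q \<in> borel_measurable ?M" for q
    by (rule borel_measurable_boot_err[OF gauss_coordinates(2)[OF X] gauss_coordinates(2)[OF w]
          borel_measurable_PiM_PiM_coordinate[OF rad s]])
  have "(\<lambda>q. restrict q {..<n}) \<in> measure_pmf (pmf_of_set {p. p permutes {..<n}}) \<rightarrow>\<^sub>M count_space ({..<n} \<rightarrow>\<^sub>E UNIV)"
    by (auto simp: measurable_pmf_measure1)
  then have r: "?r \<in> ?M \<rightarrow>\<^sub>M count_space ({..<n} \<rightarrow>\<^sub>E UNIV)"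
    by (rule measurable_compose[OF p])
  have "(\<lambda>\<omega>. ?f (?r \<omega>) \<omega>) \<in> borel_measurable ?M"
    by (rule measurable_compose_countable'[OF f r]) (simp add: countable_PiE)
  moreover have "(\<lambda>(X, w, s, p). boot_err d n t \<beta> \<eta> X w s p t j) = (\<lambda>\<omega>. ?f (?r \<omega>) \<omega>)"
  proof (rule ext, clarify)
    fix X w s and p :: "nat \<Rightarrow> nat"
    have "part_set n t p i = part_set n t (restrict p {..<n}) i" if "i < t" for i
      using part_set_id_subset[OF that, of n] unfolding part_set_image[of n t p] part_set_image[of n t "restrict p {..<n}"]
      by (intro image_cong) auto
    then show "boot_err d n t \<beta> \<eta> X w s p t j = ?f (?r (X, w, s, p)) (X, w, s, p)"
      by (simp add: boot_err_cong[of t n t p X X w w "restrict p {..<n}"])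
  qed
  ultimately show ?thesis by simp
qed

text \<open>The short stages bring the squared error down to 1 + 1/15 \<le> 3, and the last stage
  multiplies 1 + 3 by d times its squared window.\<close>

lemma boot_err_final_bound:
  fixes \<theta> :: "nat \<Rightarrow> real" and \<beta> :: "nat \<Rightarrow> real"
  assumes d: "d \<ge> 1" and t: "2 \<le> t" "ln \<Delta> \<le> real t" and \<Delta>: "0 < \<Delta>" "sqrt (\<Sum>j<d. (\<beta> j)\<^sup>2) \<le> \<Delta> / 3"
    and \<theta>: "\<And>i. i + 1 < t \<Longrightarrow> \<theta> i = 1 / (4 * sqrt d)" "0 \<le> \<theta> (t - 1)"
    and ok: "\<And>i. i < t \<Longrightarrow> \<not> stage_fails d n t \<beta> \<eta> (\<theta> i) X w s p i"
  shows "(\<Sum>j<d. (boot_err d n t \<beta> \<eta> X w s p t j)\<^sup>2) \<le> 4 * real d * (\<theta> (t - 1))\<^sup>2"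
proof -
  define \<rho> where "\<rho> = (\<lambda>i. \<Sum>j<d. (boot_err d n t \<beta> \<eta> X w s p i j)\<^sup>2)"
  have \<rho>0: "0 \<le> \<rho> i" for i by (simp add: \<rho>_def sum_nonneg)
  have step: "\<rho> (Suc i) \<le> real d * (\<theta> i)\<^sup>2 * (1 + \<rho> i)" if "i < t" for i
  proof -
    have "0 \<le> \<theta> i"
    proof (cases "i + 1 < t")
      case False
      then have "i = t - 1" using that by simp
      then show ?thesis using \<theta>(2) by simp
    qed (simp add: \<theta>(1))
    then show ?thesis using stage_contraction[OF ok[OF that]] by (simp add: \<rho>_def)
  qed
  \<comment> \<open>1/15 is the fixed point of x = (1 + x) / 16.\<close>
  have geo: "\<rho> i \<le> \<rho> 0 / 16 ^ i + 1/15" if "i \<le> t - 1" for i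
    using that
  proof (induction i)
    case (Suc i)
    then have i: "i + 1 < t" by simp
    have e: "real d * (\<theta> i)\<^sup>2 = 1/16"
      using d by (simp add: \<theta>(1)[OF i] power_divide power_mult_distrib)
    have "\<rho> (Suc i) \<le> (1/16) * (1 + \<rho> i)" using step[of i] i unfolding e by simp
    also have "\<dots> \<le> (1/16) * (1 + (\<rho> 0 / 16 ^ i + 1/15))" using Suc by simp
    also have "\<dots> = \<rho> 0 / 16 ^ Suc i + 1/15" by simp
    finally show ?case .
  qed simp
  \<comment> \<open>The 3 in the hypothesis on \<Delta> supplies the division by 9, which matches
    the t - 1 short stages: (exp t / 3)^2 \<le> 9^t / 9.\<close>
  have "\<rho> 0 \<le> 16 ^ (t - 1)"
  proof -
    have "\<Delta> = exp (ln \<Delta>)" using \<Delta>(1) by simp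
    also have "\<dots> \<le> exp (real t)" using t(2) by simp
    finally have D: "\<Delta> \<le> exp (real t)" .
    have "\<rho> 0 = (sqrt (\<Sum>j<d. (\<beta> j)\<^sup>2))\<^sup>2" by (simp add: \<rho>_def boot_err_0 sum_nonneg)
    also have "\<dots> \<le> (\<Delta> / 3)\<^sup>2" using \<Delta>(2) by (intro power_mono) (auto simp: sum_nonneg)
    also have "\<dots> \<le> (exp (real t) / 3)\<^sup>2" using D \<Delta>(1) by (intro power_mono divide_right_mono) auto
    also have "\<dots> = (exp 1 ^ t)\<^sup>2 / 9" by (simp add: exp_of_nat_mult[symmetric] power_divide)
    also have "\<dots> = ((exp 1)\<^sup>2) ^ t / 9" by (simp only: power_mult[symmetric] mult.commute)
    also have "\<dots> \<le> (3\<^sup>2) ^ t / 9" using exp_le by (intro divide_right_mono power_mono) auto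
    also have "\<dots> = 9 ^ (t - 1)" using t(1) by (cases t) auto
    also have "\<dots> \<le> 16 ^ (t - 1)" by (intro power_mono) auto
    finally show ?thesis .
  qed
  then have "\<rho> 0 / 16 ^ (t - 1) \<le> 1" by (simp add: divide_le_eq)
  then have "\<rho> (t - 1) \<le> 3" using geo[OF order.refl] by linarith
  moreover have "\<rho> t \<le> real d * (\<theta> (t - 1))\<^sup>2 * (1 + \<rho> (t - 1))"
    using step[of "t - 1"] t(1) by simp
  ultimately have "\<rho> t \<le> real d * (\<theta> (t - 1))\<^sup>2 * 4"
    by (elim order.trans) (intro mult_left_mono, auto)
  then show ?thesis by (simp add: \<rho>_def mult_ac)
qed

theorem mainTheorem4:
  shows "\<exists>C C' :: real. C > 0 \<and> C' > 0 \<and>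
    (\<forall>(d::nat) (n::nat) (\<beta>::nat \<Rightarrow> real) (\<eta>::nat \<Rightarrow> real) (\<alpha>::real) (\<Delta>::real) (\<epsilon>::real).
       d \<ge> 1 \<and> 0 < \<alpha> \<and> \<alpha> \<le> 1 \<and>
       real (card {i. i < n \<and> \<bar>\<eta> i\<bar> \<le> 1}) \<ge> \<alpha> * real n \<and>
       \<Delta> \<ge> 3 * (1 + sqrt (\<Sum>j<d. (\<beta> j)\<^sup>2)) \<and>
       0 < \<epsilon> \<and> \<epsilon> \<le> 1/2 \<and>
       real n \<ge> C * (real d * ln \<Delta> / \<alpha>\<^sup>2) * (ln (real d / \<epsilon>) + ln (ln \<Delta>))
     \<longrightarrow>
       measure (boot_space n d (boot_t \<Delta>))
         {\<omega> \<in> space (boot_space n d (boot_t \<Delta>)).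
            (case \<omega> of (X, w, s, p) \<Rightarrow>
              (let y = (\<lambda>i. (\<Sum>j<d. X i j * \<beta> j) + \<eta> i);
                   \<beta>h = boot_median d n \<Delta> y X w s p
               in (1 / real n) * (\<Sum>i<n. (\<Sum>j<d. X i j * (\<beta> j - \<beta>h j))\<^sup>2)
                    \<le> C' * real d * ln (real d / \<epsilon>) / (\<alpha>\<^sup>2 * real n)))}
       \<ge> 1 - \<epsilon>)"
proof (rule exI[of _ "768 * 160000"], rule exI[of _ "144 * 24 * 160000"], intro conjI allI impI)
  fix d n :: nat and \<beta> \<eta> :: "nat \<Rightarrow> real" and \<alpha> \<Delta> \<epsilon> :: real
  assume H: "d \<ge> 1 \<and> 0 < \<alpha> \<and> \<alpha> \<le> 1 \<and>
       real (card {i. i < n \<and> \<bar>\<eta> i\<bar> \<le> 1}) \<ge> \<alpha> * real n \<and>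
       \<Delta> \<ge> 3 * (1 + sqrt (\<Sum>j<d. (\<beta> j)\<^sup>2)) \<and>
       0 < \<epsilon> \<and> \<epsilon> \<le> 1/2 \<and>
       real n \<ge> 768 * 160000 * (real d * ln \<Delta> / \<alpha>\<^sup>2) * (ln (real d / \<epsilon>) + ln (ln \<Delta>))"
  define t where "t = boot_t \<Delta>"
  define a where "a = ln (real d / \<epsilon>)"
  \<comment> \<open>The squared window of the last stage, as small as its failure probability
    allows. The sample size keeps it at most 1, as a window parameter must be.\<close>
  define K where "K = 24 * 160000 * a / (\<alpha>\<^sup>2 * real n)"
  define \<theta> where "\<theta> = (\<lambda>i. if i + 1 < t then 1 / (4 * sqrt (real d)) else sqrt K)"
  have norm\<beta>: "0 \<le> sqrt (\<Sum>j<d. (\<beta> j)\<^sup>2)" by (simp add: sum_nonneg)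
  have "\<Delta> \<ge> 3 * (1 + sqrt (\<Sum>j<d. (\<beta> j)\<^sup>2))" using H by blast
  moreover have "3 * (1 + x) \<le> y \<Longrightarrow> 0 \<le> x \<Longrightarrow> 3 \<le> y \<and> x \<le> y / 3" for x y :: real by auto
  ultimately have \<Delta>3: "\<Delta> \<ge> 3" "sqrt (\<Sum>j<d. (\<beta> j)\<^sup>2) \<le> \<Delta> / 3" using norm\<beta> by blast+
  have d: "1 \<le> d" and \<alpha>: "0 < \<alpha>" "\<alpha> \<le> 1" and \<epsilon>: "0 < \<epsilon>" "\<epsilon> \<le> 1/2"
    and G: "real (card {i. i < n \<and> \<bar>\<eta> i\<bar> \<le> 1}) \<ge> \<alpha> * real n"
    and n: "real n \<ge> 768 * 160000 * (real d * ln \<Delta> / \<alpha>\<^sup>2) * (ln (real d / \<epsilon>) + ln (ln \<Delta>))"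
    using H by blast+
  note B = sample_size_bounds[OF d \<alpha> \<Delta>3(1) \<epsilon> t_def n, folded a_def, folded K_def]
  have t2: "2 \<le> t" and n0: "0 < n" using B by auto
  have K: "0 \<le> K" "K \<le> 1" using B(1,8) by (auto simp: K_def)
  have \<theta>01: "0 \<le> \<theta> i \<and> \<theta> i \<le> 1" for i
  proof -
    have "1 \<le> sqrt (real d)" using d by simp
    moreover have "1 \<le> x \<Longrightarrow> 1 / (4 * x) \<le> 1" for x :: real by (simp add: divide_le_eq)
    ultimately have "1 / (4 * sqrt (real d)) \<le> 1" by blast
    then show ?thesis using K by (auto simp: \<theta>_def)
  qed
  let ?M = "boot_space n d t"
  let ?bound = "144 * 24 * 160000 * real d * ln (real d / \<epsilon>) / (\<alpha>\<^sup>2 * real n)"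
  let ?loss = "\<lambda>\<omega>. case \<omega> of (X, w, s, p) \<Rightarrow>
     (1 / real n) * (\<Sum>i<n. (\<Sum>j<d. X i j * boot_err d n t \<beta> \<eta> X w s p t j)\<^sup>2)"
  let ?Good = "{\<omega> \<in> space ?M. ?loss \<omega> \<le> ?bound}"
  interpret M: prob_space ?M
    unfolding boot_space_def
    by (intro prob_space_pair prob_space_PiM prob_space_std_gauss prob_space_rademacher prob_space_measure_pmf)
  have loss_meas: "?loss \<in> borel_measurable ?M"
  proof -
    have X: "(\<lambda>\<omega>. fst \<omega> i j) \<in> borel_measurable ?M" for i j
      unfolding boot_space_def by (rule gauss_coordinates(2)[OF measurable_fst])
    note [measurable] = X borel_measurable_boot_err_boot_space[of d n t \<beta> \<eta>]
    have "(\<lambda>\<omega>. (1 / real n) * (\<Sum>i<n. (\<Sum>j<d. fst \<omega> i j * (case \<omega> of (X, w, s, p) \<Rightarrow> boot_err d n t \<beta> \<eta> X w s p t j))\<^sup>2)) \<in> borel_measurable ?M"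
      by measurable
    then show ?thesis by (simp add: case_prod_beta')
  qed
  then have Good: "?Good \<in> sets ?M" by measurable
  have "emeasure ?M (space ?M - ?Good) \<le> ennreal (exp (11 * real d - real n / 2)
    + (\<Sum>i<t. 2 * real d * exp (- real (card (part_set n t id i)) * (\<theta> i)\<^sup>2 * \<alpha>\<^sup>2 / 160000))
    + (\<Sum>i<t. exp (- real (card (part_set n t id i)) * \<alpha>\<^sup>2 / 16)))"
  proof (rule emeasure_boot_space_le[where \<beta> = \<beta>, OF _ n0 \<theta>01 \<alpha> G])
    show "space ?M - ?Good \<in> sets ?M" by (rule sets.compl_sets[OF Good])
    fix X w s p
    assume bad: "(X, w, s, p) \<in> space ?M - ?Good"
    show "(\<exists>z\<in>lattice_net d. 9 * real n < (\<Sum>k<n. (\<Sum>i<d. X k i * (z i / (2 * sqrt d)))\<^sup>2)) \<or>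
        (\<exists>i<t. stage_fails d n t \<beta> \<eta> (\<theta> i) X w s p i)"
    proof (rule ccontr)
      assume N: "\<not> ?thesis"
      have net: "(\<Sum>k<n. (\<Sum>i<d. X k i * (z i / (2 * sqrt d)))\<^sup>2) \<le> 9 * real n" if "z \<in> lattice_net d" for z
        using N that by (meson not_less)
      have ok: "\<not> stage_fails d n t \<beta> \<eta> (\<theta> i) X w s p i" if "i < t" for i
        using N that by blast
      let ?r = "boot_err d n t \<beta> \<eta> X w s p t"
      \<comment> \<open>The error vector depends on \<open>X\<close>, so the uniform norm bound is
        applied rather than concentration for a fixed vector.\<close>
      have "(\<Sum>k<n. (\<Sum>i<d. X k i * ?r i)\<^sup>2) \<le> 4 * (9 * real n) * (\<Sum>i<d. (?r i)\<^sup>2)"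
        using d by (intro matrix_norm_from_net net) auto
      also have "\<dots> \<le> 4 * (9 * real n) * (4 * real d * (\<theta> (t - 1))\<^sup>2)"
        using d t2 B(3) \<Delta>3 K(1) ok by (intro mult_left_mono boot_err_final_bound[where \<Delta> = \<Delta>]) (auto simp: \<theta>_def)
      also have "(\<theta> (t - 1))\<^sup>2 = K" using K t2 by (simp add: \<theta>_def)
      finally have "(1 / real n) * (\<Sum>k<n. (\<Sum>i<d. X k i * ?r i)\<^sup>2) \<le> (1 / real n) * (4 * (9 * real n) * (4 * real d * K))"
        by (intro mult_left_mono) auto
      \<comment> \<open>144 = 4 * 9 * 4: passing from the net to all vectors, the threshold 9 n on
        the net, and the last stage. The factor 24 * 160000 comes from \<open>K\<close>.\<close>
      also have "\<dots> = ?bound" using n0 by (simp add: K_def a_def mult_ac)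
      finally show False using bad by simp
    qed
  qed
  also have "\<dots> \<le> ennreal \<epsilon>"
  proof (rule ennreal_leI)
    define Y where "Y = 2 * real d * exp (- real (n div (2 * t)) * (1 / (16 * real d)) * \<alpha>\<^sup>2 / 160000)"
    define Z where "Z = 2 * real d * exp (- real (n div 2) * K * \<alpha>\<^sup>2 / 160000)"
    obtain t' where t': "t = Suc t'" using t2 by (cases t) auto
    have "(\<Sum>i<t. 2 * real d * exp (- real (card (part_set n t id i)) * (\<theta> i)\<^sup>2 * \<alpha>\<^sup>2 / 160000)) = (\<Sum>i<t. if i + 1 < t then Y else Z)"
      using d K by (intro sum.cong refl) (auto simp: card_part_set_id \<theta>_def Y_def Z_def power_divide power_mult_distrib)
    also have "\<dots> = real t' * Y + Z" by (simp add: t')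
    also have "\<dots> \<le> real t * Y + Z" by (intro add_right_mono mult_right_mono) (auto simp: t' Y_def)
    also have "\<dots> \<le> \<epsilon> / 8 + \<epsilon> / 16" using B(7,10) by (intro add_mono) (simp_all add: Y_def Z_def mult_ac)
    finally have 1: "(\<Sum>i<t. 2 * real d * exp (- real (card (part_set n t id i)) * (\<theta> i)\<^sup>2 * \<alpha>\<^sup>2 / 160000)) \<le> \<epsilon> / 8 + \<epsilon> / 16" .
    have "(\<Sum>i<t. exp (- real (card (part_set n t id i)) * \<alpha>\<^sup>2 / 16)) \<le> (\<Sum>i<t. exp (- real (n div (2 * t)) * \<alpha>\<^sup>2 / 16))"
      using B(12) by (intro sum_mono) (auto simp: card_part_set_id intro!: mult_right_mono divide_right_mono)
    also have "\<dots> \<le> \<epsilon> / 16" using B(11) by simp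
    finally have 2: "(\<Sum>i<t. exp (- real (card (part_set n t id i)) * \<alpha>\<^sup>2 / 16)) \<le> \<epsilon> / 16" .
    \<comment> \<open>The budget is \<epsilon>/32 for the matrix norm, \<epsilon>/8 for the short
      stages, \<epsilon>/16 for the last stage and \<epsilon>/16 for the partition.\<close>
    show "exp (11 * real d - real n / 2)
      + (\<Sum>i<t. 2 * real d * exp (- real (card (part_set n t id i)) * (\<theta> i)\<^sup>2 * \<alpha>\<^sup>2 / 160000))
      + (\<Sum>i<t. exp (- real (card (part_set n t id i)) * \<alpha>\<^sup>2 / 16)) \<le> \<epsilon>"
      using 1 2 B(6) \<epsilon> by linarith
  qed
  finally have "M.prob (space ?M - ?Good) \<le> \<epsilon>"
    using \<epsilon> by (simp add: M.emeasure_eq_measure)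
  then have "1 - \<epsilon> \<le> M.prob ?Good" using M.prob_compl[OF Good] by linarith
  also have "?Good = {\<omega> \<in> space (boot_space n d (boot_t \<Delta>)).
            (case \<omega> of (X, w, s, p) \<Rightarrow>
              (let y = (\<lambda>i. (\<Sum>j<d. X i j * \<beta> j) + \<eta> i);
                   \<beta>h = boot_median d n \<Delta> y X w s p
               in (1 / real n) * (\<Sum>i<n. (\<Sum>j<d. X i j * (\<beta> j - \<beta>h j))\<^sup>2) \<le> ?bound))}"
    by (auto simp: t_def Let_def boot_err_def response_def boot_median_def)
  finally show "1 - \<epsilon> \<le> measure (boot_space n d (boot_t \<Delta>)) {\<omega> \<in> space (boot_space n d (boot_t \<Delta>)).
            (case \<omega> of (X, w, s, p) \<Rightarrow>
              (let y = (\<lambda>i. (\<Sum>j<d. X i j * \<beta> j) + \<eta> i);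
                   \<beta>h = boot_median d n \<Delta> y X w s p
               in (1 / real n) * (\<Sum>i<n. (\<Sum>j<d. X i j * (\<beta> j - \<beta>h j))\<^sup>2) \<le> ?bound))}"
    by (simp only: t_def)
qed simp_all

end
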